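(* Let $q$ be an odd prime and $k\ge 1$ an integer, and put $r=(k,q-1)$. Then $$\gamma_{k,q}=\gamma+O\Big(\frac{\log^3 q}{q^{1/r}\log\log q}+\frac{r\log^2 q}{\sqrt q}\Big),$$ where the implied constant is absolute.
   Context: $\gamma$ is the Euler–Mascheroni constant and $\sigma_k(n)=\sum_{d\mid n}d^k$. Let $T(s)=\sum_{n\ge1,\ q\nmid \sigma_k(n)}n^{-s}$ for $\Re(s)>1$. The constant $\gamma_{k,q}$ (Euler–Kronecker constant of the set $\{n\ge1: q\nmid\sigma_k(n)\}$) is defined as $\gamma_{k,q}=\lim_{s\to1^+}\big(\frac{T'}{T}(s)+\frac{\alpha}{s-1}\big)$, where $\alpha>0$ is the (unique) real number for which this limit exists and is finite. *)

theory Defs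
  imports "HOL-Analysis.Analysis" "HOL-Computational_Algebra.Primes"
begin

definition divisor_power_sum :: "nat \<Rightarrow> nat \<Rightarrow> nat" where
  "divisor_power_sum k n = (\<Sum>d | d dvd n. d ^ k)"

definition nondivisibility_set :: "nat \<Rightarrow> nat \<Rightarrow> nat set" where
  "nondivisibility_set k q = {n. n \<ge> 1 \<and> \<not> q dvd divisor_power_sum k n}"

(* For a set of positive integers the family is absolutely summable whenever Re s > 1;
   only such s matter below. *)
definition set_dirichlet_series :: "nat set \<Rightarrow> complex \<Rightarrow> complex" where
  "set_dirichlet_series A s = (\<Sum>\<^sub>\<infinity>n\<in>A. of_nat n powr (- s))"

(* Logarithmic derivative in the complex sense, restricted to the real axis. *)
definition regularized_log_deriv :: "nat set \<Rightarrow> real \<Rightarrow> real \<Rightarrow> complex" where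
  "regularized_log_deriv A \<alpha> x =
     deriv (set_dirichlet_series A) (of_real x) / set_dirichlet_series A (of_real x)
       + of_real (\<alpha> / (x - 1))"

definition euler_kronecker_exponent :: "nat set \<Rightarrow> real" where
  "euler_kronecker_exponent A =
     (THE \<alpha>. \<alpha> > 0 \<and> (\<exists>L. (regularized_log_deriv A \<alpha> \<longlongrightarrow> L) (at_right 1)))"

(* Complex-valued because the Dirichlet series is; where the limit exists it is real. *)
definition euler_kronecker_constant :: "nat set \<Rightarrow> complex" where
  "euler_kronecker_constant A =
     Lim (at_right 1) (regularized_log_deriv A (euler_kronecker_exponent A))"

end

(* Replacing k by r = gcd k (q - 1) does not change the set, and membership of n is a condition on
   each exponent separately: with g(p) the order of divisibility of 1 + p^r + p^(2r) + ... by q,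
   the number n belongs to the set iff g(p) divides a + 1 for no prime power p^a exactly dividing n.
   Hence T'/T = - sum (Lambda(n) - c(n)) n^(-s) with an explicit c supported on prime powers, and
   c = Lambda * h at all primes other than q, where h is the indicator of n^r = -1 (mod q) (suitably
   extended to multiples of q). The series of c - Lambda * h converges absolutely at 1; its size is
   bounded by counting the solutions of p^(r a) = 1 (mod q) below q. So everything reduces to the
   limit at 1 of sum Lambda(n) h(n) n^(-s) minus its pole.

   With m = (q - 1) / r, the function h vanishes off the multiples of q for odd m and is an
   alternating average of the m powers of a character for even m. For a non-real character L'/L is
   bounded in a disc of radius of order (log q)^(-9) about 1 by the 3-4-1 inequality, so the value
   of L'/L at 1 may be replaced by a combination of its values at 1 + eta, 1 + 2 eta, 1 + 3 eta with
   an error of order eta^3. Since eta may be as large as q^(-1/4), orthogonality turns this combination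
   into sums over the residue classes n^r = -1 (mod q) that are estimated trivially.
   For the quadratic character the bound L(1) >> q^(-1/2) suffices. It follows by comparing X L(1) / 2
   with the sum of (sum of chi(d) over d | n) (exp(-n/X) - exp(-2n/X)), which has nonnegative terms and is large
   because of the squares n; for X a large multiple of q, partial summation around a centre where the
   partial sums of chi have mean deviation at most sqrt q bounds the difference of the two. *)
theory Submission
  imports Defs "HOL-Complex_Analysis.Complex_Analysis" "HOL-Number_Theory.Number_Theory"
begin

section \<open>Dirichlet series\<close>

text \<open>The third difference is dictated by powers of log q. Estimating residue classes
  trivially at 1 + eta costs about r / (q eta^2), which is r / sqrt q when eta is a small multiple
  of q^(-1/4). The Taylor error per non-real character is a power of eta times a power of log q,
  because the zero-free disc has radius only (log q)^(-9). A second difference would leave q^(-1/2)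
  (log q)^27, more than the theorem allows; with the third, q^(-3/4) (log q)^36 is absorbed, and
  averaging over the m characters loses nothing. The quadratic character has weight 1/m, about r/q,
  so the crude bound sqrt q log^2 q for its L'/L at 1 gives r log^2 q / sqrt q, the second error
  term. The first error term comes from powers p^a of primes p small against q: O(r a) primes share
  a given local exponent a, each p^a is at least about q^(1/r), and only exponents up to about log q
  / log log q matter. This is the source of log log q in the denominator.\<close>

definition ds :: "(nat \<Rightarrow> complex) \<Rightarrow> complex \<Rightarrow> complex" where
  "ds f s = (\<Sum>n. f n * of_nat n powr (- s))"

text \<open>Growth below every positive power gives absolute convergence for Re s > 1 and, unlike
  boundedness, survives multiplication by \<open>ln\<close>. The index 0 is exempt because
  \<open>0 powr z = 0\<close> removes that term from \<open>ds\<close>.\<close>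

definition subpoly :: "(nat \<Rightarrow> complex) \<Rightarrow> bool" where
  "subpoly f \<longleftrightarrow> (\<forall>\<epsilon>>0. \<exists>B. \<forall>n>0. norm (f n) \<le> B * real n powr \<epsilon>)"

lemma subpolyD:
  assumes "subpoly f" "\<epsilon> > 0"
  obtains B where "B > 0" "\<And>n. n > 0 \<Longrightarrow> norm (f n) \<le> B * real n powr \<epsilon>"
proof -
  from assms obtain B where B: "\<And>n. n > 0 \<Longrightarrow> norm (f n) \<le> B * real n powr \<epsilon>"
    unfolding subpoly_def by blast
  show ?thesis
  proof (rule that[of "max 1 B"])
    fix n :: nat assume "n > 0"
    with B[of n] have "norm (f n) \<le> B * real n powr \<epsilon>" by simp
    also have "\<dots> \<le> max 1 B * real n powr \<epsilon>" by (intro mult_right_mono) auto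
    finally show "norm (f n) \<le> max 1 B * real n powr \<epsilon>" .
  qed auto
qed

lemma subpoly_bounded:
  assumes "\<And>n. n > 0 \<Longrightarrow> norm (f n) \<le> B"
  shows "subpoly f"
  unfolding subpoly_def
proof (intro allI impI exI[of _ "max 0 B"])
  fix \<epsilon> :: real and n :: nat assume "\<epsilon> > 0" "n > 0"
  have "norm (f n) \<le> max 0 B * 1" using assms[OF \<open>n > 0\<close>] by simp
  also have "\<dots> \<le> max 0 B * real n powr \<epsilon>"
    using \<open>n > 0\<close> \<open>\<epsilon> > 0\<close> by (intro mult_left_mono ge_one_powr_ge_zero) auto
  finally show "norm (f n) \<le> max 0 B * real n powr \<epsilon>" .
qed

lemma subpoly_ln: "subpoly (\<lambda>n. of_real (ln (real n)))"
  unfolding subpoly_def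
proof (intro allI impI)
  fix \<epsilon> :: real assume "\<epsilon> > 0"
  have "\<forall>n>0. cmod (complex_of_real (ln (real n))) \<le> inverse \<epsilon> * real n powr \<epsilon>"
  proof (intro allI impI)
    fix n :: nat assume "n > 0"
    then have "ln (real n) \<le> real n powr \<epsilon> / \<epsilon>" using \<open>\<epsilon> > 0\<close> by (intro ln_powr_bound) auto
    moreover have "ln (real n) \<ge> 0" using \<open>n > 0\<close> by simp
    ultimately show "cmod (complex_of_real (ln (real n))) \<le> inverse \<epsilon> * real n powr \<epsilon>"
      by (simp add: field_simps)
  qed
  then show "\<exists>B. \<forall>n>0. cmod (complex_of_real (ln (real n))) \<le> B * real n powr \<epsilon>" by blast
qed

lemma subpoly_mult:
  assumes "subpoly f" "subpoly g"
  shows "subpoly (\<lambda>n. f n * g n)"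
  unfolding subpoly_def
proof (intro allI impI)
  fix \<epsilon> :: real assume e: "\<epsilon> > 0"
  obtain B where B: "B > 0" "\<And>n. n > 0 \<Longrightarrow> norm (f n) \<le> B * real n powr (\<epsilon>/2)"
    using subpolyD[OF assms(1), of "\<epsilon>/2"] e by auto
  obtain B' where B': "B' > 0" "\<And>n. n > 0 \<Longrightarrow> norm (g n) \<le> B' * real n powr (\<epsilon>/2)"
    using subpolyD[OF assms(2), of "\<epsilon>/2"] e by auto
  have "norm (f n * g n) \<le> (B * B') * real n powr \<epsilon>" if "n > 0" for n
  proof -
    have "norm (f n * g n) \<le> (B * real n powr (\<epsilon>/2)) * (B' * real n powr (\<epsilon>/2))"
      unfolding norm_mult using B B' that by (intro mult_mono) auto
    also have "\<dots> = (B * B') * (real n powr (\<epsilon>/2) * real n powr (\<epsilon>/2))" by simp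
    also have "real n powr (\<epsilon>/2) * real n powr (\<epsilon>/2) = real n powr \<epsilon>"
      by (subst powr_add[symmetric]) simp
    finally show ?thesis .
  qed
  then show "\<exists>B. \<forall>n>0. norm (f n * g n) \<le> B * real n powr \<epsilon>" by blast
qed

lemma subpoly_add:
  assumes "subpoly f" "subpoly g"
  shows "subpoly (\<lambda>n. f n + g n)"
  unfolding subpoly_def
proof (intro allI impI)
  fix \<epsilon> :: real assume e: "\<epsilon> > 0"
  obtain B where B: "B > 0" "\<And>n. n > 0 \<Longrightarrow> norm (f n) \<le> B * real n powr \<epsilon>"
    using subpolyD[OF assms(1) e] by auto
  obtain B' where B': "B' > 0" "\<And>n. n > 0 \<Longrightarrow> norm (g n) \<le> B' * real n powr \<epsilon>"
    using subpolyD[OF assms(2) e] by auto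
  have "norm (f n + g n) \<le> (B + B') * real n powr \<epsilon>" if "n > 0" for n
    using norm_triangle_ineq[of "f n" "g n"] B(2)[OF that] B'(2)[OF that] by (simp add: algebra_simps)
  then show "\<exists>B. \<forall>n>0. norm (f n + g n) \<le> B * real n powr \<epsilon>" by blast
qed

lemma subpoly_mono:
  assumes "subpoly g" "\<And>n. n > 0 \<Longrightarrow> norm (f n) \<le> C * norm (g n)"
  shows "subpoly f"
  unfolding subpoly_def
proof (intro allI impI)
  fix \<epsilon> :: real assume e: "\<epsilon> > 0"
  obtain B where B: "B > 0" "\<And>n. n > 0 \<Longrightarrow> norm (g n) \<le> B * real n powr \<epsilon>"
    using subpolyD[OF assms(1) e] by auto
  have "norm (f n) \<le> (max 0 C * B) * real n powr \<epsilon>" if "n > 0" for n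
  proof -
    have "norm (f n) \<le> C * norm (g n)" using assms(2) that by simp
    also have "\<dots> \<le> max 0 C * norm (g n)" by (intro mult_right_mono) auto
    also have "\<dots> \<le> max 0 C * (B * real n powr \<epsilon>)" using B that by (intro mult_left_mono) auto
    finally show ?thesis by (simp add: mult_ac)
  qed
  then show "\<exists>B. \<forall>n>0. norm (f n) \<le> B * real n powr \<epsilon>" by blast
qed

lemma norm_of_nat_powr_minus:
  "norm (of_nat n powr (- s) :: complex) = real n powr (- Re s)"
  by (cases "n = 0") (simp_all add: norm_powr_real_powr)

text \<open>Half of the margin \<sigma> - 1 absorbs the growth of the coefficients and half stays
  for convergence. The majorant does not depend on s, which serves both termwise differentiation and
  limits under the sum.\<close>

lemma subpoly_norm_bound:
  assumes "subpoly f" "\<sigma> > 1"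
  obtains B where "B > 0"
    "\<And>n s. Re s \<ge> \<sigma> \<Longrightarrow> norm (f n * of_nat n powr (- s)) \<le> B * real n powr (- ((1 + \<sigma>) / 2))"
proof -
  obtain B where B: "B > 0" "\<And>n. n > 0 \<Longrightarrow> norm (f n) \<le> B * real n powr ((\<sigma> - 1)/2)"
    using subpolyD[OF assms(1), of "(\<sigma>-1)/2"] assms(2) by auto
  show ?thesis
  proof (rule that[OF B(1)])
    fix n :: nat and s :: complex assume s: "Re s \<ge> \<sigma>"
    show "norm (f n * of_nat n powr (- s)) \<le> B * real n powr (- ((1 + \<sigma>) / 2))"
    proof (cases "n = 0")
      case False
      then have n: "n > 0" by simp
      have "norm (f n * of_nat n powr (- s)) = norm (f n) * real n powr (- Re s)"
        by (simp add: norm_mult norm_of_nat_powr_minus)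
      also have "\<dots> \<le> (B * real n powr ((\<sigma> - 1)/2)) * real n powr (- \<sigma>)"
        using B n s by (intro mult_mono powr_mono) auto
      also have "\<dots> = B * (real n powr ((\<sigma> - 1)/2) * real n powr (- \<sigma>))" by simp
      also have "real n powr ((\<sigma> - 1)/2) * real n powr (- \<sigma>) = real n powr (- ((1 + \<sigma>) / 2))"
        by (subst powr_add[symmetric], rule arg_cong[where f = "\<lambda>x. real n powr x"]) (simp add: field_simps)
      finally show ?thesis .
    qed (use B in auto)
  qed
qed

lemma summable_norm_ds:
  assumes "subpoly f" "Re s > 1"
  shows "summable (\<lambda>n. norm (f n * of_nat n powr (- s)))"
proof -
  obtain B where B: "B > 0"
    "\<And>n s'. Re s' \<ge> Re s \<Longrightarrow> norm (f n * of_nat n powr (- s')) \<le> B * real n powr (- ((1 + Re s) / 2))"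
    using subpoly_norm_bound[OF assms] by blast
  show ?thesis
  proof (rule summable_comparison_test'[where N = 0])
    show "summable (\<lambda>n. B * real n powr (- ((1 + Re s) / 2)))"
      using assms(2) by (intro summable_mult) (simp add: summable_real_powr_iff)
  qed (use B in auto)
qed

lemma summable_ds:
  assumes "subpoly f" "Re s > 1"
  shows "summable (\<lambda>n. f n * of_nat n powr (- s))"
  using summable_norm_ds[OF assms] by (rule summable_norm_cancel)

lemma ds_add:
  assumes "subpoly f" "subpoly g" "Re s > 1"
  shows "ds (\<lambda>n. f n + g n) s = ds f s + ds g s"
  unfolding ds_def using suminf_add[OF summable_ds[OF assms(1,3)] summable_ds[OF assms(2,3)]]
  by (simp add: algebra_simps)

lemma ds_cmult:
  assumes "subpoly f" "Re s > 1"
  shows "ds (\<lambda>n. c * f n) s = c * ds f s"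
  unfolding ds_def using suminf_mult[OF summable_ds[OF assms], of c]
  by (simp add: algebra_simps)

text \<open>Termwise differentiation on the half plane to the right of the midpoint between 1 and Re
  s, where the differentiated series has a uniform majorant.\<close>

lemma ds_has_field_derivative:
  assumes f: "subpoly f" and s: "Re s > 1"
  shows "(ds f has_field_derivative - ds (\<lambda>n. of_real (ln (real n)) * f n) s) (at s)"
proof -
  define \<sigma> where "\<sigma> = (1 + Re s) / 2"
  define S where "S = {z. Re z > \<sigma>}"
  have \<sigma>: "\<sigma> > 1" "Re s > \<sigma>" using s by (auto simp: \<sigma>_def)
  have fl: "subpoly (\<lambda>n. of_real (ln (real n)) * f n)" by (rule subpoly_mult[OF subpoly_ln f])
  obtain B where B: "B > 0"
    "\<And>n s'. Re s' \<ge> \<sigma> \<Longrightarrow> norm (of_real (ln (real n)) * f n * of_nat n powr (- s')) \<le> B * real n powr (- ((1 + \<sigma>) / 2))"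
    using subpoly_norm_bound[OF fl \<sigma>(1)] by blast
  have "((\<lambda>s. \<Sum>n. f n * of_nat n powr (- s)) has_field_derivative
          (\<Sum>n. - (of_real (ln (real n)) * f n * of_nat n powr (- s)))) (at s)"
  proof (rule has_field_derivative_series'(2)[where S = S and ?x0.0 = s])
    show "convex S" unfolding S_def by (rule convex_halfspace_Re_gt)
    show "((\<lambda>s. f n * of_nat n powr (- s)) has_field_derivative
           - (of_real (ln (real n)) * f n * of_nat n powr (- x))) (at x within S)" if "x \<in> S" for n x
    proof (cases "n = 0")
      case False
      have "((\<lambda>s. exp (- s * Ln (of_nat n))) has_field_derivative
           exp (- x * Ln (of_nat n)) * (- Ln (of_nat n))) (at x within S)"
        by (auto intro!: derivative_eq_intros)
      from DERIV_cmult[OF this, of "f n"] have "((\<lambda>s. f n * of_nat n powr (- s)) has_field_derivative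
           f n * (of_nat n powr (- x) * (- Ln (of_nat n)))) (at x within S)"
        using False by (simp add: powr_def)
      also have "f n * (of_nat n powr (- x) * (- Ln (of_nat n))) = - (of_real (ln (real n)) * f n * of_nat n powr (- x))"
        using False by (simp add: Ln_of_nat)
      finally show ?thesis .
    qed simp
    show "uniformly_convergent_on S (\<lambda>n x. \<Sum>i<n. - (of_real (ln (real i)) * f i * of_nat i powr (- x)))"
    proof (rule Weierstrass_m_test'_ev[OF always_eventually])
      show "\<forall>n. \<forall>x\<in>S. norm (- (of_real (ln (real n)) * f n * of_nat n powr (- x))) \<le> B * real n powr (- ((1 + \<sigma>) / 2))"
        using B by (auto simp: S_def)
      show "summable (\<lambda>n. B * real n powr (- ((1 + \<sigma>) / 2)))"
        using \<sigma>(1) by (intro summable_mult) (simp add: summable_real_powr_iff)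
    qed
    show "s \<in> S" using \<sigma> by (simp add: S_def)
    have "open S" unfolding S_def by (rule open_halfspace_Re_gt)
    then show "s \<in> interior S" using \<open>s \<in> S\<close> by (simp add: interior_open)
    show "summable (\<lambda>n. f n * of_nat n powr (- s))" using f s by (rule summable_ds)
  qed
  moreover have "(\<Sum>n. - (of_real (ln (real n)) * f n * of_nat n powr (- s))) = - ds (\<lambda>n. of_real (ln (real n)) * f n) s"
    unfolding ds_def using summable_ds[OF fl s] by (rule suminf_minus)
  ultimately show ?thesis by (simp add: ds_def[abs_def])
qed

text \<open>Regroups an absolutely convergent double series along the hyperbolas ab = n. It yields
  products of Dirichlet series and, later, the divisor sums of the quadratic character with
  exponential weights.\<close>

lemma has_sum_divisor_pairs:
  fixes F :: "nat \<Rightarrow> nat \<Rightarrow> complex"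
  assumes "(\<lambda>(a,b). norm (F a b)) summable_on ({1..} \<times> {1..})"
  shows "((\<lambda>n. \<Sum>d | d dvd n. F d (n div d)) has_sum (\<Sum>\<^sub>\<infinity>(a,b)\<in>{1..} \<times> {1..}. F a b)) {1..}"
proof -
  let ?S = "Sigma {1..} (\<lambda>n. {d. d dvd n}) :: (nat \<times> nat) set"
  have bij: "bij_betw (\<lambda>(n,d). (d, n div d)) ?S ({1..} \<times> {1..})"
  proof (rule bij_betwI[where g = "\<lambda>(a,b). (a*b,a)"])
    show "(\<lambda>(n,d). (d, n div d)) \<in> ?S \<rightarrow> {1..} \<times> {1..}"
    proof
      fix x assume "x \<in> ?S"
      then obtain n d where x: "x = (n, d)" "n > 0" "d dvd n" by auto
      then have "d > 0" using dvd_pos_nat by blast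
      moreover have "n div d > 0" using x by (simp add: div_greater_zero_iff dvd_imp_le dvd_pos_nat)
      ultimately have "d > 0" "n div d > 0" by auto
      then show "(case x of (n, d) \<Rightarrow> (d, n div d)) \<in> {1..} \<times> {1..}" using x by simp
    qed
    show "(\<lambda>(a,b). (a * b, a)) \<in> {1..} \<times> {1..} \<rightarrow> ?S" by force
    show "(case case x of (n, d) \<Rightarrow> (d, n div d) of (a, b) \<Rightarrow> (a * b, a)) = x" if "x \<in> ?S" for x :: "nat \<times> nat"
      using that by auto
    show "(case case y of (a, b) \<Rightarrow> (a * b, a) of (n, d) \<Rightarrow> (d, n div d)) = y" if y: "y \<in> {1..} \<times> {1..}" for y :: "nat \<times> nat"
    proof -
      obtain a b where "y = (a, b)" "a \<noteq> 0" using y by (cases y) auto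
      then show ?thesis by simp
    qed
  qed
  have "((\<lambda>(a,b). F a b) has_sum (\<Sum>\<^sub>\<infinity>(a,b)\<in>{1..} \<times> {1..}. F a b)) ({1..} \<times> {1..})"
    by (rule has_sum_infsum, rule abs_summable_summable) (use assms in \<open>simp add: case_prod_unfold\<close>)
  with has_sum_reindex_bij_betw[OF bij, of "\<lambda>(a,b). F a b" "\<Sum>\<^sub>\<infinity>(a,b)\<in>{1..} \<times> {1..}. F a b"]
  have hs: "((\<lambda>(n,d). F d (n div d)) has_sum (\<Sum>\<^sub>\<infinity>(a,b)\<in>{1..} \<times> {1..}. F a b)) ?S"
    by (simp only: case_prod_unfold fst_conv snd_conv)
  show ?thesis
  proof (rule has_sum_Sigma'[OF hs])
    fix n :: nat assume "n \<in> {1..}"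
    then have "finite {d. d dvd n}" by auto
    then show "((\<lambda>y. case (n, y) of (n, d) \<Rightarrow> F d (n div d)) has_sum (\<Sum>d | d dvd n. F d (n div d))) {d. d dvd n}"
      using has_sum_finite[of "{d. d dvd n}" "\<lambda>d. F d (n div d)"] by simp
  qed
qed

lemma summable_on_norm_times:
  fixes f :: "'a \<Rightarrow> complex" and g :: "'b \<Rightarrow> complex"
  assumes "(\<lambda>a. norm (f a)) summable_on A" "(\<lambda>b. norm (g b)) summable_on B"
  shows "(\<lambda>x. norm (f (fst x) * g (snd x))) summable_on (A \<times> B)"
  unfolding Infinite_Sum.abs_summable_on_Sigma_iff
proof (intro conjI ballI)
  show "(\<lambda>y. norm (f (fst (x, y)) * g (snd (x, y)))) summable_on B" for x
    using assms(2) by (simp add: norm_mult summable_on_cmult_right)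
  have "(\<lambda>x. norm (f x) * (\<Sum>\<^sub>\<infinity>y\<in>B. norm (g y))) summable_on A"
    using assms(1) by (rule summable_on_cmult_left)
  moreover have "(\<Sum>\<^sub>\<infinity>y\<in>B. norm (g y)) \<ge> 0" by (rule infsum_nonneg) auto
  ultimately show "(\<lambda>x. norm (\<Sum>\<^sub>\<infinity>y\<in>B. norm (f (fst (x, y)) * g (snd (x, y))))) summable_on A"
    by (simp add: norm_mult infsum_cmult_right')
qed

definition dconv :: "(nat \<Rightarrow> complex) \<Rightarrow> (nat \<Rightarrow> complex) \<Rightarrow> nat \<Rightarrow> complex" where
  "dconv f g n = (\<Sum>d | d dvd n. f d * g (n div d))"

lemma ds_eq_infsum:
  assumes "subpoly f" "Re s > 1"
  shows "(\<lambda>n. norm (f n * of_nat n powr (- s))) summable_on {1..}"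
    "ds f s = (\<Sum>\<^sub>\<infinity>n\<in>{1..}. f n * of_nat n powr (- s))"
proof -
  have 1: "(\<lambda>n. norm (f n * of_nat n powr (- s))) summable_on UNIV"
    using norm_summable_imp_summable_on[of "\<lambda>n. norm (f n * of_nat n powr (- s))"] summable_norm_ds[OF assms] by simp
  then show "(\<lambda>n. norm (f n * of_nat n powr (- s))) summable_on {1..}"
    by (rule summable_on_subset) auto
  have "ds f s = (\<Sum>\<^sub>\<infinity>n\<in>UNIV. f n * of_nat n powr (- s))"
    unfolding ds_def using norm_summable_imp_has_sum[OF summable_norm_ds[OF assms] summable_sums[OF summable_ds[OF assms]]]
    by (simp add: infsumI)
  also have "\<dots> = (\<Sum>\<^sub>\<infinity>n\<in>{1..}. f n * of_nat n powr (- s))"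
    by (rule infsum_cong_neutral) (auto simp: not_le)
  finally show "ds f s = (\<Sum>\<^sub>\<infinity>n\<in>{1..}. f n * of_nat n powr (- s))" .
qed

lemma has_sum_imp_sums_from_1:
  fixes f :: "nat \<Rightarrow> complex"
  assumes "(f has_sum S) {1..}" "f 0 = 0"
  shows "f sums S"
proof -
  have "(f has_sum S) UNIV"
    using assms by (subst has_sum_cong_neutral[where T = "{1..}" and g = f]) (auto simp: not_le)
  then show ?thesis by (rule has_sum_imp_sums)
qed

lemma ds_mult:
  assumes f: "subpoly f" and g: "subpoly g" and s: "Re s > 1"
  shows "ds f s * ds g s = ds (dconv f g) s"
proof -
  define F where "F = (\<lambda>a b. (f a * of_nat a powr (- s)) * (g b * of_nat b powr (- s)))"
  have abs: "(\<lambda>(a,b). norm (F a b)) summable_on ({1..} \<times> {1..})"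
    unfolding F_def case_prod_unfold
    by (rule summable_on_norm_times[OF ds_eq_infsum(1)[OF f s] ds_eq_infsum(1)[OF g s]])
  then have "(\<lambda>(a,b). F a b) summable_on ({1..} \<times> {1..})"
    using abs_summable_summable[of "\<lambda>(a,b). F a b"] by (simp add: case_prod_unfold)
  then have "(\<Sum>\<^sub>\<infinity>(a,b)\<in>{1..} \<times> {1..}. F a b) = (\<Sum>\<^sub>\<infinity>a\<in>{1..}. \<Sum>\<^sub>\<infinity>b\<in>{1..}. F a b)"
    using infsum_Sigma'_banach[of F "{1..}" "\<lambda>_. {1..}"] by simp
  also have "\<dots> = ds f s * ds g s"
    unfolding ds_eq_infsum(2)[OF f s] ds_eq_infsum(2)[OF g s] F_def
    by (simp only: infsum_cmult_right' infsum_cmult_left')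
  finally have "(\<Sum>\<^sub>\<infinity>(a,b)\<in>{1..} \<times> {1..}. F a b) = ds f s * ds g s" .
  with has_sum_divisor_pairs[OF abs]
  have "((\<lambda>n. \<Sum>d | d dvd n. F d (n div d)) has_sum ds f s * ds g s) {1..}" by simp
  also have "?this \<longleftrightarrow> ((\<lambda>n. dconv f g n * of_nat n powr (- s)) has_sum ds f s * ds g s) {1..}"
  proof (rule has_sum_cong)
    fix n :: nat assume n: "n \<in> {1..}"
    have "F d (n div d) = f d * g (n div d) * of_nat n powr (- s)" if dn: "d dvd n" for d
    proof -
      obtain e where e: "n = d * e" using dn by blast
      have "d > 0" "e > 0" using n e by (auto intro!: Nat.gr0I)
      then have "(of_nat n :: complex) powr (- s) = of_nat d powr (- s) * of_nat e powr (- s)"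
        unfolding e of_nat_mult by (intro powr_times_real) auto
      then show ?thesis using \<open>d > 0\<close> by (simp add: F_def e)
    qed
    then show "(\<Sum>d | d dvd n. F d (n div d)) = dconv f g n * of_nat n powr (- s)"
      by (simp add: dconv_def sum_distrib_right)
  qed
  finally have "(\<lambda>n. dconv f g n * of_nat n powr (- s)) sums (ds f s * ds g s)"
    by (rule has_sum_imp_sums_from_1) simp
  then show ?thesis by (simp add: ds_def sums_iff)
qed

text \<open>Far to the right only the term n = 1 survives. This supplies the limit 1 for the
  monotonicity argument behind the 3-4-1 inequality.\<close>

lemma ds_tendsto_at_top:
  assumes f: "subpoly f"
  shows "((\<lambda>x. ds f (of_real x)) \<longlongrightarrow> f 1) at_top"
proof -
  obtain B where B: "B > 0"
    "\<And>n s'. Re s' \<ge> 2 \<Longrightarrow> norm (f n * of_nat n powr (- s')) \<le> B * real n powr (- ((1 + 2) / 2))"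
    using subpoly_norm_bound[OF f, of 2] by auto
  have "((\<lambda>x. \<Sum>n. f n * of_nat n powr (- of_real x)) \<longlongrightarrow> (\<Sum>n. if n = 1 then f 1 else 0)) at_top"
  proof (rule tannerys_theorem[THEN conjunct2, THEN conjunct2])
    show "((\<lambda>x. f n * of_nat n powr (- of_real x)) \<longlongrightarrow> (if n = 1 then f 1 else 0)) at_top" for n
    proof -
      consider "n = 0" | "n = 1" | "n > 1" by linarith
      then show ?thesis
      proof cases
        case 3
        have "((\<lambda>x. exp (- (ln (real n) * x))) \<longlongrightarrow> 0) at_top"
          using 3 by (intro filterlim_compose[OF exp_at_bot] filterlim_uminus_at_bot_at_top[THEN filterlim_compose]
             filterlim_tendsto_pos_mult_at_top[OF tendsto_const] filterlim_ident) auto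
        then have "((\<lambda>x. real n powr (- x)) \<longlongrightarrow> 0) at_top"
          using 3 by (simp add: powr_def mult.commute)
        then have "((\<lambda>x. norm (of_nat n powr (- of_real x) :: complex)) \<longlongrightarrow> 0) at_top"
          by (simp add: norm_of_nat_powr_minus)
        then have "((\<lambda>x. of_nat n powr (- of_real x) :: complex) \<longlongrightarrow> 0) at_top"
          by (simp add: tendsto_norm_zero_iff)
        then have "((\<lambda>x. f n * of_nat n powr (- of_real x)) \<longlongrightarrow> 0) at_top"
          by (rule tendsto_mult_right_zero)
        then show ?thesis using 3 by simp
      qed auto
    qed
    show "\<forall>\<^sub>F (k,x) in sequentially \<times>\<^sub>F at_top. norm (f k * of_nat k powr (- of_real x)) \<le> B * real k powr (- ((1 + 2) / 2))"
    proof -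
      have "\<forall>\<^sub>F x::real in at_top. x \<ge> 2" by (rule eventually_ge_at_top)
      then have "\<forall>\<^sub>F (k, x) in (sequentially :: nat filter) \<times>\<^sub>F at_top. x \<ge> (2::real)"
        by (subst eventually_prod2) auto
      then show ?thesis
      proof eventually_elim
        case (elim y)
        obtain k x where y: "y = (k, x)" by (cases y)
        show ?case using elim B(2)[of "of_real x" k] unfolding y by simp
      qed
    qed
    show "summable (\<lambda>k. B * real k powr (- ((1 + 2) / 2)))"
      by (intro summable_mult) (simp add: summable_real_powr_iff)
  qed auto
  moreover have "(\<Sum>n. if n = 1 then f 1 else 0) = f 1"
    using suminf_finite[of "{1::nat}" "\<lambda>n. if n = 1 then f 1 else 0"] by simp
  ultimately show ?thesis by (simp add: ds_def)
qed

section \<open>Divisor sums and the logarithmic derivative\<close>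

text \<open>For x = p^k and a > 0 this is the divisor power sum of p^(a - 1).\<close>

definition geo :: "nat \<Rightarrow> nat \<Rightarrow> nat" where "geo x a = (\<Sum>j<a. x ^ j)"

lemma geo_add: "geo x (a + b) = geo x a + x ^ a * geo x b"
  by (induction b) (simp_all add: geo_def algebra_simps power_add)

text \<open>The value 0 encodes that no positive a works. Since 0 divides only 0, the criterion
  \<open>geo_ord q x dvd a\<close> then stays correct without a case split.\<close>

definition geo_ord :: "nat \<Rightarrow> nat \<Rightarrow> nat" where
  "geo_ord q x = (if \<exists>a>0. q dvd geo x a then LEAST a. a > 0 \<and> q dvd geo x a else 0)"

lemma geo_cong_1:
  assumes "[x = 1] (mod q)"
  shows "[geo x a = a] (mod q)"
proof -
  have "[(\<Sum>j<a. x ^ j) = (\<Sum>j<a. 1 ^ j)] (mod q)"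
    using assms by (intro cong_sum cong_pow) auto
  then show ?thesis by (simp add: geo_def)
qed

lemma geo_minus_one: "int (geo x a) * (int x - 1) = int x ^ a - 1"
  by (induction a) (simp_all add: geo_def algebra_simps)

text \<open>If x = 1 modulo q, the a summands are all 1. Otherwise x - 1 is invertible modulo q and
  can be multiplied in, which turns the sum into x^a - 1.\<close>

lemma dvd_geo_iff:
  assumes "prime q"
  shows "q dvd geo x a \<longleftrightarrow> (if [x = 1] (mod q) then q dvd a else [x ^ a = 1] (mod q))"
proof (cases "[x = 1] (mod q)")
  case True
  then show ?thesis using cong_dvd_iff[OF geo_cong_1[OF True]] by simp
next
  case False
  have 1: "\<not> int q dvd int x - 1"
    using False by (metis cong_iff_dvd_diff cong_int_iff int_ops(2))
  have "q dvd geo x a \<longleftrightarrow> int q dvd int (geo x a) * (int x - 1)"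
    using assms 1 by (simp add: prime_dvd_mult_iff)
  also have "\<dots> \<longleftrightarrow> [x ^ a = 1] (mod q)"
    unfolding geo_minus_one by (metis cong_iff_dvd_diff cong_int_iff int_ops(2) of_nat_power)
  finally show ?thesis using False by simp
qed

lemma geo_dvd_x:
  assumes "q dvd x" "a > 0" "prime q"
  shows "\<not> q dvd geo x a"
proof -
  from \<open>a > 0\<close> obtain b where b: "a = Suc b" by (cases a) auto
  have "geo x a = 1 + x * geo x b"
    unfolding b using geo_add[of x 1 b] by (simp add: geo_def)
  then have "q dvd geo x a \<longleftrightarrow> q dvd 1"
    using dvd_add_left_iff[of q "x * geo x b" 1] assms(1) by (simp only: dvd_mult2)
  then show ?thesis using not_prime_unit assms(3) by metis
qed

text \<open>The indices a with q dividing \<open>geo x a\<close> are closed under multiples and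
  remainders, by \<open>geo_add\<close> and invertibility of x, so they are the multiples of the
  least positive one.\<close>

lemma dvd_geo_iff_geo_ord:
  assumes "prime q"
  shows "q dvd geo x a \<longleftrightarrow> geo_ord q x dvd a"
proof (cases "\<exists>a>0. q dvd geo x a")
  case no_multiple: False
  then have "geo_ord q x = 0" unfolding geo_ord_def by (rule if_not_P)
  moreover have "q dvd geo x a \<longleftrightarrow> a = 0"
  proof (cases "a = 0")
    case True
    then show ?thesis by (simp add: geo_def)
  qed (use no_multiple in blast)
  ultimately show ?thesis by simp
next
  case True
  define G where "G = geo_ord q x"
  have G0: "G = (LEAST a. a > 0 \<and> q dvd geo x a)" using True by (simp add: G_def geo_ord_def)
  have G: "G > 0" "q dvd geo x G"
    unfolding G0 using LeastI_ex[OF True] by auto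
  have least: "\<not> q dvd geo x a" if "a > 0" "a < G" for a
    using not_less_Least[of a "\<lambda>a. a > 0 \<and> q dvd geo x a"] that unfolding G0 by auto
  have nx: "\<not> q dvd x" using geo_dvd_x[OF _ G(1) assms] G(2) by blast
  have mult: "q dvd geo x (G * t)" for t
    by (induction t) (use G in \<open>simp_all add: geo_add geo_def[of _ 0]\<close>)
  show ?thesis unfolding G_def[symmetric]
  proof
    assume "G dvd a" then show "q dvd geo x a" using mult by auto
  next
    assume a: "q dvd geo x a"
    have "geo x a = geo x (G * (a div G)) + x ^ (G * (a div G)) * geo x (a mod G)"
      by (subst geo_add[symmetric]) simp
    with a mult[of "a div G"] have "q dvd x ^ (G * (a div G)) * geo x (a mod G)"
      by (metis dvd_add_right_iff)
    then have "q dvd geo x (a mod G)"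
      using nx assms by (auto simp: prime_dvd_mult_iff dest: prime_dvd_power)
    then have "a mod G = 0" using least[of "a mod G"] G(1) by (metis gr0I mod_less_divisor)
    then show "G dvd a" by auto
  qed
qed

lemma geo_ord_eqI:
  assumes "prime q" "\<And>a. q dvd geo x a \<longleftrightarrow> q dvd geo y a"
  shows "geo_ord q x = geo_ord q y"
  by (simp only: geo_ord_def assms(2))

lemma geo_ord_neq_1:
  assumes "prime q" shows "geo_ord q x \<noteq> 1"
proof
  assume "geo_ord q x = 1"
  then have "q dvd geo x 1" using dvd_geo_iff_geo_ord[OF assms] by simp
  then show False using assms by (simp add: geo_def)
qed

lemma geo_ord_eq_0_iff:
  assumes "prime q" shows "geo_ord q x = 0 \<longleftrightarrow> q dvd x"
proof
  assume "q dvd x"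
  then show "geo_ord q x = 0" using geo_dvd_x[OF _ _ assms] by (auto simp: geo_ord_def)
next
  assume 0: "geo_ord q x = 0"
  show "q dvd x"
  proof (rule ccontr)
    assume nx: "\<not> q dvd x"
    \<comment> \<open>A positive index exists for every unit: q itself if x = 1 modulo q, and q - 1
      by Fermat otherwise.\<close>
    have "q dvd geo x (if [x = 1] (mod q) then q else q - 1)"
      using fermat_theorem[OF assms nx] by (auto simp: dvd_geo_iff[OF assms])
    then have "geo_ord q x dvd (if [x = 1] (mod q) then q else q - 1)"
      using dvd_geo_iff_geo_ord[OF assms] by blast
    then show False using 0 prime_gt_1_nat[OF assms] by (auto split: if_splits)
  qed
qed

lemma geo_ord_eq_2_iff:
  assumes "prime q" shows "geo_ord q x = 2 \<longleftrightarrow> q dvd x + 1"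
proof -
  have geo2: "geo x 2 = x + 1" by (simp add: geo_def numeral_2_eq_2)
  have "q dvd x + 1 \<longleftrightarrow> geo_ord q x dvd 2"
    using dvd_geo_iff_geo_ord[OF assms, of x 2] by (simp add: geo2)
  also have "\<dots> \<longleftrightarrow> geo_ord q x = 2"
    using geo_ord_neq_1[OF assms, of x] two_is_prime_nat by (auto simp: prime_nat_iff)
  finally show ?thesis by simp
qed

text \<open>Turns \<open>geo_ord\<close> into a binomial congruence, so that primes of given order
  can be counted as roots modulo q.\<close>

lemma pow_geo_ord_cong_1:
  assumes "prime q" shows "[x ^ geo_ord q x = 1] (mod q)"
proof -
  have "q dvd geo x (geo_ord q x)" by (simp add: dvd_geo_iff_geo_ord[OF assms])
  then have "if [x = 1] (mod q) then q dvd geo_ord q x else [x ^ geo_ord q x = 1] (mod q)"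
    unfolding dvd_geo_iff[OF assms] .
  moreover have "[x ^ geo_ord q x = 1 ^ geo_ord q x] (mod q)" if "[x = 1] (mod q)"
    using that by (rule cong_pow)
  ultimately show ?thesis unfolding power_one by argo
qed

text \<open>The order of p modulo q divides q - 1, so it divides k a exactly when it divides gcd(k,
  q - 1) a. The instance a = 1 shows that both powers fall into the same case of
  \<open>dvd_geo_iff\<close>.\<close>

lemma geo_ord_power_gcd:
  assumes q: "prime q" and p: "\<not> q dvd p" and k: "k \<ge> 1"
  shows "geo_ord q (p ^ k) = geo_ord q (p ^ gcd k (q - 1))"
proof (rule geo_ord_eqI[OF q])
  fix a
  have ordq: "ord q p dvd q - 1" using fermat_theorem[OF q p] by (simp only: ord_divides)
  have eq: "[(p ^ k) ^ a = 1] (mod q) \<longleftrightarrow> [(p ^ gcd k (q - 1)) ^ a = 1] (mod q)" for a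
  proof -
    have "ord q p dvd k * a \<longleftrightarrow> ord q p dvd gcd (k * a) ((q - 1) * a)"
      using ordq by (auto intro: dvd_mult2)
    also have "gcd (k * a) ((q - 1) * a) = gcd k (q - 1) * a"
      by (simp add: gcd_mult_distrib_nat mult.commute)
    finally show ?thesis by (simp only: power_mult[symmetric] ord_divides)
  qed
  show "q dvd geo (p ^ k) a \<longleftrightarrow> q dvd geo (p ^ gcd k (q - 1)) a"
    unfolding dvd_geo_iff[OF q] using eq[of a] eq[of 1] by simp
qed

section \<open>Divisor sums of completely multiplicative functions\<close>

lemma bij_betw_divisors_coprime:
  assumes "coprime a (b::nat)" "a > 0" "b > 0"
  shows "bij_betw (\<lambda>(x,y). x * y) ({d. d dvd a} \<times> {d. d dvd b}) {d. d dvd a * b}"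
proof (rule bij_betwI[where g = "\<lambda>d. (gcd d a, gcd d b)"])
  have gcd_prod: "gcd (x * y) a = x" "gcd (x * y) b = y" if xy: "x dvd a" "y dvd b" for x y
  proof -
    have "coprime a y" "coprime b x"
      using assms(1) xy by (meson coprime_commute coprime_divisors dvd_refl)+
    then have "gcd (x * y) a = gcd x a" "gcd (x * y) b = gcd y b"
      using gcd_mult_left_right_cancel[of a y x] gcd_mult_left_left_cancel[of b x y] by auto
    then show "gcd (x * y) a = x" "gcd (x * y) b = y" using xy by (auto simp: gcd_proj1_iff)
  qed
  show "(\<lambda>(x,y). x * y) \<in> {d. d dvd a} \<times> {d. d dvd b} \<rightarrow> {d. d dvd a * b}"
    by (auto intro: mult_dvd_mono)
  show "(\<lambda>d. (gcd d a, gcd d b)) \<in> {d. d dvd a * b} \<rightarrow> {d. d dvd a} \<times> {d. d dvd b}"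
    by auto
  show "(gcd (case z of (x,y) \<Rightarrow> x * y) a, gcd (case z of (x,y) \<Rightarrow> x * y) b) = z"
    if z: "z \<in> {d. d dvd a} \<times> {d. d dvd b}" for z
  proof -
    obtain x y where [simp]: "z = (x, y)" and xy: "x dvd a" "y dvd b" using z by auto
    show ?thesis using gcd_prod[OF xy] by simp
  qed
  show "(case (gcd d a, gcd d b) of (x,y) \<Rightarrow> x * y) = d" if d: "d \<in> {d. d dvd a * b}" for d
  proof -
    obtain x y where "d = x * y" "x dvd a" "y dvd b" using division_decomp[of d a b] d by blast
    then show ?thesis using gcd_prod by simp
  qed
qed

lemma divisor_sum_coprime_mult:
  fixes w :: "nat \<Rightarrow> 'a :: comm_semiring_1"
  assumes "coprime a b" "a > 0" "b > 0" "\<And>x y. w (x * y) = w x * w y"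
  shows "(\<Sum>d | d dvd a * b. w d) = (\<Sum>d | d dvd a. w d) * (\<Sum>d | d dvd b. w d)"
proof -
  have "(\<Sum>d | d dvd a * b. w d) = (\<Sum>(x,y)\<in>{d. d dvd a} \<times> {d. d dvd b}. w (x * y))"
    using sum.reindex_bij_betw[OF bij_betw_divisors_coprime[OF assms(1-3)], of w]
    by (simp add: case_prod_unfold)
  also have "\<dots> = (\<Sum>d | d dvd a. w d) * (\<Sum>d | d dvd b. w d)"
    by (simp add: assms(4) sum.cartesian_product[symmetric] sum_product)
  finally show ?thesis .
qed

lemma divisor_sum_prime_power:
  fixes w :: "nat \<Rightarrow> 'a :: comm_semiring_1"
  assumes "prime p" "\<And>x y. w (x * y) = w x * w y" "w 1 = 1"
  shows "(\<Sum>d | d dvd p ^ a. w d) = (\<Sum>j\<le>a. w p ^ j)"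
proof -
  have pw: "w (p ^ j) = w p ^ j" for j by (induction j) (use assms(2,3) in auto)
  have set: "{d. d dvd p ^ a} = (\<lambda>j. p ^ j) ` {..a}"
    using divides_primepow_nat[OF assms(1)] by auto
  have inj: "inj_on (\<lambda>j. p ^ j) {..a}"
    using prime_gt_1_nat[OF assms(1)] by (auto intro!: inj_onI)
  show ?thesis unfolding set by (subst sum.reindex[OF inj]) (simp add: pw)
qed

text \<open>Induction for multiplicative functions: the full power of one prime is split off, so the
  cofactor is coprime to it.\<close>

lemma prod_prime_power_induct [consumes 1, case_names one mult]:
  assumes "n > (0::nat)"
    and "P 1"
    and "\<And>p a m. prime p \<Longrightarrow> a > 0 \<Longrightarrow> m > 0 \<Longrightarrow> \<not> p dvd m \<Longrightarrow> P m \<Longrightarrow> P (p ^ a * m)"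
  shows "P n"
  using assms(1)
proof (induction n rule: less_induct)
  case (less n)
  show ?case
  proof (cases "n = 1")
    case False
    then obtain p where p: "prime p" "p dvd n" using prime_factor_nat by blast
    define a where "a = multiplicity p n"
    obtain m where m: "n = p ^ a * m" "\<not> p dvd m"
      unfolding a_def using multiplicity_decompose'[of n p] p less.prems by (metis neq0_conv not_prime_unit)
    have "a > 0" using p less.prems unfolding a_def by (simp add: prime_multiplicity_gt_zero_iff)
    have "m > 0" using m less.prems by (auto intro: Nat.gr0I)
    moreover have "m < n"
    proof -
      have "1 < p ^ a" using prime_gt_1_nat[OF p(1)] \<open>a > 0\<close> by (intro one_less_power) auto
      then show ?thesis using m(1) \<open>m > 0\<close> by simp
    qed
    ultimately show ?thesis using assms(3)[OF p(1) \<open>a > 0\<close> _ m(2)] less.IH m(1) by auto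
  qed (use assms in auto)
qed

text \<open>The divisor sum factors over the prime powers exactly dividing n into values of
  \<open>geo\<close>, and a prime q divides the product iff it divides a factor.\<close>

lemma geo_dvd_divisor_sum_iff:
  assumes q: "prime q" and n: "n > 0"
  shows "q dvd (\<Sum>d | d dvd n. d ^ k) \<longleftrightarrow> (\<exists>p\<in>prime_factors n. geo_ord q (p ^ k) dvd Suc (multiplicity p n))"
  using n
proof (induction n rule: prod_prime_power_induct)
  case one
  then show ?case using prime_gt_1_nat[OF q] by simp
next
  case (mult p a m)
  have cop: "coprime (p ^ a) m" using mult by (simp add: prime_imp_coprime)
  have "(\<Sum>d | d dvd p ^ a * m. d ^ k) = (\<Sum>d | d dvd p ^ a. d ^ k) * (\<Sum>d | d dvd m. d ^ k)"
    using mult cop prime_gt_0_nat[of p] by (intro divisor_sum_coprime_mult) (auto simp: power_mult_distrib)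
  moreover have "(\<Sum>d | d dvd p ^ a. d ^ k) = geo (p ^ k) (Suc a)"
    using mult by (subst divisor_sum_prime_power) (auto simp: power_mult_distrib geo_def lessThan_Suc_atMost)
  ultimately have "q dvd (\<Sum>d | d dvd p ^ a * m. d ^ k) \<longleftrightarrow>
      geo_ord q (p ^ k) dvd Suc a \<or> q dvd (\<Sum>d | d dvd m. d ^ k)"
    using q by (simp add: prime_dvd_mult_iff dvd_geo_iff_geo_ord)
  also have "\<dots> \<longleftrightarrow> (\<exists>p'\<in>prime_factors (p ^ a * m). geo_ord q (p' ^ k) dvd Suc (multiplicity p' (p ^ a * m)))"
  proof -
    have pf: "prime_factors (p ^ a * m) = insert p (prime_factors m)"
      using mult prime_gt_0_nat[of p] by (auto simp: prime_factors_product prime_factorization_prime_power)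
    have "multiplicity p (p ^ a * m) = a"
      using mult prime_gt_0_nat[of p] by (simp add: prime_elem_multiplicity_mult_distrib not_dvd_imp_multiplicity_0 multiplicity_prime_power)
    moreover have "multiplicity p' (p ^ a * m) = multiplicity p' m" if "p' \<in> prime_factors m" for p'
    proof -
      have "p' \<noteq> p" "prime p'" using that mult by (auto simp: in_prime_factors_iff)
      then show ?thesis using mult prime_gt_0_nat[of p]
        by (simp add: prime_elem_multiplicity_mult_distrib multiplicity_distinct_prime_power)
    qed
    ultimately show ?thesis unfolding pf using mult.IH by auto
  qed
  finally show ?case .
qed

section \<open>Local factors as formal power series\<close>

definition fps_mults :: "nat \<Rightarrow> real fps" where
  "fps_mults g = Abs_fps (\<lambda>n. if g dvd n then 1 else 0)"

lemma fps_mults_times: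
  assumes "g > 0" shows "fps_mults g * (1 - fps_X ^ g) = 1"
proof (rule fps_ext)
  fix n
  have "(fps_mults g * (1 - fps_X ^ g)) $ n = fps_mults g $ n - (fps_mults g * fps_X ^ g) $ n"
    by (simp add: algebra_simps)
  also have "\<dots> = 1 $ n"
    using assms by (auto simp: fps_X_power_mult_right_nth fps_mults_def dvd_minus_self not_less dest: dvd_imp_le)
  finally show "(fps_mults g * (1 - fps_X ^ g)) $ n = 1 $ n" .
qed

lemma fps_mults_deriv:
  assumes "g > 0"
  shows "fps_X * fps_deriv (fps_mults g) = of_nat g * fps_mults g * (fps_mults g - 1)"
proof -
  let ?E = "fps_mults g" and ?U = "1 - fps_X ^ g :: real fps"
  have EU: "?E * ?U = 1" by (rule fps_mults_times[OF assms])
  have "fps_deriv (?E * ?U) = 0" unfolding EU by simp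
  then have 1: "fps_deriv ?E * ?U = ?E * fps_deriv (fps_X ^ g)"
    by (simp add: algebra_simps)
  have 2: "fps_X * fps_deriv (fps_X ^ g) = of_nat g * (fps_X ^ g :: real fps)"
  proof -
    obtain g' where "g = Suc g'" using assms by (cases g) auto
    then have "fps_deriv (fps_X ^ g) = fps_const (of_nat g) * fps_deriv fps_X * (fps_X ^ g' :: real fps)"
      using fps_deriv_power[of fps_X g] by simp
    then have "fps_X * fps_deriv (fps_X ^ g) = of_nat g * (fps_X * fps_X ^ g' :: real fps)"
      by (simp only: fps_deriv_fps_X fps_of_nat mult_1_right mult.left_commute)
    then show ?thesis unfolding \<open>g = Suc g'\<close> by (simp only: power_Suc)
  qed
  have "fps_X * fps_deriv ?E = fps_X * (fps_deriv ?E * ?U) * ?E"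
    using EU by (simp add: mult_ac)
  also have "\<dots> = ?E * ?E * (fps_X * fps_deriv (fps_X ^ g))" unfolding 1 by (simp add: mult_ac)
  also have "\<dots> = of_nat g * ?E * (?E * fps_X ^ g)" unfolding 2 by (simp add: mult_ac)
  also have "?E * fps_X ^ g = ?E - 1" using EU by (simp add: algebra_simps)
  finally show ?thesis .
qed

text \<open>With E_h = 1 / (1 - x^h), multiplying B by E_(g-1) cancels its numerator: B E_(g-1) =
  E_1 E_g. Each E_h satisfies x E_h' = h E_h (E_h - 1), and the claim is the logarithmic derivative
  of this product relation.\<close>

lemma local_log_deriv_fps:
  assumes g: "g \<ge> 2"
  defines "B \<equiv> Abs_fps (\<lambda>n. if g dvd Suc n then 0 else 1 :: real)"
  shows "fps_X * fps_deriv B = ((fps_mults 1 - 1) + of_nat g * (fps_mults g - 1)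
           - of_nat (g - 1) * (fps_mults (g - 1) - 1)) * B"
proof -
  define E1 Eg Ee U where "E1 = fps_mults 1" "Eg = fps_mults g" "Ee = fps_mults (g - 1)"
    "U = (1 - fps_X ^ (g - 1) :: real fps)"
  note defs = this
  have E1: "E1 * (1 - fps_X) = 1" using fps_mults_times[of 1] by (simp add: defs)
  have Eg: "Eg * (1 - fps_X ^ g) = 1" using fps_mults_times[of g] g by (simp add: defs)
  have Ee: "Ee * U = 1" using fps_mults_times[of "g - 1"] g by (simp add: defs)
  \<comment> \<open>The shift by one turns the condition on n + 1 into g dividing n;
    \<open>Eg - 1\<close> drops the constant term, which the shifted series lacks.\<close>
  have XB: "fps_X * B = fps_X * E1 - (Eg - 1)"
  proof (rule fps_ext)
    fix n show "(fps_X * B) $ n = (fps_X * E1 - (Eg - 1)) $ n"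
      by (cases n) (auto simp: B_def defs fps_mults_def)
  qed
  have Xg: "fps_X ^ g = fps_X * (fps_X ^ (g - 1) :: real fps)"
    using g by (metis One_nat_def Suc_diff_1 Suc_leD lessI less_le_trans numeral_2_eq_2 power_Suc zero_less_Suc)
  have "fps_X * (B * (1 - fps_X) * (1 - fps_X ^ g)) =
     fps_X * (1 - fps_X ^ g) * (E1 * (1 - fps_X)) - (1 - fps_X) * (Eg * (1 - fps_X ^ g) - (1 - fps_X ^ g))"
    using arg_cong[OF XB, of "\<lambda>z. z * ((1 - fps_X) * (1 - fps_X ^ g))"] by (simp add: algebra_simps)
  also have "\<dots> = fps_X * U" unfolding E1 Eg by (simp add: algebra_simps Xg defs(4))
  finally have BU: "B * (1 - fps_X) * (1 - fps_X ^ g) = U"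
    by simp
  have B: "B = U * E1 * Eg"
  proof -
    have "B = B * (E1 * (1 - fps_X)) * (Eg * (1 - fps_X ^ g))" using E1 Eg by simp
    also have "\<dots> = (B * (1 - fps_X) * (1 - fps_X ^ g)) * E1 * Eg" by (simp only: mult_ac)
    finally show ?thesis unfolding BU .
  qed
  have d1: "fps_X * fps_deriv E1 = E1 * (E1 - 1)"
    using fps_mults_deriv[of 1] by (simp add: defs)
  have dg: "fps_X * fps_deriv Eg = of_nat g * Eg * (Eg - 1)"
    using fps_mults_deriv[of g] g by (simp add: defs)
  have de: "fps_X * fps_deriv Ee = of_nat (g - 1) * Ee * (Ee - 1)"
    using fps_mults_deriv[of "g - 1"] g by (simp add: defs)
  have BEe: "B * Ee = E1 * Eg" unfolding B using Ee by (simp add: mult_ac)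
  have "fps_X * fps_deriv (B * Ee) = fps_X * fps_deriv (E1 * Eg)" unfolding BEe ..
  then have "(fps_X * fps_deriv B) * Ee + B * (fps_X * fps_deriv Ee) =
       (fps_X * fps_deriv E1) * Eg + E1 * (fps_X * fps_deriv Eg)"
    by (simp add: algebra_simps)
  then have "(fps_X * fps_deriv B) * Ee = (E1 * Eg) * ((E1 - 1) + of_nat g * (Eg - 1)) - B * (of_nat (g - 1) * Ee * (Ee - 1))"
    unfolding d1 dg de by (simp add: algebra_simps)
  also have "\<dots> = ((E1 - 1) + of_nat g * (Eg - 1) - of_nat (g - 1) * (Ee - 1)) * B * Ee"
    unfolding BEe[symmetric] by (simp add: algebra_simps)
  finally have "(fps_X * fps_deriv B) * Ee = ((E1 - 1) + of_nat g * (Eg - 1) - of_nat (g - 1) * (Ee - 1)) * B * Ee" .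
  moreover have "Ee \<noteq> 0" using Ee by auto
  ultimately have "fps_X * fps_deriv B = ((E1 - 1) + of_nat g * (Eg - 1) - of_nat (g - 1) * (Ee - 1)) * B"
    by (rule mult_right_cancel[THEN iffD1, rotated])
  then show ?thesis unfolding defs .
qed

text \<open>The power series B with coefficient 1 at a if g does not divide a + 1, and 0 otherwise, equals
  (1 - x^(g-1)) / ((1 - x) (1 - x^g)), and x B' / B has the coefficients 1 - (local coefficient).
  The value g = 0 encodes the absence of a condition.\<close>
definition local_coeff :: "nat \<Rightarrow> nat \<Rightarrow> real" where
  "local_coeff g j = (if g = 0 then 0 else
     (if (g - 1) dvd j then real (g - 1) else 0) - (if g dvd j then real g else 0))"

text \<open>Compares the coefficients of x^a in x B' = C B, where C collects the numbers 1 -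
  \<open>local_coeff\<close>. This is the contribution of a single prime in
  \<open>dconv_beta\<close>.\<close>

lemma local_log_deriv:
  assumes "g \<noteq> 1"
  shows "(\<Sum>j=1..a. (1 - local_coeff g j) * (if g dvd Suc (a - j) then 0 else 1))
          = (if g dvd Suc a then 0 else real a)"
proof (cases "g = 0")
  case True
  then show ?thesis by (simp add: local_coeff_def)
next
  case False
  with assms have g: "g \<ge> 2" by simp
  define C where "C = (fps_mults 1 - 1) + of_nat g * (fps_mults g - 1)
           - of_nat (g - 1) * (fps_mults (g - 1) - 1)"
  define B where "B = Abs_fps (\<lambda>n. if g dvd Suc n then 0 else 1 :: real)"
  have C: "C $ j = (if j = 0 then 0 else 1 - local_coeff g j)" for j
    using g by (auto simp: C_def fps_mults_def local_coeff_def fps_of_nat[symmetric] simp del: fps_of_nat)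
  have "(if g dvd Suc a then 0 else real a) = (fps_X * fps_deriv B) $ a"
    by (cases a) (auto simp: B_def)
  also have "\<dots> = (C * B) $ a"
    unfolding C_def B_def by (subst local_log_deriv_fps[OF g]) (rule refl)
  also have "\<dots> = (\<Sum>j=0..a. C $ j * B $ (a - j))" by (simp add: fps_mult_nth)
  also have "\<dots> = (\<Sum>j=1..a. C $ j * B $ (a - j))"
    by (subst sum.atLeast_Suc_atMost) (auto simp: C)
  also have "\<dots> = (\<Sum>j=1..a. (1 - local_coeff g j) * (if g dvd Suc (a - j) then 0 else 1))"
    by (intro sum.cong) (auto simp: C B_def)
  finally show ?thesis by simp
qed

section \<open>The indicator of the set and its logarithmic derivative\<close>

definition beta :: "(nat \<Rightarrow> nat) \<Rightarrow> nat \<Rightarrow> complex" where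
  "beta g n = (if n > 0 \<and> (\<forall>p\<in>prime_factors n. \<not> g p dvd Suc (multiplicity p n)) then 1 else 0)"

text \<open>If T is the Dirichlet series of \<open>beta g\<close>, these are the coefficients of
  T'/T - zeta'/zeta.\<close>

definition dcoef :: "(nat \<Rightarrow> nat) \<Rightarrow> nat \<Rightarrow> real" where
  "dcoef g n = mangoldt n * local_coeff (g (aprimedivisor n)) (multiplicity (aprimedivisor n) n)"

lemma dcoef_prime_power:
  assumes "prime p" "j > 0"
  shows "dcoef g (p ^ j) = ln (real p) * local_coeff (g p) j"
  using assms by (simp add: dcoef_def aprimedivisor_prime_power)

lemma sum_primepow_divisors:
  fixes f :: "nat \<Rightarrow> 'a :: comm_monoid_add"
  assumes "n > 0" "\<And>d. \<not> primepow d \<Longrightarrow> f d = 0"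
  shows "(\<Sum>d | d dvd n. f d) = (\<Sum>p\<in>prime_factors n. \<Sum>j=1..multiplicity p n. f (p ^ j))"
proof -
  let ?A = "SIGMA p:prime_factors n. {1..multiplicity p n}"
  have "(\<Sum>d | d dvd n. f d) = (\<Sum>d\<in>primepow_factors n. f d)"
    using assms by (intro sum.mono_neutral_right) (auto simp: primepow_factors_def)
  also have "primepow_factors n = (\<lambda>(p,k). p ^ k) ` ?A"
    using assms(1) by (subst primepow_factors_altdef) fastforce+
  also have "sum f \<dots> = (\<Sum>(p,k)\<in>?A. f (p ^ k))"
    by (subst sum.reindex) (auto simp: inj_on_def prime_power_inj'' prime_factors_multiplicity case_prod_unfold)
  also have "\<dots> = (\<Sum>p\<in>prime_factors n. \<Sum>j=1..multiplicity p n. f (p ^ j))"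
    by (rule sum.Sigma[symmetric]) auto
  finally show ?thesis .
qed

text \<open>A prime not dividing n has multiplicity 0, and g p does not divide 1, so all primes may
  be quantified over. In this form the condition at one prime separates from the rest.\<close>

lemma beta_altdef:
  assumes "\<And>p. g p \<noteq> 1"
  shows "beta g n = (if n > 0 \<and> (\<forall>p. prime p \<longrightarrow> \<not> g p dvd Suc (multiplicity p n)) then 1 else 0)"
proof -
  have "(\<forall>p\<in>prime_factors n. \<not> g p dvd Suc (multiplicity p n)) \<longleftrightarrow>
        (\<forall>p. prime p \<longrightarrow> \<not> g p dvd Suc (multiplicity p n))"
    using assms by (auto simp: prime_factors_multiplicity) (metis One_nat_def gr0I nat_dvd_1_iff_1)
  then show ?thesis by (simp add: beta_def)
qed

lemma beta_div_prime_power: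
  assumes g: "\<And>p. g p \<noteq> 1" and n: "n > 0" and p: "prime p" and j: "j \<le> multiplicity p n"
  shows "beta g (n div p ^ j) = (if g p dvd Suc (multiplicity p n - j) then 0 else 1) *
    (if \<forall>p'. prime p' \<and> p' \<noteq> p \<longrightarrow> \<not> g p' dvd Suc (multiplicity p' n) then 1 else 0)"
proof -
  obtain m where m: "n = p ^ j * m" using j multiplicity_dvd'[of j p n] by auto
  have m0: "m > 0" using n m by (auto intro: Nat.gr0I)
  have p0: "p ^ j \<noteq> 0" using prime_gt_0_nat[OF p] by simp
  have [simp]: "n div p ^ j = m" using m p0 by simp
  have mp: "multiplicity p m = multiplicity p n - j"
    unfolding m using p m0 p0 by (simp add: prime_elem_multiplicity_mult_distrib multiplicity_prime_power)
  have mp': "multiplicity p' m = multiplicity p' n" if "prime p'" "p' \<noteq> p" for p'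
    unfolding m using p m0 p0 that
    by (simp add: prime_elem_multiplicity_mult_distrib multiplicity_distinct_prime_power)
  have "(\<forall>p'. prime p' \<longrightarrow> \<not> g p' dvd Suc (multiplicity p' m)) \<longleftrightarrow>
      \<not> g p dvd Suc (multiplicity p n - j) \<and>
      (\<forall>p'. prime p' \<and> p' \<noteq> p \<longrightarrow> \<not> g p' dvd Suc (multiplicity p' n))"
    using mp mp' p by metis
  then show ?thesis unfolding beta_altdef[OF g] using m0 by auto
qed

text \<open>Removing p^j from n changes only the factor of the indicator at p, so the sum over j is
  \<open>local_log_deriv\<close> times the indicator at the other primes. The weights ln p, taken
  with multiplicity, add up to ln n.\<close>

lemma dconv_beta:
  assumes g: "\<And>p. g p \<noteq> 1" and n: "n > 0"
  shows "dconv (\<lambda>n. of_real (mangoldt n - dcoef g n)) (beta g) n = of_real (ln (real n)) * beta g n"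
proof -
  define c where "c = (\<lambda>n. complex_of_real (mangoldt n - dcoef g n))"
  have c0: "c d = 0" if "\<not> primepow d" for d using that by (simp add: c_def dcoef_def mangoldt_def)
  have cpp: "c (p ^ j) = of_real (ln (real p)) * of_real (1 - local_coeff (g p) j)" if "prime p" "j > 0" for p j
    using that by (simp add: c_def dcoef_prime_power algebra_simps)
  have inner: "(\<Sum>j=1..multiplicity p n. c (p ^ j) * beta g (n div p ^ j)) =
      of_real (ln (real p) * real (multiplicity p n)) * beta g n" if p: "p \<in> prime_factors n" for p
  proof -
    have pr: "prime p" using p by auto
    define R :: complex where "R = (if \<forall>p'. prime p' \<and> p' \<noteq> p \<longrightarrow> \<not> g p' dvd Suc (multiplicity p' n) then 1 else 0)"
    define a where "a = multiplicity p n"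
    have "(\<Sum>j=1..a. c (p ^ j) * beta g (n div p ^ j)) =
       (\<Sum>j=1..a. of_real (ln (real p)) * of_real ((1 - local_coeff (g p) j) * (if g p dvd Suc (a - j) then 0 else 1)) * R)"
      by (intro sum.cong refl) (auto simp: cpp pr beta_div_prime_power[OF g n pr] R_def a_def)
    also have "\<dots> = of_real (ln (real p)) * of_real (\<Sum>j=1..a. (1 - local_coeff (g p) j) * (if g p dvd Suc (a - j) then 0 else 1)) * R"
      by (simp only: sum_distrib_left sum_distrib_right of_real_sum)
    also have "\<dots> = of_real (ln (real p)) * of_real (if g p dvd Suc a then 0 else real a) * R"
      by (subst local_log_deriv[OF g]) (rule refl)
    also have "\<dots> = of_real (ln (real p) * real a) * beta g n"
      using beta_div_prime_power[OF g n pr, of 0] by (simp add: R_def a_def)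
    finally show ?thesis unfolding a_def .
  qed
  have "dconv c (beta g) n = (\<Sum>p\<in>prime_factors n. \<Sum>j=1..multiplicity p n. c (p ^ j) * beta g (n div p ^ j))"
    unfolding dconv_def using n c0 by (intro sum_primepow_divisors) auto
  also have "\<dots> = (\<Sum>p\<in>prime_factors n. of_real (ln (real p) * real (multiplicity p n)) * beta g n)"
    by (intro sum.cong refl inner)
  also have "\<dots> = of_real (\<Sum>p\<in>prime_factors n. ln (real p) * real (multiplicity p n)) * beta g n"
    by (simp add: sum_distrib_right)
  also have "(\<Sum>p\<in>prime_factors n. ln (real p) * real (multiplicity p n)) =
      (\<Sum>p\<in>prime_factors n. \<Sum>j=1..multiplicity p n. mangoldt (p ^ j))"
  proof (rule sum.cong[OF refl])
    fix p assume "p \<in> prime_factors n"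
    then have "(\<Sum>j=1..multiplicity p n. mangoldt (p ^ j)) = (\<Sum>j=1..multiplicity p n. ln (real p))"
      by (intro sum.cong) (auto simp: mangoldt_primepow in_prime_factors_imp_prime)
    then show "ln (real p) * real (multiplicity p n) = (\<Sum>j=1..multiplicity p n. mangoldt (p ^ j))"
      by simp
  qed
  also have "\<dots> = (\<Sum>d | d dvd n. mangoldt d)"
    using n by (intro sum_primepow_divisors[symmetric]) (auto simp: mangoldt_def)
  also have "\<dots> = ln (real n)" using n by (simp add: mangoldt_sum)
  finally show ?thesis unfolding c_def .
qed

lemma dconv_mangoldt:
  assumes n: "n > 0" and w: "\<And>x y. w (x * y) = w x * w y"
  shows "dconv (\<lambda>n. of_real (mangoldt n) * w n) w n = of_real (ln (real n)) * w n"
proof -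
  have "dconv (\<lambda>n. of_real (mangoldt n) * w n) w n = (\<Sum>d | d dvd n. of_real (mangoldt d) * w n)"
    unfolding dconv_def
  proof (intro sum.cong refl)
    fix d assume "d \<in> {d. d dvd n}"
    then have "w n = w d * w (n div d)" by (subst w[symmetric]) simp
    then show "of_real (mangoldt d) * w d * w (n div d) = of_real (mangoldt d) * w n" by simp
  qed
  also have "\<dots> = of_real (\<Sum>d | d dvd n. mangoldt d) * w n"
    by (simp only: sum_distrib_right of_real_sum)
  finally show ?thesis using n by (simp add: mangoldt_sum)
qed

lemma norm_local_coeff_le: "\<bar>local_coeff g j\<bar> \<le> 2 * real j" if "j > 0"
  using that by (auto simp: local_coeff_def dest: dvd_imp_le)

lemma multiplicity_mult_ln_le:
  assumes "primepow n"
  shows "real (multiplicity (aprimedivisor n) n) * ln (real (aprimedivisor n)) = ln (real n)"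
proof -
  have "aprimedivisor n > 0" using assms by (metis aprimedivisor_pos_nat primepow_gt_Suc_0 One_nat_def)
  then show ?thesis by (subst (3) primepow_decompose[OF assms, symmetric]) (simp add: ln_realpow)
qed

lemma abs_dcoef_le: "\<bar>dcoef g n\<bar> \<le> 2 * ln (real n)" if "n > 0"
proof (cases "primepow n")
  case True
  define p j where "p = aprimedivisor n" "j = multiplicity p n"
  have j: "j > 0" using primepow_decompose[OF True] primepow_gt_Suc_0[OF True]
    unfolding p_j_def by (intro Nat.gr0I) auto
  have "prime p" using prime_aprimedivisor'[of n] primepow_gt_Suc_0[OF True]
    unfolding p_j_def by simp
  then have p: "ln (real p) \<ge> 0" using prime_ge_1_nat[of p] by simp
  have "\<bar>dcoef g n\<bar> = ln (real p) * \<bar>local_coeff (g p) j\<bar>"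
    using True p by (simp add: dcoef_def p_j_def mangoldt_def abs_mult)
  also have "\<dots> \<le> ln (real p) * (2 * real j)" using p norm_local_coeff_le[OF j] by (intro mult_left_mono)
  also have "\<dots> = 2 * ln (real n)" using multiplicity_mult_ln_le[OF True] by (simp add: p_j_def mult.commute)
  finally show ?thesis .
qed (use that in \<open>simp add: dcoef_def mangoldt_def\<close>)

lemma subpoly_mangoldt: "subpoly (\<lambda>n. of_real (mangoldt n))"
  by (rule subpoly_mono[OF subpoly_ln, where C = 1]) (auto simp: mangoldt_le)

lemma subpoly_dcoef: "subpoly (\<lambda>n. of_real (dcoef g n))"
  by (rule subpoly_mono[OF subpoly_ln, where C = 2]) (use abs_dcoef_le in auto)

lemma subpoly_beta: "subpoly (beta g)"
  by (rule subpoly_bounded[of _ 1]) (auto simp: beta_def)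

lemma subpoly_diff_dcoef: "subpoly (\<lambda>n. of_real (mangoldt n - dcoef g n))"
  using subpoly_add[OF subpoly_mangoldt subpoly_mult[OF subpoly_bounded[of "\<lambda>_. -1" 1] subpoly_dcoef[of g]]]
  by simp

lemma ds_cong: "(\<And>n. n > 0 \<Longrightarrow> f n = g n) \<Longrightarrow> ds f s = ds g s"
  unfolding ds_def by (rule suminf_cong) (metis mult_zero_right of_nat_0 powr_0 gr0I)

text \<open>The convolution identity plays the role of a logarithmic derivative, so zeta, the
  characters and the indicator \<open>beta\<close> are treated alike, without Euler
  products.\<close>

lemma ds_log_deriv:
  assumes f: "subpoly f" and c: "subpoly c" and s: "Re s > 1"
    and conv: "\<And>n. n > 0 \<Longrightarrow> dconv c f n = of_real (ln (real n)) * f n"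
  shows "(ds f has_field_derivative - (ds c s * ds f s)) (at s)"
proof -
  have "ds c s * ds f s = ds (\<lambda>n. of_real (ln (real n)) * f n) s"
    unfolding ds_mult[OF c f s] using conv by (rule ds_cong)
  then show ?thesis using ds_has_field_derivative[OF f s] by simp
qed

section \<open>The zeta function near 1\<close>

definition rzeta :: "real \<Rightarrow> real" where "rzeta s = (\<Sum>n. real (Suc n) powr (- s))"
text \<open>Minus the derivative of zeta on the real axis.\<close>

definition rzeta_ln :: "real \<Rightarrow> real" where "rzeta_ln s = (\<Sum>n. ln (real (Suc n)) * real (Suc n) powr (- s))"

lemma powr_diff_bound:
  assumes "s > 0" "n > 0"
  shows "0 \<le> real n powr (- s) - real (Suc n) powr (- s)"
    "real n powr (- s) - real (Suc n) powr (- s) \<le> s * real n powr (- s - 1)"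
    "s * real (Suc n) powr (- s - 1) \<le> real n powr (- s) - real (Suc n) powr (- s)"
proof -
  have "\<exists>\<xi>. \<xi> > real n \<and> \<xi> < real (Suc n) \<and>
     real (Suc n) powr (- s) - real n powr (- s) = (real (Suc n) - real n) * ((- s) * \<xi> powr (- s - 1))"
    using assms by (intro MVT2) (auto intro!: derivative_eq_intros)
  then obtain \<xi> where \<xi>: "\<xi> > real n" "\<xi> < real (Suc n)"
    "real n powr (- s) - real (Suc n) powr (- s) = s * \<xi> powr (- s - 1)" by auto
  have "\<xi> powr (- s - 1) \<le> real n powr (- s - 1)" "real (Suc n) powr (- s - 1) \<le> \<xi> powr (- s - 1)"
    using \<xi> assms by (auto intro!: powr_mono2')
  then show "0 \<le> real n powr (- s) - real (Suc n) powr (- s)"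
    "real n powr (- s) - real (Suc n) powr (- s) \<le> s * real n powr (- s - 1)"
    "s * real (Suc n) powr (- s - 1) \<le> real n powr (- s) - real (Suc n) powr (- s)"
    unfolding \<xi>(3) using assms by (auto intro: mult_left_mono)
qed

lemma filterlim_real_Suc_plus: "filterlim (\<lambda>n. real (Suc n)) at_top sequentially"
  using filterlim_compose[OF filterlim_real_sequentially filterlim_Suc] by simp

lemma powr_tendsto_0_seq: "s > 0 \<Longrightarrow> (\<lambda>n. real (Suc n) powr (- s)) \<longlonglongrightarrow> 0"
  by (intro tendsto_neg_powr filterlim_real_Suc_plus) auto

lemma eventually_at_right_1_2: "\<forall>\<^sub>F s::real in at_right 1. s > 1 \<and> s < 2"
  unfolding eventually_at_right_field by (intro exI[of _ 2]) auto

text \<open>The term (n + 1)^(-s) minus the integral of t^(-s) over [n + 1, n + 2].\<close>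

definition zeta_err :: "real \<Rightarrow> nat \<Rightarrow> real" where
  "zeta_err s n = real (Suc n) powr (- s) - (real (Suc n) powr (1 - s) - real (Suc (Suc n)) powr (1 - s)) / (s - 1)"

lemma zeta_err_bounds:
  assumes "s > 1"
  shows "0 \<le> zeta_err s n" "zeta_err s n \<le> real (Suc n) powr (- s) - real (Suc (Suc n)) powr (- s)"
  using powr_diff_bound(2,3)[of "s - 1" "Suc n"] assms
  by (auto simp: zeta_err_def field_simps)

lemma zeta_main_sums:
  assumes "s > 1"
  shows "(\<lambda>n. (real (Suc n) powr (1 - s) - real (Suc (Suc n)) powr (1 - s)) / (s - 1)) sums (1 / (s - 1))"
proof -
  have "(\<lambda>n. real (Suc n) powr (1 - s)) \<longlonglongrightarrow> 0" using powr_tendsto_0_seq[of "s - 1"] assms by simp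
  from telescope_sums'[OF this] have "(\<lambda>n. real (Suc n) powr (1 - s) - real (Suc (Suc n)) powr (1 - s)) sums 1"
    by simp
  then show ?thesis by (rule sums_divide)
qed

lemma summable_rzeta: "s > 1 \<Longrightarrow> summable (\<lambda>n. real (Suc n) powr (- s))"
  using summable_real_powr_iff[of "- s"] by (subst summable_Suc_iff) simp

lemma rzeta_sums_err:
  assumes "s > 1"
  shows "zeta_err s sums (rzeta s - 1 / (s - 1))"
  unfolding zeta_err_def rzeta_def
  by (intro sums_diff summable_sums[OF summable_rzeta[OF assms]] zeta_main_sums[OF assms])

lemma rzeta_bounds:
  assumes "s > 1"
  shows "rzeta s \<le> 1 + 1 / (s - 1)" "1 / (s - 1) \<le> rzeta s"
proof -
  have "(\<lambda>n. real (Suc n) powr (- s)) \<longlonglongrightarrow> 0" using powr_tendsto_0_seq[of s] assms by simp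
  from telescope_sums'[OF this]
  have 1: "(\<lambda>n. real (Suc n) powr (- s) - real (Suc (Suc n)) powr (- s)) sums 1" by simp
  have "rzeta s - 1 / (s - 1) \<le> 1"
    using sums_le[OF zeta_err_bounds(2)[OF assms] rzeta_sums_err[OF assms] 1] .
  then show "rzeta s \<le> 1 + 1 / (s - 1)" by simp
  have "0 \<le> rzeta s - 1 / (s - 1)"
    using sums_le[OF zeta_err_bounds(1)[OF assms] sums_zero rzeta_sums_err[OF assms]] .
  then show "1 / (s - 1) \<le> rzeta s" by simp
qed

lemma zeta_err_tendsto: "((\<lambda>s. zeta_err s n) \<longlongrightarrow> inverse (real (n+1)) + ln (real (n+1)) - ln (real (n+2))) (at_right 1)"
proof -
  define D where "D = (\<lambda>s::real. real (Suc n) powr (1 - s) - real (Suc (Suc n)) powr (1 - s))"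
  have "(D has_real_derivative (ln (real (Suc (Suc n))) - ln (real (Suc n)))) (at 1)"
    unfolding D_def powr_def by (rule derivative_eq_intros refl | simp)+
  then have "((\<lambda>s. (D s - D 1) / (s - 1)) \<longlongrightarrow> ln (real (Suc (Suc n))) - ln (real (Suc n))) (at 1)"
    by (simp add: has_field_derivative_iff)
  then have "((\<lambda>s. (D s - D 1) / (s - 1)) \<longlongrightarrow> ln (real (Suc (Suc n))) - ln (real (Suc n))) (at_right 1)"
    by (rule tendsto_within_subset) auto
  moreover have "D 1 = 0" by (simp add: D_def)
  ultimately have "((\<lambda>s. D s / (s - 1)) \<longlongrightarrow> ln (real (Suc (Suc n))) - ln (real (Suc n))) (at_right 1)" by simp
  moreover have "((\<lambda>s::real. real (Suc n) powr (- s)) \<longlongrightarrow> real (Suc n) powr (- 1)) (at_right 1)"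
    by (intro tendsto_intros) auto
  ultimately have "((\<lambda>s. real (Suc n) powr (- s) - D s / (s - 1)) \<longlongrightarrow>
       real (Suc n) powr (- 1) - (ln (real (Suc (Suc n))) - ln (real (Suc n)))) (at_right 1)"
    by (intro tendsto_diff)
  moreover have "zeta_err s n = real (Suc n) powr (- s) - D s / (s - 1)" for s
    by (simp only: zeta_err_def D_def)
  moreover have "real (Suc n) powr (- 1) - (ln (real (Suc (Suc n))) - ln (real (Suc n))) =
      inverse (real (n+1)) + ln (real (n+1)) - ln (real (n+2))"
    by (simp add: powr_minus)
  ultimately show ?thesis by (simp only:)
qed

text \<open>The errors against the integral are dominated by 2 (n + 1)^(-2) for 1 < s < 2, and their
  limits at 1 form the telescoped series of Euler's constant.\<close>

lemma rzeta_minus_pole_tendsto: "((\<lambda>s. rzeta s - 1 / (s - 1)) \<longlongrightarrow> euler_mascheroni) (at_right 1)"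
proof -
  have "((\<lambda>s. \<Sum>n. zeta_err s n) \<longlongrightarrow> (\<Sum>n. inverse (real (n+1)) + ln (real (n+1)) - ln (real (n+2)))) (at_right 1)"
  proof (rule tannerys_theorem[THEN conjunct2, THEN conjunct2])
    show "((\<lambda>s. zeta_err s n) \<longlongrightarrow> inverse (real (n+1)) + ln (real (n+1)) - ln (real (n+2))) (at_right 1)" for n
      by (rule zeta_err_tendsto)
    have "\<forall>\<^sub>F s::real in at_right 1. s > 1 \<and> s < 2"
      by (rule eventually_at_right_1_2)
    then have "\<forall>\<^sub>F (k, s) in (sequentially :: nat filter) \<times>\<^sub>F at_right (1::real). s > 1 \<and> s < 2"
      by (subst eventually_prod2) auto
    then show "\<forall>\<^sub>F (k, s) in sequentially \<times>\<^sub>F at_right 1. norm (zeta_err s k) \<le> 2 * real (Suc k) powr (- 2)"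
    proof eventually_elim
      case (elim y)
      obtain k s where y: "y = (k, s)" by (cases y)
      with elim have s: "s > 1" "s < 2" by auto
      have "norm (zeta_err s k) \<le> real (Suc k) powr (- s) - real (Suc (Suc k)) powr (- s)"
        using zeta_err_bounds[OF s(1), of k] by simp
      also have "\<dots> \<le> s * real (Suc k) powr (- s - 1)" using s by (intro powr_diff_bound) auto
      also have "\<dots> \<le> 2 * real (Suc k) powr (- 2)" using s by (intro mult_mono powr_mono) auto
      finally show ?case by (simp add: y)
    qed
    show "summable (\<lambda>k. 2 * real (Suc k) powr (- 2))"
      by (intro summable_mult summable_rzeta) auto
  qed auto
  moreover have "(\<Sum>n. inverse (real (n+1)) + ln (real (n+1)) - ln (real (n+2))) = euler_mascheroni"
    using euler_mascheroni_sum_real by (simp add: sums_iff)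
  ultimately have "((\<lambda>s. \<Sum>n. zeta_err s n) \<longlongrightarrow> euler_mascheroni) (at_right 1)" by (simp only:)
  moreover have "\<forall>\<^sub>F s::real in at_right 1. (\<Sum>n. zeta_err s n) = rzeta s - 1 / (s - 1)"
    using eventually_at_right_1_2 by eventually_elim (use rzeta_sums_err in \<open>auto simp: sums_iff\<close>)
  ultimately show ?thesis by (rule Lim_transform_eventually)
qed

lemma summable_rzeta_ln:
  assumes "s > 1" shows "summable (\<lambda>n. ln (real (Suc n)) * real (Suc n) powr (- s))"
proof (rule summable_comparison_test'[where N = 0])
  show "summable (\<lambda>n. (2 / (s - 1)) * real (Suc n) powr (- ((1 + s) / 2)))"
    using assms by (intro summable_mult summable_rzeta) auto
  show "norm (ln (real (Suc n)) * real (Suc n) powr (- s)) \<le> (2 / (s - 1)) * real (Suc n) powr (- ((1 + s) / 2))" for n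
  proof -
    have "ln (real (Suc n)) \<le> real (Suc n) powr ((s - 1) / 2) / ((s - 1) / 2)"
      using assms by (intro ln_powr_bound) auto
    then have "ln (real (Suc n)) * real (Suc n) powr (- s) \<le> real (Suc n) powr ((s - 1) / 2) / ((s - 1) / 2) * real (Suc n) powr (- s)"
      by (intro mult_right_mono) auto
    also have "\<dots> = (2 / (s - 1)) * (real (Suc n) powr ((s - 1) / 2) * real (Suc n) powr (- s))" by simp
    also have "real (Suc n) powr ((s - 1) / 2) * real (Suc n) powr (- s) = real (Suc n) powr (- ((1 + s) / 2))"
      by (subst powr_add[symmetric], rule arg_cong[where f = "\<lambda>x. real (Suc n) powr x"]) (simp add: field_simps)
    finally show ?thesis by simp
  qed
qed

text \<open>For s > 1 this is the integral of u^(-s) ln u over u from t to infinity.\<close>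

definition zeta_ln_prim :: "real \<Rightarrow> real \<Rightarrow> real" where
  "zeta_ln_prim s t = t powr (1 - s) * (ln t / (s - 1) + 1 / (s - 1)\<^sup>2)"

lemma zeta_ln_prim_deriv:
  assumes "s > 1" "t > 0"
  shows "(zeta_ln_prim s has_real_derivative (- (ln t * t powr (- s)))) (at t)"
proof -
  have "((\<lambda>t. ln t / (s - 1) + 1 / (s - 1)\<^sup>2) has_real_derivative 1 / t / (s - 1)) (at t)"
    using assms by (auto intro!: derivative_eq_intros)
  from DERIV_mult[OF has_real_derivative_powr[OF assms(2), of "1 - s"] this]
  have "(zeta_ln_prim s has_real_derivative
     ((1 - s) * t powr (1 - s - 1)) * (ln t / (s - 1) + 1 / (s - 1)\<^sup>2) + t powr (1 - s) * (1 / t / (s - 1))) (at t)"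
    by (simp add: zeta_ln_prim_def[abs_def] mult_ac)
  also have "t powr (1 - s) * (1 / t / (s - 1)) = t powr (- s) / (s - 1)"
    using assms powr_diff[of t "1 - s" 1] by (simp add: field_simps)
  also have "((1 - s) * t powr (1 - s - 1)) * (ln t / (s - 1) + 1 / (s - 1)\<^sup>2) + t powr (- s) / (s - 1) = - (ln t * t powr (- s))"
    using assms by (simp add: divide_simps power2_eq_square) (simp add: algebra_simps)
  finally show ?thesis .
qed

text \<open>The difference of \<open>zeta_ln_prim\<close> is the integrand at an intermediate point,
  and the derivative of the integrand is O(t^(-3/2)) uniformly in s.\<close>

lemma zeta_ln_diff_bound:
  assumes s: "s > 1" "s \<le> 2"
  shows "\<bar>ln (real (Suc n)) * real (Suc n) powr (- s) - (zeta_ln_prim s (real (Suc n)) - zeta_ln_prim s (real (Suc (Suc n))))\<bar>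
     \<le> 9 * real (Suc n) powr (- 3/2)"
proof -
  define \<psi> where "\<psi> = (\<lambda>t::real. ln t * t powr (- s))"
  have "\<exists>\<xi>. \<xi> > real (Suc n) \<and> \<xi> < real (Suc (Suc n)) \<and>
     zeta_ln_prim s (real (Suc (Suc n))) - zeta_ln_prim s (real (Suc n)) = (real (Suc (Suc n)) - real (Suc n)) * (- \<psi> \<xi>)"
    unfolding \<psi>_def using s by (intro MVT2) (auto intro!: zeta_ln_prim_deriv)
  then obtain \<xi> where \<xi>: "\<xi> > real (Suc n)" "\<xi> < real (Suc (Suc n))"
    "zeta_ln_prim s (real (Suc n)) - zeta_ln_prim s (real (Suc (Suc n))) = \<psi> \<xi>" by auto
  have "\<exists>\<eta>. \<eta> > real (Suc n) \<and> \<eta> < \<xi> \<and> \<psi> \<xi> - \<psi> (real (Suc n)) = (\<xi> - real (Suc n)) * ((1 - s * ln \<eta>) * \<eta> powr (- s - 1))"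
  proof (rule MVT2[OF \<xi>(1)])
    fix x assume "real (Suc n) \<le> x" "x \<le> \<xi>"
    then have x: "x > 0" by linarith
    have "(\<psi> has_real_derivative (1 / x * x powr (- s) + ln x * ((- s) * x powr (- s - 1)))) (at x)"
      unfolding \<psi>_def using x by (auto intro!: derivative_eq_intros simp: field_simps)
    also have "1 / x * x powr (- s) = x powr (- s - 1)" using x powr_diff[of x "- s" 1] by simp
    also have "x powr (- s - 1) + ln x * ((- s) * x powr (- s - 1)) = (1 - s * ln x) * x powr (- s - 1)"
      by (simp add: algebra_simps)
    finally show "(\<psi> has_real_derivative (1 - s * ln x) * x powr (- s - 1)) (at x)" .
  qed
  then obtain \<eta> where \<eta>: "\<eta> > real (Suc n)" "\<eta> < \<xi>"
    "\<psi> \<xi> - \<psi> (real (Suc n)) = (\<xi> - real (Suc n)) * ((1 - s * ln \<eta>) * \<eta> powr (- s - 1))" by blast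
  have \<eta>1: "\<eta> \<ge> 1" using \<eta>(1) by simp
  have sq: "ln \<eta> \<le> 2 * \<eta> powr (1/2)" using ln_powr_bound[of \<eta> "1/2"] \<eta>1 by simp
  have "\<bar>1 - s * ln \<eta>\<bar> \<le> 1 + 2 * ln \<eta>"
  proof -
    have "0 \<le> s * ln \<eta>" "s * ln \<eta> \<le> 2 * ln \<eta>" using s \<eta>1 by (auto intro!: mult_right_mono)
    then show ?thesis by linarith
  qed
  also have "\<dots> \<le> 9 * \<eta> powr (1/2)" using sq ge_one_powr_ge_zero[OF \<eta>1, of "1/2"] by linarith
  finally have b1: "\<bar>1 - s * ln \<eta>\<bar> \<le> 9 * \<eta> powr (1/2)" .
  have "\<bar>\<psi> \<xi> - \<psi> (real (Suc n))\<bar> = (\<xi> - real (Suc n)) * (\<bar>1 - s * ln \<eta>\<bar> * \<eta> powr (- s - 1))"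
    unfolding \<eta>(3) using \<xi> by (simp add: abs_mult)
  also have "\<dots> \<le> 1 * (9 * \<eta> powr (1/2) * \<eta> powr (- 2))"
    using \<xi> s \<eta>1 b1 by (intro mult_mono powr_mono) auto
  also have "\<dots> = 9 * \<eta> powr (- 3/2)" by (simp add: powr_add[symmetric])
  also have "\<dots> \<le> 9 * real (Suc n) powr (- 3/2)" using \<eta>(1) by (intro mult_left_mono powr_mono2') auto
  finally show ?thesis unfolding \<xi>(3) by (simp add: \<psi>_def abs_minus_commute)
qed

lemma zeta_ln_main_sums:
  assumes "s > 1"
  shows "(\<lambda>n. zeta_ln_prim s (real (Suc n)) - zeta_ln_prim s (real (Suc (Suc n)))) sums (1 / (s - 1)\<^sup>2)"
proof -
  have "(zeta_ln_prim s \<longlongrightarrow> 0) at_top"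
    unfolding zeta_ln_prim_def using assms by real_asymp
  from filterlim_compose[OF this filterlim_real_Suc_plus]
  have "(\<lambda>n. zeta_ln_prim s (real (Suc n))) \<longlonglongrightarrow> 0" .
  from telescope_sums'[OF this] show ?thesis by (simp add: zeta_ln_prim_def)
qed

lemma rzeta_ln_bound:
  obtains M where "M > 0" "\<And>s. s > 1 \<Longrightarrow> s \<le> 2 \<Longrightarrow> \<bar>rzeta_ln s - 1 / (s - 1)\<^sup>2\<bar> \<le> M"
proof -
  define M where "M = (\<Sum>n. 9 * real (Suc n) powr (- 3/2))"
  have sm: "summable (\<lambda>n. 9 * real (Suc n) powr (- 3/2))"
    using summable_rzeta[of "3/2"] by (intro summable_mult) simp
  have M: "M \<ge> 0" unfolding M_def by (intro suminf_nonneg sm) auto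
  show ?thesis
  proof (rule that[of "M + 1"])
    fix s :: real assume s: "s > 1" "s \<le> 2"
    define f where "f = (\<lambda>n. ln (real (Suc n)) * real (Suc n) powr (- s) - (zeta_ln_prim s (real (Suc n)) - zeta_ln_prim s (real (Suc (Suc n)))))"
    have fs: "f sums (rzeta_ln s - 1 / (s - 1)\<^sup>2)"
      unfolding f_def rzeta_ln_def
      by (intro sums_diff summable_sums[OF summable_rzeta_ln[OF s(1)]] zeta_ln_main_sums[OF s(1)])
    have "norm (suminf f) \<le> M" unfolding M_def
      by (rule norm_suminf_le[OF _ sm]) (use zeta_ln_diff_bound[OF s] in \<open>simp add: f_def\<close>)
    then show "\<bar>rzeta_ln s - 1 / (s - 1)\<^sup>2\<bar> \<le> M + 1" using fs by (simp add: sums_iff)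
  qed (use M in auto)
qed

lemma ds_one_eq: "s > 1 \<Longrightarrow> ds (\<lambda>_. 1) (of_real s) = of_real (rzeta s)"
  and ds_ln_eq: "s > 1 \<Longrightarrow> ds (\<lambda>n. of_real (ln (real n)) * 1) (of_real s) = of_real (rzeta_ln s)"
proof -
  assume s: "s > 1"
  have *: "(of_nat (Suc n) :: complex) powr (- of_real s) = of_real (real (Suc n) powr (- s))" for n
    by (metis of_nat_0_le_iff of_real_minus of_real_of_nat_eq powr_of_real)
  have "(\<lambda>n. of_real (real (Suc n) powr (- s)) :: complex) sums of_real (rzeta s)"
    using summable_sums[OF summable_rzeta[OF s]] unfolding rzeta_def by (rule sums_of_real)
  then have "(\<lambda>n. 1 * of_nat (Suc n) powr (- of_real s) :: complex) sums of_real (rzeta s)"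
    by (simp only: * mult_1)
  from sums_Suc_imp[OF _ this] have "(\<lambda>n. 1 * of_nat n powr (- of_real s) :: complex) sums of_real (rzeta s)"
    by simp
  then show "ds (\<lambda>_. 1) (of_real s) = of_real (rzeta s)" by (simp add: ds_def sums_iff)
  have "(\<lambda>n. of_real (ln (real (Suc n)) * real (Suc n) powr (- s)) :: complex) sums of_real (rzeta_ln s)"
    using summable_sums[OF summable_rzeta_ln[OF s]] unfolding rzeta_ln_def by (rule sums_of_real)
  then have "(\<lambda>n. of_real (ln (real (Suc n))) * 1 * of_nat (Suc n) powr (- of_real s) :: complex) sums of_real (rzeta_ln s)"
    by (simp only: * mult_1_right of_real_mult)
  from sums_Suc_imp[OF _ this]
  have "(\<lambda>n. of_real (ln (real n)) * 1 * of_nat n powr (- of_real s) :: complex) sums of_real (rzeta_ln s)"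
    by simp
  then show "ds (\<lambda>n. of_real (ln (real n)) * 1) (of_real s) = of_real (rzeta_ln s)" by (simp add: ds_def sums_iff)
qed

lemma ds_mangoldt_eq:
  assumes "s > 1"
  shows "ds mangoldt (of_real s) = of_real (rzeta_ln s / rzeta s)"
proof -
  have "ds (\<lambda>n. of_real (mangoldt n) * 1) (of_real s) * ds (\<lambda>_. 1) (of_real s) = ds (\<lambda>n. of_real (ln (real n)) * 1) (of_real s)"
    using assms subpoly_mangoldt
    by (subst ds_mult) (auto intro!: ds_cong subpoly_bounded[of _ 1] dconv_mangoldt[of _ "\<lambda>_. 1", simplified])
  moreover have "rzeta s > 0" using rzeta_bounds(2)[OF assms] assms by (smt (verit) divide_pos_pos)
  ultimately show ?thesis unfolding ds_one_eq[OF assms] ds_ln_eq[OF assms]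
    by (simp add: field_simps)
qed

text \<open>Write u = s - 1, zeta = 1/u + A and -zeta' = 1/u^2 + B. Then the expression equals (A -
  u B) / (1 + u A), where A tends to Euler's constant and B only has to be bounded.\<close>

lemma ds_mangoldt_pole_tendsto:
  "((\<lambda>s. of_real (1 / (s - 1)) - ds mangoldt (of_real s)) \<longlongrightarrow> euler_mascheroni) (at_right 1)"
proof -
  obtain M where M: "M > 0" "\<And>s. s > 1 \<Longrightarrow> s \<le> 2 \<Longrightarrow> \<bar>rzeta_ln s - 1 / (s - 1)\<^sup>2\<bar> \<le> M"
    using rzeta_ln_bound by blast
  define A where "A = (\<lambda>s. rzeta s - 1 / (s - 1))"
  define B where "B = (\<lambda>s. rzeta_ln s - 1 / (s - 1)\<^sup>2)"
  have A: "(A \<longlongrightarrow> euler_mascheroni) (at_right 1)" unfolding A_def by (rule rzeta_minus_pole_tendsto)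
  have u: "((\<lambda>s::real. s - 1) \<longlongrightarrow> 0) (at_right 1)"
    by (auto intro!: tendsto_eq_intros)
  have near: "\<forall>\<^sub>F s::real in at_right 1. s > 1 \<and> s < 2"
    by (rule eventually_at_right_1_2)
  have uB: "((\<lambda>s. (s - 1) * B s) \<longlongrightarrow> 0) (at_right 1)"
  proof (rule Lim_null_comparison)
    show "\<forall>\<^sub>F s in at_right 1. norm ((s - 1) * B s) \<le> (s - 1) * M"
      using near by eventually_elim (use M in \<open>auto simp: abs_mult B_def intro!: mult_left_mono\<close>)
    show "((\<lambda>s. (s - 1) * M) \<longlongrightarrow> 0) (at_right 1)" using tendsto_mult_left_zero[OF u] .
  qed
  have "((\<lambda>s. (A s - (s - 1) * B s) / (1 + (s - 1) * A s)) \<longlongrightarrow> (euler_mascheroni - 0) / (1 + 0 * euler_mascheroni)) (at_right 1)"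
    by (intro tendsto_intros A u uB) auto
  moreover have "\<forall>\<^sub>F s in at_right 1. (A s - (s - 1) * B s) / (1 + (s - 1) * A s) = 1 / (s - 1) - rzeta_ln s / rzeta s"
    using near
  proof eventually_elim
    case (elim s)
    have "rzeta s > 0" using rzeta_bounds(2)[of s] elim by (smt (verit) divide_pos_pos)
    moreover have "1 + (s - 1) * A s = (s - 1) * rzeta s" using elim by (simp add: A_def field_simps)
    moreover have "A s - (s - 1) * B s = rzeta s - (s - 1) * rzeta_ln s"
    proof -
      have "(s - 1) / (s - 1)\<^sup>2 = 1 / (s - 1)" using elim by (simp add: power2_eq_square)
      then show ?thesis by (simp add: A_def B_def right_diff_distrib)
    qed
    ultimately have "(A s - (s - 1) * B s) / (1 + (s - 1) * A s) = (rzeta s - (s - 1) * rzeta_ln s) / ((s - 1) * rzeta s)"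
      "rzeta s \<noteq> 0" by simp_all
    then show ?case using elim by (simp add: diff_divide_distrib)
  qed
  ultimately have "((\<lambda>s. 1 / (s - 1) - rzeta_ln s / rzeta s) \<longlongrightarrow> (euler_mascheroni - 0) / (1 + 0 * euler_mascheroni)) (at_right 1)"
    by (rule Lim_transform_eventually)
  then have "((\<lambda>s. 1 / (s - 1) - rzeta_ln s / rzeta s) \<longlongrightarrow> euler_mascheroni) (at_right 1)"
    by simp
  then have "((\<lambda>s. complex_of_real (1 / (s - 1) - rzeta_ln s / rzeta s)) \<longlongrightarrow> of_real euler_mascheroni) (at_right 1)"
    by (rule tendsto_of_real)
  moreover have "\<forall>\<^sub>F s in at_right 1. complex_of_real (1 / (s - 1) - rzeta_ln s / rzeta s) = of_real (1 / (s - 1)) - ds mangoldt (of_real s)"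
    using near by eventually_elim (simp add: ds_mangoldt_eq)
  ultimately have "((\<lambda>s. of_real (1 / (s - 1)) - ds mangoldt (of_real s)) \<longlongrightarrow> of_real euler_mascheroni) (at_right 1)"
    by (rule Lim_transform_eventually)
  then show ?thesis by simp
qed

section \<open>L-functions of periodic sequences with mean zero\<close>

text \<open>These properties already give the continuation of L to Re s > 0 and its bounds near 1;
  multiplicativity enters with \<open>prime_character\<close>.\<close>

locale mean_zero_periodic =
  fixes ch :: "nat \<Rightarrow> complex" and q :: nat
  assumes q3: "q \<ge> 3"
    and periodic: "ch (n + q) = ch n"
    and norm_le_1: "norm (ch n) \<le> 1"
    and chi_0: "ch 0 = 0"
    and sum_period: "(\<Sum>n<q. ch n) = 0"
begin

definition A :: "nat \<Rightarrow> complex" where "A N = (\<Sum>n\<le>N. ch n)"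

text \<open>The series of ch(n) n^(-s) after partial summation. As the partial sums A are bounded by
  q, it converges absolutely for Re s > 0.\<close>

definition L :: "complex \<Rightarrow> complex" where
  "L s = (\<Sum>n. A n * (of_nat n powr (- s) - of_nat (Suc n) powr (- s)))"

lemma sum_shift_period: "(\<Sum>n<N + q. ch n) = (\<Sum>n<N. ch n)"
  by (induction N) (use sum_period periodic in auto)

lemma norm_partial_sum_le: "norm (\<Sum>n<N. ch n) \<le> real q"
proof (induction N rule: less_induct)
  case (less N)
  show ?case
  proof (cases "N < q")
    case True
    have "norm (\<Sum>n<N. ch n) \<le> (\<Sum>n<N. 1)" by (intro sum_norm_le norm_le_1)
    then show ?thesis using True by simp
  next
    case False
    then have "(\<Sum>n<N. ch n) = (\<Sum>n<N - q. ch n)" using sum_shift_period[of "N - q"] by simp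
    then show ?thesis using less.IH[of "N - q"] False q3 by simp
  qed
qed

lemma A_0 [simp]: "A 0 = 0" by (simp add: A_def chi_0)
lemma A_Suc: "A (Suc n) = A n + ch (Suc n)" by (simp add: A_def)
lemma A_period: "A (n + q) = A n"
  using sum_shift_period[of "Suc n"] by (simp add: A_def lessThan_Suc_atMost[symmetric])
lemma norm_A_le: "norm (A n) \<le> real q"
  using norm_partial_sum_le[of "Suc n"] by (simp add: A_def lessThan_Suc_atMost)
lemma A_q_minus_1: "A (q - 1) = 0"
  using sum_period q3 by (simp add: A_def lessThan_Suc_atMost[symmetric])

lemma norm_powr_diff_le:
  assumes "Re s > 0" "n > 0"
  shows "norm (of_nat n powr (- s) - of_nat (Suc n) powr (- s)) \<le> norm s * real n powr (- Re s - 1)"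
proof -
  let ?S = "closed_segment (of_nat n) (of_nat (Suc n)) :: complex set"
  have S: "\<exists>t. z = of_real t \<and> t \<ge> real n" if z: "z \<in> ?S" for z
  proof -
    obtain u where u: "z = (1 - u) *\<^sub>R of_nat n + u *\<^sub>R of_nat (Suc n)" "0 \<le> u" "u \<le> 1"
      using z by (auto simp: closed_segment_def)
    then have "z = of_real (real n + u)" by (simp add: scaleR_conv_of_real algebra_simps)
    then show ?thesis using u by (intro exI[of _ "real n + u"]) auto
  qed
  have "norm (of_nat n powr (- s) - of_nat (Suc n) powr (- s)) \<le> (norm s * real n powr (- Re s - 1)) * norm (of_nat n - of_nat (Suc n) :: complex)"
  proof (rule field_differentiable_bound[where S = ?S and f = "\<lambda>z. z powr (- s)" and f' = "\<lambda>z. - s * z powr (- s - 1)"])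
    show "((\<lambda>z. z powr (- s)) has_field_derivative - s * z powr (- s - 1)) (at z within ?S)" if z: "z \<in> ?S" for z
    proof -
      obtain t where t: "z = of_real t" "t \<ge> real n" using S[OF z] by blast
      then have "z \<notin> \<real>\<^sub>\<le>\<^sub>0" using assms(2) by (auto simp: complex_nonpos_Reals_iff)
      then have "((\<lambda>z. z powr (- s)) has_field_derivative - s * z powr (- s - 1)) (at z)"
        by (rule has_field_derivative_powr)
      then show ?thesis by (rule DERIV_subset) simp
    qed
    show "norm (- s * z powr (- s - 1)) \<le> norm s * real n powr (- Re s - 1)" if z: "z \<in> ?S" for z
    proof -
      obtain t where t: "z = of_real t" "t \<ge> real n" using S[OF z] by blast
      have "norm (z powr (- s - 1)) = t powr (- Re s - 1)"
        unfolding t using t assms by (subst norm_powr_real_powr) auto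
      also have "\<dots> \<le> real n powr (- Re s - 1)" using t assms by (intro powr_mono2') auto
      finally show ?thesis by (simp add: norm_mult mult_left_mono)
    qed
  qed auto
  then show ?thesis by simp
qed

lemma norm_L_term_le:
  assumes "Re s > 0"
  shows "norm (A n * (of_nat n powr (- s) - of_nat (Suc n) powr (- s))) \<le> real q * (norm s * real n powr (- Re s - 1))"
proof (cases "n = 0")
  case False
  then show ?thesis unfolding norm_mult using norm_powr_diff_le[OF assms, of n]
    by (intro mult_mono norm_A_le) auto
qed simp

lemma summable_L:
  assumes "Re s > 0"
  shows "summable (\<lambda>n. A n * (of_nat n powr (- s) - of_nat (Suc n) powr (- s)))"
proof (rule summable_comparison_test'[where N = 0])
  show "summable (\<lambda>n. real q * (norm s * real n powr (- Re s - 1)))"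
    using assms by (intro summable_mult) (simp add: summable_real_powr_iff)
qed (use norm_L_term_le[OF assms] in auto)

lemma L_holomorphic: "L holomorphic_on {s. Re s > 0}"
proof (rule holomorphic_uniform_sequence)
  let ?S = "{s::complex. Re s > 0}"
  show "open ?S" by (rule open_halfspace_Re_gt)
  show "(\<lambda>s. \<Sum>n<N. A n * (of_nat n powr (- s) - of_nat (Suc n) powr (- s))) holomorphic_on ?S" for N
    by (intro holomorphic_intros)
  fix x assume x: "x \<in> ?S"
  define d where "d = Re x / 2"
  have d: "d > 0" using x by (simp add: d_def)
  have Re_ge: "Re s \<ge> d" if "s \<in> cball x d" for s
    using that abs_Re_le_cmod[of "x - s"] by (auto simp: d_def dist_norm)
  have norm_s: "norm s \<le> norm x + d" if "s \<in> cball x d" for s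
    using that norm_triangle_sub[of s x] by (auto simp: dist_norm norm_minus_commute)
  have "uniform_limit (cball x d) (\<lambda>N s. \<Sum>n<N. A n * (of_nat n powr (- s) - of_nat (Suc n) powr (- s))) L sequentially"
    unfolding L_def[abs_def]
  proof (rule Weierstrass_m_test)
    show "norm (A n * (of_nat n powr (- s) - of_nat (Suc n) powr (- s))) \<le> real q * ((norm x + d) * real n powr (- d - 1))"
      if s: "s \<in> cball x d" for n s
    proof (cases "n = 0")
      case False
      have "norm (A n * (of_nat n powr (- s) - of_nat (Suc n) powr (- s))) \<le> real q * (norm s * real n powr (- Re s - 1))"
        using Re_ge[OF s] d by (intro norm_L_term_le) auto
      also have "\<dots> \<le> real q * ((norm x + d) * real n powr (- d - 1))"
        using Re_ge[OF s] norm_s[OF s] d False by (intro mult_left_mono mult_mono powr_mono) auto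
      finally show ?thesis .
    qed simp
    show "summable (\<lambda>n. real q * ((norm x + d) * real n powr (- d - 1)))"
      using d by (intro summable_mult) (simp add: summable_real_powr_iff)
  qed
  moreover have "cball x d \<subseteq> ?S" using Re_ge d by fastforce
  ultimately show "\<exists>d>0. cball x d \<subseteq> ?S \<and> uniform_limit (cball x d)
      (\<lambda>N s. \<Sum>n<N. A n * (of_nat n powr (- s) - of_nat (Suc n) powr (- s))) L sequentially"
    using d by blast
qed

lemma partial_summation:
  "(\<Sum>n<Suc N. ch n * of_nat n powr (- s)) =
     (\<Sum>n<Suc N. A n * (of_nat n powr (- s) - of_nat (Suc n) powr (- s))) + A N * of_nat (Suc N) powr (- s)"
  by (induction N) (simp_all add: A_Suc chi_0 algebra_simps)

lemma dirichlet_partial_sums_tendsto: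
  assumes "Re s > 0"
  shows "(\<lambda>N. \<Sum>n<N. ch n * of_nat n powr (- s)) \<longlonglongrightarrow> L s"
proof -
  have "(\<lambda>N. A N * of_nat (Suc N) powr (- s)) \<longlonglongrightarrow> 0"
  proof (rule Lim_null_comparison)
    show "\<forall>\<^sub>F N in sequentially. norm (A N * of_nat (Suc N) powr (- s)) \<le> real q * real (Suc N) powr (- Re s)"
      unfolding norm_mult norm_of_nat_powr_minus by (intro always_eventually allI mult_right_mono norm_A_le) auto
    show "(\<lambda>N. real q * real (Suc N) powr (- Re s)) \<longlonglongrightarrow> 0"
      using powr_tendsto_0_seq[OF assms] by (rule tendsto_mult_right_zero)
  qed
  moreover have "(\<lambda>N. \<Sum>n<Suc N. A n * (of_nat n powr (- s) - of_nat (Suc n) powr (- s))) \<longlonglongrightarrow> L s"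
    unfolding L_def using summable_LIMSEQ[OF summable_L[OF assms]] by (rule LIMSEQ_Suc)
  ultimately have "(\<lambda>N. \<Sum>n<Suc N. ch n * of_nat n powr (- s)) \<longlonglongrightarrow> L s + 0"
    unfolding partial_summation by (intro tendsto_add)
  then have "(\<lambda>N. \<Sum>n<Suc N. ch n * of_nat n powr (- s)) \<longlonglongrightarrow> L s" by simp
  then show ?thesis by (rule LIMSEQ_imp_Suc)
qed

lemma subpoly_chi: "subpoly ch" by (rule subpoly_bounded) (rule norm_le_1)

lemma ds_eq_L:
  assumes "Re s > 1"
  shows "ds ch s = L s"
proof -
  have "(\<lambda>N. \<Sum>n<N. ch n * of_nat n powr (- s)) \<longlonglongrightarrow> ds ch s"
    unfolding ds_def using summable_LIMSEQ[OF summable_ds[OF subpoly_chi assms]] .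
  with dirichlet_partial_sums_tendsto[of s] assms show ?thesis by (auto intro: LIMSEQ_unique)
qed

lemma ln_q_ge_1: "ln (real q) \<ge> 1"
proof -
  have "exp 1 \<le> (3::real)" using exp_le by simp
  also have "\<dots> \<le> real q" using q3 by simp
  finally show ?thesis using q3 by (simp add: ln_ge_iff)
qed

lemma sum_inverse_le_ln: "(\<Sum>n=1..N. 1 / real n) \<le> 1 + ln (real N)" if "N > 0"
  using that
proof (induction N rule: nat_induct_non_zero)
  case (Suc n)
  have "ln (1 - 1 / real (Suc n)) \<le> - (1 / real (Suc n))"
    using ln_le_minus_one[of "1 - 1 / real (Suc n)"] Suc.hyps by simp
  moreover have "1 - 1 / real (Suc n) = real n / real (Suc n)" by (simp add: field_simps)
  ultimately have "1 / real (Suc n) \<le> ln (real (Suc n)) - ln (real n)"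
    using Suc.hyps by (simp add: ln_div)
  then show ?case using Suc.IH by simp
qed simp

text \<open>Cutting at q leaves no boundary term because the partial sum A vanishes at q -
  1.\<close>

lemma L_tail:
  assumes "Re s > 0"
  shows "L s = (\<Sum>n<q. ch n * of_nat n powr (- s)) +
     (\<Sum>n. A (n + q) * (of_nat (n + q) powr (- s) - of_nat (Suc (n + q)) powr (- s)))"
proof -
  have "L s = (\<Sum>n. A (n + q) * (of_nat (n + q) powr (- s) - of_nat (Suc (n + q)) powr (- s))) +
      (\<Sum>n<q. A n * (of_nat n powr (- s) - of_nat (Suc n) powr (- s)))"
    unfolding L_def by (rule suminf_split_initial_segment[OF summable_L[OF assms]])
  moreover have "(\<Sum>n<q. A n * (of_nat n powr (- s) - of_nat (Suc n) powr (- s))) = (\<Sum>n<q. ch n * of_nat n powr (- s))"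
    using partial_summation[of s "q - 1"] A_q_minus_1 q3 by simp
  ultimately show ?thesis by simp
qed

text \<open>In this disc n^(-Re s) exceeds 1/n by at most the factor e^(1/2) for n <= q, so the head
  is a harmonic sum. The tail telescopes to a multiple of q (q - 1)^(-Re s) and is at most 9. The
  constant is 2 + 2 + 9, with ln q >= 1.\<close>

lemma norm_L_le:
  assumes s: "norm (s - 1) \<le> 1 / (2 * ln (real q))"
  shows "norm (L s) \<le> 13 * ln (real q)"
proof -
  define l where "l = ln (real q)"
  have l: "l \<ge> 1" using ln_q_ge_1 by (simp add: l_def)
  have half: "1 / (2 * l) \<le> 1 / 2" using l by (simp add: field_simps)
  define \<sigma> where "\<sigma> = Re s"
  have \<sigma>: "\<sigma> \<ge> 1 - 1 / (2 * l)" using s abs_Re_le_cmod[of "s - 1"] by (simp add: \<sigma>_def l_def)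
  then have \<sigma>2: "\<sigma> \<ge> 1 / 2" using half by linarith
  have norm_s: "norm s \<le> 3 / 2" using s norm_triangle_ineq[of "s - 1" 1] half by (simp add: l_def)
  have exp_half: "exp (1 / 2 :: real) \<le> 2"
  proof -
    have "exp (1 / 2 :: real) ^ 2 = exp 1" by (simp add: power2_eq_square exp_add[symmetric])
    also have "\<dots> \<le> 2 ^ 2" using exp_le by simp
    finally show ?thesis by (rule power2_le_imp_le) simp
  qed
  have powr_le: "real n powr (- \<sigma>) \<le> 2 / real n" if n: "n > 0" "n \<le> q" for n
  proof -
    have "real n powr (- \<sigma>) \<le> real n powr (- 1 + 1 / (2 * l))" using n \<sigma> by (intro powr_mono) auto
    also have "\<dots> = real n powr (- 1) * real n powr (1 / (2 * l))" by (rule powr_add)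
    also have "\<dots> = real n powr (1 / (2 * l)) / real n" using n by (simp add: powr_minus field_simps)
    also have "real n powr (1 / (2 * l)) \<le> real q powr (1 / (2 * l))" using n l by (intro powr_mono2) auto
    also have "real q powr (1 / (2 * l)) = exp (1 / 2)" using q3 l by (simp add: powr_def l_def)
    also have "\<dots> \<le> 2" by (rule exp_half)
    finally show ?thesis using n by (simp add: divide_right_mono)
  qed
  have "norm (\<Sum>n<q. ch n * of_nat n powr (- s)) \<le> (\<Sum>n<q. real n powr (- \<sigma>))"
    by (rule sum_norm_le) (use norm_le_1 in \<open>auto simp: norm_mult norm_of_nat_powr_minus \<sigma>_def intro!: mult_left_le_one_le\<close>)
  also have "\<dots> = (\<Sum>n=1..q-1. real n powr (- \<sigma>))"
    using q3 by (intro sum.mono_neutral_right) (auto simp: not_le)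
  also have "\<dots> \<le> (\<Sum>n=1..q-1. 2 * (1 / real n))" using powr_le by (intro sum_mono) auto
  also have "\<dots> = 2 * (\<Sum>n=1..q-1. 1 / real n)" by (simp add: sum_distrib_left)
  also have "\<dots> \<le> 2 * (1 + ln (real (q - 1)))" using q3 by (intro mult_left_mono sum_inverse_le_ln) auto
  also have "ln (real (q - 1)) \<le> l" unfolding l_def using q3 by (intro ln_mono) auto
  finally have head: "norm (\<Sum>n<q. ch n * of_nat n powr (- s)) \<le> 2 * (1 + l)" by simp
  have Re_s: "Re s > 0" using \<sigma>2 by (simp add: \<sigma>_def)
  have tel: "(\<lambda>n. real (n + q - 1) powr (- \<sigma>) - real (n + q) powr (- \<sigma>)) sums (real (q - 1) powr (- \<sigma>))"
  proof -
    have "(\<lambda>n. real (Suc n) powr (- \<sigma>)) \<longlonglongrightarrow> 0" using \<sigma>2 by (intro powr_tendsto_0_seq) auto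
    from LIMSEQ_ignore_initial_segment[OF this, of "q - 2"]
    have "(\<lambda>n. real (n + q - 1) powr (- \<sigma>)) \<longlonglongrightarrow> 0" using q3 by (simp add: Suc_diff_le numeral_2_eq_2 of_nat_diff algebra_simps)
    from telescope_sums'[OF this] show ?thesis by simp
  qed
  have term_le: "norm (A (n + q) * (of_nat (n + q) powr (- s) - of_nat (Suc (n + q)) powr (- s))) \<le>
     (3 * real q) * (real (n + q - 1) powr (- \<sigma>) - real (n + q) powr (- \<sigma>))" for n
  proof -
    have "norm (A (n + q) * (of_nat (n + q) powr (- s) - of_nat (Suc (n + q)) powr (- s))) \<le> real q * (norm s * real (n + q) powr (- \<sigma> - 1))"
      using norm_L_term_le[OF Re_s, of "n + q"] by (simp add: \<sigma>_def)
    \<comment> \<open>Here norm s <= 3/2 and \<sigma> >= 1/2.\<close>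
    also have "\<dots> \<le> real q * (3 * (\<sigma> * real (n + q) powr (- \<sigma> - 1)))"
      using norm_s \<sigma>2 by (intro mult_left_mono) (auto simp flip: mult.assoc intro!: mult_right_mono)
    also have "\<dots> \<le> real q * (3 * (real (n + q - 1) powr (- \<sigma>) - real (n + q) powr (- \<sigma>)))"
      using powr_diff_bound(3)[of \<sigma> "n + q - 1"] \<sigma>2 q3 by (intro mult_left_mono) auto
    finally show ?thesis by (simp only: mult_ac)
  qed
  have "norm (\<Sum>n. A (n + q) * (of_nat (n + q) powr (- s) - of_nat (Suc (n + q)) powr (- s))) \<le>
      (\<Sum>n. (3 * real q) * (real (n + q - 1) powr (- \<sigma>) - real (n + q) powr (- \<sigma>)))"
    using sums_summable[OF tel] by (intro norm_suminf_le term_le summable_mult)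
  also have "\<dots> = 3 * real q * real (q - 1) powr (- \<sigma>)"
    using sums_mult[OF tel, of "3 * real q"] by (simp add: sums_iff)
  also have "\<dots> \<le> 3 * real q * (2 / real (q - 1))" using powr_le[of "q - 1"] q3 by (intro mult_left_mono) auto
  also have "\<dots> \<le> 9" using q3 by (simp add: field_simps of_nat_diff)
  finally have tail: "norm (\<Sum>n. A (n + q) * (of_nat (n + q) powr (- s) - of_nat (Suc (n + q)) powr (- s))) \<le> 9" .
  have "norm (L s) \<le> 2 * (1 + l) + 9"
    unfolding L_tail[OF Re_s] using head tail norm_triangle_mono by blast
  then show ?thesis using l by (simp add: l_def)
qed

lemma L_has_deriv: "Re s > 0 \<Longrightarrow> (L has_field_derivative deriv L s) (at s)"
  using L_holomorphic open_halfspace_Re_gt[of 0] by (intro holomorphic_derivI) auto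

text \<open>Cauchy's inequality on circles of radius 1 / (4 ln q), which stay in the disc of
  \<open>norm_L_le\<close>: 13 ln q times 4 ln q.\<close>

lemma norm_deriv_L_le:
  assumes s: "norm (s - 1) \<le> 1 / (4 * ln (real q))"
  shows "norm (deriv L s) \<le> 52 * ln (real q) ^ 2"
proof -
  define l where "l = ln (real q)"
  have l: "l \<ge> 1" using ln_q_ge_1 by (simp add: l_def)
  define r where "r = 1 / (4 * l)"
  have r: "r > 0" using l by (simp add: r_def)
  have near: "norm (z - 1) \<le> 1 / (2 * l)" if "norm (s - z) \<le> r" for z
    using that s norm_triangle_ineq[of "z - s" "s - 1"] by (simp add: r_def l_def norm_minus_commute)
  have half: "1 / (2 * l) < 1" using l by (simp add: field_simps)
  have sub: "cball s r \<subseteq> {s. Re s > 0}"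
  proof
    fix z assume "z \<in> cball s r"
    then have "norm (z - 1) \<le> 1 / (2 * l)" by (intro near) (simp add: dist_norm)
    then show "z \<in> {s. Re s > 0}" using half abs_Re_le_cmod[of "z - 1"] by auto
  qed
  have "norm ((deriv ^^ 1) L s) \<le> fact 1 * (13 * l) / r ^ 1"
  proof (rule Cauchy_inequality)
    show "L holomorphic_on ball s r" using L_holomorphic by (rule holomorphic_on_subset) (use sub ball_subset_cball in blast)
    show "continuous_on (cball s r) L"
      using holomorphic_on_imp_continuous_on[OF L_holomorphic] by (rule continuous_on_subset) (use sub in auto)
    show "norm (L x) \<le> 13 * l" if "norm (s - x) = r" for x
      unfolding l_def by (rule norm_L_le) (use near[of x] that in \<open>simp add: l_def\<close>)
  qed (use r in auto)
  then show ?thesis by (simp add: r_def l_def power2_eq_square)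
qed

end

section \<open>Characters and the 3-4-1 inequality\<close>

text \<open>The derivative of |f|^2 along the axis is -2 Re E |f|^2 <= 0, so |f| decreases towards
  its limit 1. This replaces taking logarithms of an Euler product.\<close>

lemma norm_ge_1_of_log_deriv:
  fixes f E :: "complex \<Rightarrow> complex"
  assumes deriv: "\<And>x. x > 1 \<Longrightarrow> (f has_field_derivative - (E (of_real x) * f (of_real x))) (at (of_real x))"
    and E: "\<And>x. x > 1 \<Longrightarrow> Re (E (of_real x)) \<ge> 0"
    and lim: "((\<lambda>x. f (of_real x)) \<longlongrightarrow> 1) at_top"
    and x: "x > (1::real)"
  shows "norm (f (of_real x)) \<ge> 1"
proof -
  define N where "N = (\<lambda>x::real. (Re (f (of_real x)))\<^sup>2 + (Im (f (of_real x)))\<^sup>2)"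
  have N_norm: "N x = (norm (f (of_real x)))\<^sup>2" for x by (simp add: N_def cmod_power2)
  have "\<exists>d. (N has_real_derivative d) (at y) \<and> d \<le> 0" if y: "y > 1" for y
  proof -
    let ?d = "- (E (of_real y) * f (of_real y))"
    have v: "((\<lambda>x. f (of_real x)) has_vector_derivative ?d) (at y)"
      using has_vector_derivative_real_field[OF deriv[OF y]] by simp
    have re: "((\<lambda>x. Re (f (of_real x))) has_real_derivative Re ?d) (at y)"
      using bounded_linear.has_vector_derivative[OF bounded_linear_Re v]
      by (simp only: has_real_derivative_iff_has_vector_derivative)
    have im: "((\<lambda>x. Im (f (of_real x))) has_real_derivative Im ?d) (at y)"
      using bounded_linear.has_vector_derivative[OF bounded_linear_Im v]
      by (simp only: has_real_derivative_iff_has_vector_derivative)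
    have "(N has_real_derivative (2 * Re ?d * Re (f (of_real y)) + 2 * Im ?d * Im (f (of_real y)))) (at y)"
      using DERIV_add[OF DERIV_power[OF re, of 2] DERIV_power[OF im, of 2]]
      unfolding N_def by (simp add: algebra_simps)
    also have "2 * Re ?d * Re (f (of_real y)) + 2 * Im ?d * Im (f (of_real y)) = - (2 * Re (E (of_real y)) * N y)"
      by (simp add: N_def power2_eq_square algebra_simps)
    finally have "(N has_real_derivative - (2 * Re (E (of_real y)) * N y)) (at y)" .
    moreover have "- (2 * Re (E (of_real y)) * N y) \<le> 0" using E[OF y] by (simp add: N_def)
    ultimately show ?thesis by blast
  qed
  then have dec: "N y \<le> N x" if "y \<ge> x" for y
    using that x by (intro DERIV_nonpos_imp_nonincreasing[OF that]) auto
  have "((\<lambda>x. (norm (f (of_real x)))\<^sup>2) \<longlongrightarrow> (norm (1::complex))\<^sup>2) at_top"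
    by (intro tendsto_intros lim)
  moreover have "N = (\<lambda>x. (norm (f (of_real x)))\<^sup>2)" by (rule ext) (rule N_norm)
  ultimately have "(N \<longlongrightarrow> 1) at_top" by (simp only: norm_one power_one)
  moreover have "\<forall>\<^sub>F y in at_top. N y \<le> N x"
    using eventually_ge_at_top[of x] by (rule eventually_mono) (rule dec)
  ultimately have "1 \<le> N x" by (rule tendsto_upperbound) simp
  then show ?thesis unfolding N_norm using power2_le_imp_le[of 1 "norm (f (of_real x))"] by simp
qed

text \<open>A nonprincipal Dirichlet character modulo the prime q, in axiomatic form.\<close>

locale prime_character =
  fixes ch :: "nat \<Rightarrow> complex" and q :: nat
  assumes prime: "prime q" and q3: "q \<ge> 3"
    and mult: "ch (m * n) = ch m * ch n"
    and zero_iff: "ch n = 0 \<longleftrightarrow> q dvd n"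
    and norm_eq_1: "\<not> q dvd n \<Longrightarrow> norm (ch n) = 1"
    and mod_eq: "ch (n mod q) = ch n"
    and nontrivial: "\<exists>g. \<not> q dvd g \<and> ch g \<noteq> 1"
begin

lemma ch_1: "ch 1 = 1"
proof -
  have "ch 1 * ch 1 = ch 1 * 1" using mult[of 1 1] by simp
  moreover have "ch 1 \<noteq> 0" using zero_iff[of 1] q3 by simp
  ultimately show ?thesis by simp
qed

lemma norm_le: "norm (ch n) \<le> 1"
  using norm_eq_1[of n] zero_iff[of n] by (cases "q dvd n") auto

lemma sum_mult_mod:
  fixes F :: "nat \<Rightarrow> 'a :: comm_monoid_add"
  assumes g: "\<not> q dvd g"
  shows "(\<Sum>n<q. F (g * n mod q)) = (\<Sum>n<q. F n)"
proof -
  have inj: "inj_on (\<lambda>n. g * n mod q) {..<q}"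
  proof (rule inj_onI)
    fix x y assume xy: "x \<in> {..<q}" "y \<in> {..<q}" "g * x mod q = g * y mod q"
    then have "[g * x = g * y] (mod q)" by (simp add: cong_def)
    moreover have "coprime g q" using prime_imp_coprime[OF prime g] by (simp add: coprime_commute)
    ultimately have "[x = y] (mod q)" by (simp add: cong_mult_lcancel_nat)
    then show "x = y" using xy by (simp add: cong_def)
  qed
  moreover have "(\<lambda>n. g * n mod q) ` {..<q} \<subseteq> {..<q}" using q3 by auto
  ultimately have "bij_betw (\<lambda>n. g * n mod q) {..<q} {..<q}"
    by (simp add: bij_betw_def endo_inj_surj)
  then show ?thesis by (rule sum.reindex_bij_betw)
qed

lemma sum_period_0: "(\<Sum>n<q. ch n) = 0"
proof -
  obtain g where g: "\<not> q dvd g" "ch g \<noteq> 1" using nontrivial by blast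
  have "ch g * (\<Sum>n<q. ch n) = (\<Sum>n<q. ch (g * n mod q))"
    by (simp add: sum_distrib_left mult mod_eq)
  also have "\<dots> = (\<Sum>n<q. ch n)" by (rule sum_mult_mod[OF g(1)])
  finally have "(ch g - 1) * (\<Sum>n<q. ch n) = 0" by (simp add: algebra_simps)
  then show ?thesis using g(2) by simp
qed

sublocale mean_zero_periodic ch q
proof
  show "ch (n + q) = ch n" for n using mod_eq[of "n + q"] mod_eq[of n] by simp
  show "ch 0 = 0" using zero_iff[of 0] by simp
qed (use q3 norm_le sum_period_0 in auto)

lemma subpoly_mangoldt_ch: "subpoly (\<lambda>n. of_real (mangoldt n) * ch n)"
  by (intro subpoly_mult subpoly_mangoldt subpoly_chi)

lemma ds_ch_deriv:
  assumes "Re s > 1"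
  shows "(ds ch has_field_derivative - (ds (\<lambda>n. of_real (mangoldt n) * ch n) s * ds ch s)) (at s)"
  using subpoly_chi subpoly_mangoldt_ch assms
  by (rule ds_log_deriv) (rule dconv_mangoldt[OF _ mult])

lemma deriv_L_eq:
  assumes "Re s > 1"
  shows "deriv L s = - (ds (\<lambda>n. of_real (mangoldt n) * ch n) s * L s)"
proof -
  have "(L has_field_derivative - (ds (\<lambda>n. of_real (mangoldt n) * ch n) s * ds ch s)) (at s)"
  proof (rule has_field_derivative_transform_within_open[OF ds_ch_deriv[OF assms]])
    show "open {s. Re s > 1}" by (rule open_halfspace_Re_gt)
  qed (use assms ds_eq_L in auto)
  then show ?thesis using ds_eq_L[OF assms] by (simp add: DERIV_imp_deriv)
qed

end

lemma ds_one_deriv: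
  assumes "Re s > 1"
  shows "(ds (\<lambda>_. 1) has_field_derivative - (ds (\<lambda>n. of_real (mangoldt n)) s * ds (\<lambda>_. 1) s)) (at s)"
  by (rule ds_log_deriv)
     (use assms subpoly_mangoldt subpoly_bounded[of "\<lambda>_. 1" 1] dconv_mangoldt[of _ "\<lambda>_. 1", simplified] in auto)

text \<open>A nonprincipal square keeps the factor L(s, ch^2) of the 3-4-1 inequality bounded near s
  = 1; for the quadratic character that factor has a pole.\<close>

locale complex_prime_character = prime_character +
  assumes square_nontrivial: "\<exists>g. \<not> q dvd g \<and> ch g ^ 2 \<noteq> 1"
begin

sublocale sq: prime_character "\<lambda>n. ch n ^ 2" q
proof
  show "(ch (m * n))\<^sup>2 = (ch m)\<^sup>2 * (ch n)\<^sup>2" for m n by (simp add: mult power_mult_distrib)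
  show "norm ((ch n)\<^sup>2) = 1" if "\<not> q dvd n" for n using norm_eq_1[OF that] by (simp add: norm_power)
qed (use prime q3 zero_iff mod_eq square_nontrivial in auto)

text \<open>Minus the logarithmic derivative of zeta^3 L(ch)^4 L(ch^2) has coefficients with real
  part 2 Lambda(n) (1 + Re ch(n))^2, or 3 Lambda(n) at multiples of q, so
  \<open>norm_ge_1_of_log_deriv\<close> applies.\<close>

lemma three_four_one:
  assumes x: "x > (1::real)"
  shows "1 \<le> rzeta x ^ 3 * norm (L (of_real x)) ^ 4 * norm (sq.L (of_real x))"
proof -
  let ?D0 = "ds (\<lambda>n. of_real (mangoldt n))" and ?D1 = "ds (\<lambda>n. of_real (mangoldt n) * ch n)"
    and ?D2 = "ds (\<lambda>n. of_real (mangoldt n) * ch n ^ 2)"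
  define f where "f = (\<lambda>s. ds (\<lambda>_. 1) s ^ 3 * ds ch s ^ 4 * ds (\<lambda>n. ch n ^ 2) s)"
  define E where "E = (\<lambda>s. 3 * ?D0 s + 4 * ?D1 s + ?D2 s)"
  have "1 \<le> norm (f (of_real x))"
  proof (rule norm_ge_1_of_log_deriv[where E = E])
    fix x :: real assume x: "x > 1"
    have Re: "Re (of_real x) > 1" using x by simp
    show "(f has_field_derivative - (E (of_real x) * f (of_real x))) (at (of_real x))"
      unfolding f_def
      by (rule derivative_eq_intros ds_one_deriv[OF Re] ds_ch_deriv[OF Re] sq.ds_ch_deriv[OF Re] refl)+
         (simp add: E_def algebra_simps power2_eq_square power3_eq_cube power4_eq_xxxx)
    define h where "h = (\<lambda>n. 3 * of_real (mangoldt n) + (4 * (of_real (mangoldt n) * ch n) + of_real (mangoldt n) * ch n ^ 2))"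
    have sm: "subpoly (\<lambda>n. 3 * (of_real (mangoldt n) :: complex))"
      using subpoly_mult[OF subpoly_bounded[of "\<lambda>_. 3" 3] subpoly_mangoldt] by simp
    have sm1: "subpoly (\<lambda>n. 4 * (of_real (mangoldt n) * ch n))"
      using subpoly_mult[OF subpoly_bounded[of "\<lambda>_. 4" 4] subpoly_mangoldt_ch] by simp
    have subh: "subpoly h" unfolding h_def by (intro subpoly_add sm sm1 sq.subpoly_mangoldt_ch)
    have "E (of_real x) = ds h (of_real x)"
      unfolding E_def h_def
      using Re sm sm1 subpoly_add[OF sm1 sq.subpoly_mangoldt_ch]
      by (simp add: ds_add ds_cmult sq.subpoly_mangoldt_ch subpoly_mangoldt_ch subpoly_mangoldt del: of_real_mangoldt)
    also have "Re (ds h (of_real x)) = (\<Sum>n. Re (h n * of_nat n powr (- of_real x)))"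
      unfolding ds_def using summable_ds[OF subh Re] by (rule Re_suminf)
    also have "\<dots> \<ge> 0"
    proof (rule suminf_nonneg)
      show "summable (\<lambda>n. Re (h n * of_nat n powr (- of_real x)))"
        using summable_ds[OF subh Re] by (rule summable_Re)
      fix n
      have "Re (h n) = mangoldt n * (3 + 4 * Re (ch n) + Re (ch n ^ 2))"
        by (simp add: h_def algebra_simps del: of_real_mangoldt)
      moreover have "3 + 4 * Re (ch n) + Re (ch n ^ 2) \<ge> 0"
      proof (cases "q dvd n")
        case False
        have "(Re (ch n))\<^sup>2 + (Im (ch n))\<^sup>2 = 1" using norm_eq_1[OF False] cmod_power2[of "ch n"] by simp
        then have "3 + 4 * Re (ch n) + Re (ch n ^ 2) = 2 * (1 + Re (ch n))\<^sup>2"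
          by (simp add: power2_eq_square algebra_simps)
        then show ?thesis by simp
      qed (use zero_iff[of n] in simp)
      moreover have "of_nat n powr (- of_real x) = complex_of_real (real n powr (- x))"
        by (metis of_nat_0_le_iff of_real_minus of_real_of_nat_eq powr_of_real)
      ultimately show "Re (h n * of_nat n powr (- of_real x)) \<ge> 0" by (simp add: mangoldt_nonneg)
    qed
    finally show "Re (E (of_real x)) \<ge> 0" .
  next
    have "((\<lambda>x. f (of_real x)) \<longlongrightarrow> 1 ^ 3 * ch 1 ^ 4 * ch 1 ^ 2) at_top"
      unfolding f_def
      by (intro tendsto_intros ds_tendsto_at_top[of "\<lambda>_. 1"] ds_tendsto_at_top[OF subpoly_chi]
          ds_tendsto_at_top[OF sq.subpoly_chi] subpoly_bounded[of "\<lambda>_. 1" 1]) auto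
    then show "((\<lambda>x. f (of_real x)) \<longlongrightarrow> 1) at_top" unfolding ch_1 by simp
  qed (rule x)
  moreover have "rzeta x > 0" using rzeta_bounds(2)[OF x] x by (smt (verit) divide_pos_pos)
  ultimately show ?thesis
    using x by (simp add: f_def ds_one_eq ds_eq_L sq.ds_eq_L norm_mult norm_power)
qed

text \<open>If the norm of L(1) were below 52 (ln q)^2 t with t = a0 / (ln q)^9, the inequality of the previous lemma
  would fail at 1 + t.\<close>
definition a0 :: real where "a0 = 1 / 104 ^ 5"
definition rho :: real where "rho = a0 / 2 / ln (real q) ^ 9"

lemma L_diff_le:
  assumes "norm (s - 1) \<le> 1 / (4 * ln (real q))"
  shows "norm (L s - L 1) \<le> 52 * ln (real q) ^ 2 * norm (s - 1)"
proof (rule field_differentiable_bound[where S = "cball 1 (1 / (4 * ln (real q)))" and f' = "deriv L"])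
  have "1 / (4 * ln (real q)) < 1" using ln_q_ge_1 by (simp add: field_simps)
  then have "Re z > 0" if "z \<in> cball 1 (1 / (4 * ln (real q)))" for z
    using that abs_Re_le_cmod[of "z - 1"] by (auto simp: dist_norm norm_minus_commute)
  then show "(L has_field_derivative deriv L z) (at z within cball 1 (1 / (4 * ln (real q))))"
    if "z \<in> cball 1 (1 / (4 * ln (real q)))" for z
    using L_has_deriv that has_field_derivative_at_within by blast
  show "norm (deriv L z) \<le> 52 * ln (real q) ^ 2" if "z \<in> cball 1 (1 / (4 * ln (real q)))" for z
    by (rule norm_deriv_L_le) (use that in \<open>simp add: dist_norm norm_minus_commute\<close>)
qed (use assms ln_q_ge_1 in \<open>auto simp: dist_norm norm_minus_commute\<close>)

text \<open>At 1 + t, zeta is at most 2/t and L(ch^2) at most 13 ln q, so |L(1 + t)|^4 >= t^3 / (104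
  ln q). The power (ln q)^(-9) in t makes the resulting lower bound and the loss 52 (ln q)^2 t in
  passing to 1 both of order (ln q)^(-7). The value a0 = 104^(-5) solves (104 a0)^4 = a0^3 / 104, so
  the bound at 1 + t is twice the loss.\<close>

lemma norm_L_1_ge: "norm (L 1) \<ge> 52 * a0 / ln (real q) ^ 7"
proof -
  define l where "l = ln (real q)"
  have l: "l \<ge> 1" using ln_q_ge_1 by (simp add: l_def)
  define t where "t = a0 / l ^ 9"
  have a0: "a0 > 0" "a0 \<le> 1 / 4" by (auto simp: a0_def)
  have t0: "t > 0" using a0 l by (simp add: t_def)
  have t_le: "t \<le> 1 / (4 * l)"
  proof -
    have "l ^ 1 \<le> l ^ 9" using l by (intro power_increasing) auto
    then have "t \<le> (1 / 4) / l" unfolding t_def using a0 l by (intro frac_le) auto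
    then show ?thesis by simp
  qed
  then have t1: "t \<le> 1" using l by (smt (verit) divide_le_eq_1)
  let ?s = "complex_of_real (1 + t)"
  have near: "norm (?s - 1) = t" using t0 by simp
  have L2: "norm (sq.L ?s) \<le> 13 * l"
    unfolding l_def by (rule sq.norm_L_le) (use near t_le l in \<open>simp add: l_def field_simps\<close>)
  have z: "rzeta (1 + t) \<le> 2 / t" using rzeta_bounds(1)[of "1 + t"] t0 t1 by (simp add: field_simps)
  have z0: "rzeta (1 + t) \<ge> 0" using rzeta_bounds(2)[of "1 + t"] t0 by (smt (verit) divide_pos_pos)
  have "1 \<le> rzeta (1 + t) ^ 3 * norm (L ?s) ^ 4 * norm (sq.L ?s)" using three_four_one[of "1 + t"] t0 by simp
  also have "\<dots> \<le> (2 / t) ^ 3 * norm (L ?s) ^ 4 * (13 * l)"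
    using z z0 L2 t0 by (intro mult_mono power_mono) auto
  also have "\<dots> = 104 * l * norm (L ?s) ^ 4 / t ^ 3" by (simp add: power_divide)
  finally have "t ^ 3 \<le> 104 * l * norm (L ?s) ^ 4" using t0 by (simp add: field_simps)
  then have "a0 ^ 3 / l ^ 27 \<le> 104 * l * norm (L ?s) ^ 4" by (simp add: t_def power_divide power_mult[symmetric])
  then have "a0 ^ 3 \<le> 104 * norm (L ?s) ^ 4 * (l * l ^ 27)" using l by (simp add: field_simps)
  also have "l * l ^ 27 = l ^ 28" by (simp flip: power_Suc)
  finally have "a0 ^ 3 / (104 * l ^ 28) \<le> norm (L ?s) ^ 4" using l by (simp add: field_simps)
  moreover have "(104 * a0 / l ^ 7) ^ 4 = a0 ^ 3 / (104 * l ^ 28)"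
    by (simp add: a0_def power_divide power_mult[symmetric])
  ultimately have "(104 * a0 / l ^ 7) ^ 4 \<le> norm (L ?s) ^ 4" by simp
  then have low: "104 * a0 / l ^ 7 \<le> norm (L ?s)" using l a0 by (subst (asm) power_mono_iff) auto
  have "norm (L ?s - L 1) \<le> 52 * l ^ 2 * t"
    using L_diff_le[of ?s] near t_le by (simp add: l_def)
  also have "\<dots> = 52 * a0 / l ^ 7" using l by (simp add: t_def field_simps power_add[symmetric])
  finally have "norm (L ?s) - norm (L 1) \<le> 52 * a0 / l ^ 7"
    using norm_triangle_ineq2[of "L ?s" "L 1"] by linarith
  with low show ?thesis by (simp add: l_def)
qed

lemma rho_pos: "rho > 0" and rho_le: "rho \<le> 1 / (4 * ln (real q))"
proof -
  define l where "l = ln (real q)"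
  have l: "l \<ge> 1" using ln_q_ge_1 by (simp add: l_def)
  have rho: "rho = a0 / 2 / l ^ 9" by (simp add: rho_def l_def)
  show "rho > 0" using l by (simp add: rho a0_def)
  have "l ^ 1 \<le> l ^ 9" using l by (intro power_increasing) auto
  then have "rho \<le> (1 / 4) / l" unfolding rho using l by (rule_tac frac_le) (auto simp: a0_def)
  then show "rho \<le> 1 / (4 * ln (real q))" by (simp add: l_def)
qed

text \<open>\<open>rho\<close> is half of the t in \<open>norm_L_1_ge\<close>, so at most half of
  the lower bound at 1 is lost.\<close>

lemma norm_L_ge_near_1:
  assumes "norm (s - 1) \<le> rho"
  shows "norm (L s) \<ge> 26 * a0 / ln (real q) ^ 7"
proof -
  have l: "ln (real q) \<ge> 1" by (rule ln_q_ge_1)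
  have "norm (L s - L 1) \<le> 52 * ln (real q) ^ 2 * norm (s - 1)"
    using assms rho_le by (intro L_diff_le) auto
  also have "\<dots> \<le> 52 * ln (real q) ^ 2 * rho" using assms by (intro mult_left_mono) auto
  also have "\<dots> = 26 * a0 / ln (real q) ^ 7" using l by (simp add: rho_def field_simps power_add[symmetric])
  finally have "norm (L 1) - norm (L s) \<le> 26 * a0 / ln (real q) ^ 7"
    using norm_triangle_ineq2[of "L 1" "L s"] norm_minus_commute[of "L 1" "L s"] by linarith
  with norm_L_1_ge show ?thesis by simp
qed

lemma L_nonzero_near_1: "norm (s - 1) \<le> rho \<Longrightarrow> L s \<noteq> 0"
  using norm_L_ge_near_1[of s] ln_q_ge_1 by (auto simp: a0_def field_simps)

text \<open>The choice of \<open>rho\<close> makes the upper bound for the derivative divided by the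
  lower bound for L equal to 1 / \<open>rho\<close>.\<close>

lemma norm_log_deriv_L_le:
  assumes "norm (s - 1) \<le> rho"
  shows "norm (deriv L s / L s) \<le> 1 / rho"
proof -
  have l: "ln (real q) \<ge> 1" by (rule ln_q_ge_1)
  have a0: "a0 > 0" by (simp add: a0_def)
  have "norm (deriv L s / L s) \<le> (52 * ln (real q) ^ 2) / (26 * a0 / ln (real q) ^ 7)"
    unfolding norm_divide using assms rho_le norm_L_ge_near_1[OF assms] l a0
    by (intro frac_le norm_deriv_L_le) auto
  also have "\<dots> = 1 / rho" using l a0 by (simp add: rho_def field_simps power_add[symmetric])
  finally show ?thesis .
qed

text \<open>The combination annihilates quadratic polynomials, so only the Taylor remainders of
  order 3 at 1 survive. Cauchy's inequality with radius rho/4 bounds the third derivative by 384 /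
  rho^4, and (27 + 3 * 8 + 3) / 2 = 27 such units give 10368.\<close>

lemma log_deriv_third_difference:
  assumes \<eta>: "\<eta> > 0" "6 * \<eta> \<le> rho"
  defines "f \<equiv> \<lambda>s. deriv L s / L s"
  shows "norm (f (of_real (1 + 3 * \<eta>)) - 3 * f (of_real (1 + 2 * \<eta>)) + 3 * f (of_real (1 + \<eta>)) - f 1)
      \<le> 10368 * \<eta> ^ 3 / rho ^ 4"
proof -
  have rho: "rho > 0" by (rule rho_pos)
  have "rho < 1" using rho_le ln_q_ge_1 by (smt (verit) divide_less_eq_1)
  then have Re: "Re s > 0" if "s \<in> cball 1 rho" for s
    using that abs_Re_le_cmod[of "s - 1"] by (auto simp: dist_norm norm_minus_commute)
  have nz: "L s \<noteq> 0" if "s \<in> cball 1 rho" for s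
    using that by (intro L_nonzero_near_1) (simp add: dist_norm norm_minus_commute)
  have hol: "f holomorphic_on {s. Re s > 0} - {s. L s = 0}"
    unfolding f_def using L_holomorphic open_halfspace_Re_gt[of 0]
    by (auto intro!: holomorphic_intros holomorphic_on_subset[OF holomorphic_deriv[OF L_holomorphic]] holomorphic_on_subset[OF L_holomorphic])
  have sub: "cball 1 rho \<subseteq> {s. Re s > 0} - {s. L s = 0}" using Re nz by auto
  have holb: "f holomorphic_on ball 1 rho"
    by (rule holomorphic_on_subset[OF hol]) (use sub ball_subset_cball in blast)
  have cont: "continuous_on (cball 1 rho) f"
    by (rule continuous_on_subset[OF holomorphic_on_imp_continuous_on[OF hol] sub])
  define B where "B = 384 / rho ^ 4"
  have der: "norm ((deriv ^^ 3) f z) \<le> B" if z: "z \<in> cball 1 (rho / 2)" for z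
  proof -
    have in_ball: "x \<in> cball 1 rho" if "x \<in> cball z (rho / 4)" for x
      using that z rho dist_triangle[of 1 x z] by auto
    have "norm ((deriv ^^ 3) f z) \<le> fact 3 * (1 / rho) / (rho / 4) ^ 3"
    proof (rule Cauchy_inequality)
      have "ball z (rho / 4) \<subseteq> cball 1 rho" using in_ball by auto
      then show "f holomorphic_on ball z (rho / 4)"
        by (intro holomorphic_on_subset[OF hol] order.trans[OF _ sub])
      show "continuous_on (cball z (rho / 4)) f"
        by (rule continuous_on_subset[OF cont]) (use in_ball in blast)
      show "norm (f x) \<le> 1 / rho" if "norm (z - x) = rho / 4" for x
        unfolding f_def using in_ball[of x] that
        by (intro norm_log_deriv_L_le) (simp add: dist_norm norm_minus_commute)
    qed (use rho in auto)
    also have "\<dots> = B" using rho by (simp add: B_def fact_numeral power_divide field_simps eval_nat_numeral)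
    finally show ?thesis .
  qed
  have step: "((deriv ^^ i) f has_field_derivative (deriv ^^ Suc i) f x) (at x within cball 1 (rho / 2))"
    if "x \<in> cball 1 (rho / 2)" for i x
  proof -
    have "x \<in> ball 1 rho" using that rho by auto
    then have "((deriv ^^ i) f has_field_derivative deriv ((deriv ^^ i) f) x) (at x)"
      using holomorphic_higher_deriv[OF holb open_ball] open_ball by (intro holomorphic_derivI) auto
    then show ?thesis by (simp add: has_field_derivative_at_within)
  qed
  define R where "R = (\<lambda>z. f z - (\<Sum>i\<le>2. (deriv ^^ i) f 1 * (z - 1) ^ i / fact i))"
  have R: "norm (R (of_real (1 + t))) \<le> B * t ^ 3 / 2" if "t \<ge> 0" "t \<le> rho / 2" for t
  proof -
    have "norm ((deriv ^^ 0) f (of_real (1 + t)) - (\<Sum>i\<le>2. (deriv ^^ i) f 1 * (of_real (1 + t) - 1) ^ i / fact i))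
        \<le> B * norm (complex_of_real (1 + t) - 1) ^ Suc 2 / fact 2"
      by (rule complex_Taylor[where S = "cball 1 (rho / 2)"])
         (use step der that rho in \<open>auto simp: numeral_3_eq_3 dist_norm numeral_2_eq_2\<close>)
    then show ?thesis using that by (simp add: R_def fact_numeral numeral_2_eq_2 numeral_3_eq_3)
  qed
  have "f (of_real (1 + 3 * \<eta>)) - 3 * f (of_real (1 + 2 * \<eta>)) + 3 * f (of_real (1 + \<eta>)) - f 1 =
      R (of_real (1 + 3 * \<eta>)) - 3 * R (of_real (1 + 2 * \<eta>)) + 3 * R (of_real (1 + 1 * \<eta>))"
    by (simp add: R_def numeral_2_eq_2 power2_eq_square algebra_simps)
  also have "norm \<dots> \<le> B * (3 * \<eta>) ^ 3 / 2 + 3 * (B * (2 * \<eta>) ^ 3 / 2) + 3 * (B * (1 * \<eta>) ^ 3 / 2)"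
  proof -
    have tri: "norm (x - 3 * y + 3 * z) \<le> norm x + 3 * norm y + 3 * norm z" for x y z :: complex
      using norm_triangle_ineq[of "x - 3 * y" "3 * z"] norm_triangle_ineq4[of x "3 * y"] by (simp add: norm_mult)
    have bound: "norm (R (of_real (1 + c * \<eta>))) \<le> B * (c * \<eta>) ^ 3 / 2" if "c \<ge> 0" "c \<le> 3" for c
    proof -
      have "c * \<eta> \<le> 3 * \<eta>" using that \<eta> by (intro mult_right_mono) auto
      moreover have "0 \<le> c * \<eta>" using that \<eta> by simp
      ultimately show ?thesis using \<eta> by (intro R) linarith+
    qed
    show ?thesis
      using tri[of "R (of_real (1 + 3 * \<eta>))" "R (of_real (1 + 2 * \<eta>))" "R (of_real (1 + 1 * \<eta>))"]
        bound[of 3] bound[of 2] bound[of 1] by linarith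
  qed
  also have "\<dots> = 10368 * \<eta> ^ 3 / rho ^ 4" by (simp add: B_def power3_eq_cube)
  finally show ?thesis .
qed

end

section \<open>Characters modulo a prime\<close>

text \<open>E is the discrete logarithm to a primitive root followed by j -> exp(2 pi i j / (q -
  1)), a faithful character of the units. At multiples of q it takes some value of norm 1, which
  \<open>chi\<close> overrides by 0.\<close>

lemma prime_character_generator_exists:
  assumes q: "prime (q::nat)" "q \<ge> 3"
  obtains E :: "nat \<Rightarrow> complex" and g :: nat where
    "\<And>a b. \<not> q dvd a \<Longrightarrow> \<not> q dvd b \<Longrightarrow> E (a * b) = E a * E b"
    "\<And>a. norm (E a) = 1"
    "\<And>a. E (a mod q) = E a"
    "\<And>a b. \<not> q dvd a \<Longrightarrow> \<not> q dvd b \<Longrightarrow> E a = E b \<longleftrightarrow> [a = b] (mod q)"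
    "\<not> q dvd g" "\<And>j. E g ^ j = 1 \<longleftrightarrow> (q - 1) dvd j"
proof -
  obtain g where g: "residue_primroot q g" using prime_primitive_root_exists[of q] q by auto
  have cop: "coprime q g" and ordg: "ord q g = q - 1"
    using g q by (auto simp: residue_primroot_def totient_prime)
  define n where "n = q - 1"
  have n0: "n > 0" using q by (simp add: n_def)
  have gij: "[g ^ i = g ^ j] (mod q) \<longleftrightarrow> [i = j] (mod n)" for i j
    using order_divides_expdiff[OF cop, of i j] ordg by (simp add: n_def)
  have copI: "coprime a q" if "\<not> q dvd a" for a
    using prime_imp_coprime[OF q(1) that] by (simp add: coprime_commute)
  have ex: "\<exists>i. [g ^ i = a] (mod q)" if a: "\<not> q dvd a" for a
  proof -
    have "a mod q \<in> totatives q"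
      using a q copI[OF a] by (auto simp: totatives_def mod_greater_zero_iff_not_dvd coprime_commute)
    then obtain i where "a mod q = g ^ i mod q"
      using residue_primroot_is_generator[of q g] g q by (auto simp: bij_betw_def)
    then show ?thesis by (auto simp: cong_def)
  qed
  \<comment> \<open>The exponent is chosen from a mod q, so that periodicity of E holds by
    definition.\<close>
  define dl where "dl = (\<lambda>a. SOME i. [g ^ i = a mod q] (mod q))"
  have dl: "[g ^ dl a = a] (mod q)" if "\<not> q dvd a" for a
  proof -
    have "\<not> q dvd (a mod q)" using that by (simp add: dvd_mod_iff)
    from someI_ex[OF ex[OF this]] have "[g ^ dl a = a mod q] (mod q)" by (simp add: dl_def)
    then show ?thesis by (simp add: cong_def)
  qed
  define e where "e = (\<lambda>j. exp (2 * of_real pi * \<i> * of_nat j / of_nat n))"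
  define E where "E = (\<lambda>a. e (dl a))"
  have e_eq: "e i = e j \<longleftrightarrow> [i = j] (mod n)" for i j
    using complex_root_unity_eq[of n i j] n0 by (simp add: e_def cong_def)
  have e_add: "e (i + j) = e i * e j" for i j
    by (simp add: e_def exp_add[symmetric] add_divide_distrib ring_distribs)
  have e_pow: "e i ^ j = e (i * j)" for i j
    by (induction j) (simp_all add: e_add[symmetric], simp add: e_def)
  have e0: "e 0 = 1" by (simp add: e_def)
  have ng: "\<not> q dvd g" using cop q by (auto simp: prime_nat_iff dest: coprime_absorb_left)
  show ?thesis
  proof (rule that[of E g])
    fix a b assume ab: "\<not> q dvd a" "\<not> q dvd b"
    then have "\<not> q dvd a * b" using q by (simp add: prime_dvd_mult_iff)
    then have "[g ^ dl (a * b) = a * b] (mod q)" by (rule dl)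
    also have "[a * b = g ^ dl a * g ^ dl b] (mod q)"
      using cong_mult[OF dl[OF ab(1)] dl[OF ab(2)]] by (rule cong_sym)
    finally have "[g ^ dl (a * b) = g ^ (dl a + dl b)] (mod q)" by (simp add: power_add)
    then show "E (a * b) = E a * E b" unfolding gij by (simp add: E_def e_add[symmetric] e_eq)
    show "E a = E b \<longleftrightarrow> [a = b] (mod q)"
      unfolding E_def e_eq gij[symmetric] using dl[OF ab(1)] dl[OF ab(2)]
      by (meson cong_sym cong_trans)
  next
    show "norm (E a) = 1" for a by (simp add: E_def e_def)
    show "E (a mod q) = E a" for a by (simp add: E_def dl_def)
    show "\<not> q dvd g" by (rule ng)
    fix j
    have "[g ^ dl g = g ^ 1] (mod q)" using dl[OF ng] by simp
    then have "[dl g = 1] (mod n)" unfolding gij .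
    then have "[dl g * j = 1 * j] (mod n)" by (rule cong_scalar_right)
    then have "E g ^ j = e (1 * j)" unfolding E_def e_pow e_eq .
    also have "\<dots> = 1 \<longleftrightarrow> n dvd j" using e_eq[of j 0] by (simp add: e0 cong_0_iff)
    finally show "E g ^ j = 1 \<longleftrightarrow> (q - 1) dvd j" by (simp add: n_def)
  qed
qed

locale real_prime_character = prime_character +
  assumes square_trivial: "\<not> q dvd n \<Longrightarrow> ch n ^ 2 = 1"

text \<open>The powers of E^r are the m characters of order dividing m. Even m is the case in which
  -1 is an r-th power modulo q.\<close>

locale character_family =
  fixes q r m :: nat and E :: "nat \<Rightarrow> complex" and g :: nat
  assumes prime: "prime q" and q3: "q \<ge> 3" and rm: "r * m = q - 1" and even_m: "even m"
    and E_mult: "\<not> q dvd a \<Longrightarrow> \<not> q dvd b \<Longrightarrow> E (a * b) = E a * E b"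
    and norm_E: "norm (E a) = 1"
    and E_mod: "E (a mod q) = E a"
    and E_eq_iff: "\<not> q dvd a \<Longrightarrow> \<not> q dvd b \<Longrightarrow> E a = E b \<longleftrightarrow> [a = b] (mod q)"
    and g: "\<not> q dvd g" and E_g: "E g ^ j = 1 \<longleftrightarrow> (q - 1) dvd j"
begin

definition chi :: "nat \<Rightarrow> nat \<Rightarrow> complex" where
  "chi i n = (if q dvd n then 0 else E n ^ (r * i))"

lemma r_pos: "r > 0" and m_pos: "m > 0" using rm q3 by (auto intro!: Nat.gr0I)

lemma prime_character_chi:
  assumes "0 < i" "i < m"
  shows "prime_character (chi i) q"
proof
  show "chi i (a * b) = chi i a * chi i b" for a b
    using prime by (simp add: chi_def prime_dvd_mult_iff E_mult power_mult_distrib)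
  have nz: "E n \<noteq> 0" for n using norm_E[of n] by auto
  show "chi i n = 0 \<longleftrightarrow> q dvd n" for n using nz by (simp add: chi_def)
  show "norm (chi i n) = 1" if "\<not> q dvd n" for n using that by (simp add: chi_def norm_power norm_E)
  show "chi i (n mod q) = chi i n" for n by (simp add: chi_def E_mod dvd_mod_iff)
  have "r * i < r * m" "r * i > 0" using assms r_pos by auto
  then have "\<not> (q - 1) dvd r * i" unfolding rm by (auto dest: dvd_imp_le)
  then show "\<exists>g. \<not> q dvd g \<and> chi i g \<noteq> 1" using g E_g by (intro exI[of _ g]) (simp add: chi_def)
qed (use prime q3 in auto)

text \<open>The square of \<open>chi i\<close> is principal iff m divides 2 i, which for 0 < i < m
  means 2 i = m.\<close>

lemma complex_prime_character_chi:
  assumes "0 < i" "i < m" "2 * i \<noteq> m"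
  shows "complex_prime_character (chi i) q"
proof -
  interpret prime_character "chi i" q using assms by (intro prime_character_chi)
  show ?thesis
  proof
    have "\<not> m dvd 2 * i"
    proof
      assume "m dvd 2 * i"
      then obtain c where c: "2 * i = m * c" by blast
      then have "0 < c" using assms by (auto intro!: Nat.gr0I)
      have "m * c < m * 2" unfolding c[symmetric] using assms by linarith
      then have "c < 2" using mult_less_cancel1 by blast
      then have "c = 1" using \<open>0 < c\<close> by simp
      then show False using c assms(3) by simp
    qed
    then have "\<not> (q - 1) dvd r * (2 * i)" unfolding rm[symmetric] using r_pos by simp
    then have "E g ^ (r * i * 2) \<noteq> 1" using E_g[of "r * (2 * i)"] by (simp add: mult_ac)
    then have "chi i g ^ 2 \<noteq> 1" using g by (simp add: chi_def power_mult)
    then show "\<exists>g. \<not> q dvd g \<and> chi i g ^ 2 \<noteq> 1" using g by blast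
  qed
qed

lemma E_pow_q_minus_1:
  assumes "\<not> q dvd n" shows "E n ^ (q - 1) = 1"
proof -
  have E1: "E 1 = 1"
  proof -
    have "E 1 * E 1 = E 1 * 1" using E_mult[of 1 1] q3 by simp
    moreover have "E 1 \<noteq> 0" using norm_E[of 1] by auto
    ultimately show ?thesis by simp
  qed
  have nd: "\<not> q dvd n ^ j" for j using assms prime prime_dvd_power by blast
  have "E (n ^ j) = E n ^ j" for j
    by (induction j) (use E1 E_mult[OF assms nd] in auto)
  then have "E n ^ (q - 1) = E (n ^ (q - 1))" by simp
  also have "\<dots> = E 1" using E_eq_iff[OF nd, of 1] fermat_theorem[OF prime assms] q3 by simp
  finally show ?thesis using E1 by simp
qed

lemma real_prime_character_chi:
  assumes "2 * i = m"
  shows "real_prime_character (chi i) q"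
proof -
  have "0 < i" "i < m" using assms m_pos by auto
  then interpret prime_character "chi i" q by (rule prime_character_chi)
  show ?thesis
  proof
    fix n assume "\<not> q dvd n"
    have "r * i * 2 = q - 1" unfolding rm[symmetric] assms[symmetric] by (simp only: mult.assoc mult.commute[of i 2])
    then show "chi i n ^ 2 = 1"
      using E_pow_q_minus_1[of n] \<open>\<not> q dvd n\<close> by (simp add: chi_def power_mult[symmetric])
  qed
qed

text \<open>Since E is faithful, E (q - 1) is a square root of 1 other than 1, hence -1, and n^r =
  -1 can be read off from E.\<close>

lemma E_pow_r:
  assumes n: "\<not> q dvd n"
  shows "E n ^ r = -1 \<longleftrightarrow> q dvd n ^ r + 1"
proof -
  have E1: "E 1 = 1"
  proof -
    have "E 1 * E 1 = E 1 * 1" using E_mult[of 1 1] q3 by simp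
    moreover have "E 1 \<noteq> 0" using norm_E[of 1] by auto
    ultimately show ?thesis by simp
  qed
  have nd: "\<not> q dvd n ^ j" for j using n prime prime_dvd_power by blast
  have pow: "E (n ^ j) = E n ^ j" for j
    by (induction j) (use E1 E_mult[OF n nd] in auto)
  have nq1: "\<not> q dvd q - 1" using q3 by (auto dest: dvd_imp_le)
  have "[(q - 1) * (q - 1) = 1] (mod q)"
  proof -
    have "(q - 1) * (q - 1) = 1 + q * (q - 2)" using q3 by (cases q; cases "q - 1") (auto simp: algebra_simps)
    then show ?thesis by (simp only: cong_def mod_mult_self2)
  qed
  then have "E (q - 1) * E (q - 1) = 1"
    using E_eq_iff[of "(q - 1) * (q - 1)" 1] E_mult[OF nq1 nq1] nq1 prime q3 E1 by (simp add: prime_dvd_mult_iff)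
  moreover have "E (q - 1) \<noteq> 1"
    using E_eq_iff[OF nq1, of 1] q3 E1 by (auto simp: cong_def)
  ultimately have "E (q - 1) = -1" by (metis square_eq_1_iff)
  then have "E n ^ r = -1 \<longleftrightarrow> [n ^ r = q - 1] (mod q)"
    using E_eq_iff[OF nd nq1, of r] pow by simp
  also have "\<dots> \<longleftrightarrow> [n ^ r + 1 = (q - 1) + 1] (mod q)" by (simp only: cong_add_rcancel_nat)
  also have "\<dots> \<longleftrightarrow> q dvd n ^ r + 1" using q3 by (simp add: cong_def dvd_eq_mod_eq_0)
  finally show ?thesis .
qed

text \<open>The left side is a geometric sum with ratio z = -E(n)^r. As m is even, z^m = E(n)^(q -
  1) = 1, so the sum vanishes unless z = 1.\<close>

lemma orthogonality:
  assumes n: "\<not> q dvd n"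
  shows "(\<Sum>i<m. (-1) ^ i * chi i n) = (if q dvd n ^ r + 1 then of_nat m else 0)"
proof -
  define z where "z = - (E n ^ r)"
  have "(\<Sum>i<m. (-1) ^ i * chi i n) = (\<Sum>i<m. z ^ i)"
    using n by (intro sum.cong refl) (simp add: chi_def z_def power_mult power_minus[of "E n ^ r"])
  also have "\<dots> = (if z = 1 then of_nat m else 0)"
  proof (cases "z = 1")
    case False
    have "z ^ m = E n ^ (q - 1)" using even_m unfolding z_def rm[symmetric] by (simp add: power_mult)
    then have "z ^ m = 1" using E_pow_q_minus_1[OF n] by simp
    then show ?thesis using False by (simp add: sum_gp_strict)
  qed simp
  also have "z = 1 \<longleftrightarrow> q dvd n ^ r + 1" using E_pow_r[OF n] unfolding z_def by (metis minus_equation_iff)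
  finally show ?thesis .
qed

end

section \<open>Partial sums of the quadratic character\<close>

lemma sum_periodic_shift:
  fixes f :: "nat \<Rightarrow> 'a :: ab_group_add"
  assumes "\<And>n. f (n + q) = f n"
  shows "(\<Sum>n<q. f (n + a)) = (\<Sum>n<q. f n)"
proof (induction a)
  case (Suc a)
  have "(\<Sum>n<q. f (n + Suc a)) = (\<Sum>n<q. f (Suc n + a))" by simp
  also have "\<dots> = (\<Sum>n<Suc q. f (n + a)) - f (0 + a)" by (subst sum.lessThan_Suc_shift) simp
  also have "\<dots> = (\<Sum>n<q. f (n + a)) + f (q + a) - f (0 + a)" by simp
  also have "f (q + a) = f a" using assms[of a] by (simp add: add.commute)
  finally show ?case using Suc.IH by simp
qed simp

context real_prime_character
begin

definition lg :: "nat \<Rightarrow> real" where "lg n = Re (ch n)"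

lemma ch_cases: "ch n = 0 \<or> ch n = 1 \<or> ch n = -1"
proof (cases "q dvd n")
  case False
  then have "ch n ^ 2 = 1" by (rule square_trivial)
  then show ?thesis by (simp add: power2_eq_1_iff)
qed (use zero_iff in auto)

lemma ch_eq_lg: "ch n = of_real (lg n)" using ch_cases[of n] by (auto simp: lg_def)
lemma lg_cases: "lg n = 0 \<or> lg n = 1 \<or> lg n = -1" using ch_cases[of n] by (auto simp: lg_def)
lemma lg_mult: "lg (m * n) = lg m * lg n"
proof -
  have "complex_of_real (lg (m * n)) = of_real (lg m * lg n)"
    using mult[of m n] by (metis ch_eq_lg of_real_mult)
  then show ?thesis by (rule of_real_eq_iff[THEN iffD1])
qed
lemma lg_1: "lg 1 = 1" using ch_1 by (simp add: lg_def)
lemma lg_period: "lg (n + q) = lg n" using periodic[of n] by (simp add: lg_def)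
lemma lg_mod: "lg (n mod q) = lg n" using mod_eq[of n] by (simp add: lg_def)
lemma lg_square: "\<not> q dvd n \<Longrightarrow> lg n * lg n = 1"
proof -
  assume "\<not> q dvd n"
  then have "complex_of_real (lg n * lg n) = of_real 1"
    using square_trivial[of n] by (metis ch_eq_lg of_real_1 of_real_mult power2_eq_square)
  then show ?thesis by (rule of_real_eq_iff[THEN iffD1])
qed
lemma lg_zero: "q dvd n \<Longrightarrow> lg n = 0" using zero_iff[of n] by (auto simp: lg_def)
lemma lg_sum: "(\<Sum>n<q. lg n) = 0" using sum_period by (simp add: lg_def Re_sum[symmetric])
lemma abs_lg_le: "\<bar>lg n\<bar> \<le> 1" using lg_cases[of n] by auto

definition corr :: "nat \<Rightarrow> real" where "corr h = (\<Sum>n<q. lg n * lg (n + h))"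

lemma corr_mult:
  assumes u: "\<not> q dvd u" shows "corr (u * h) = corr h"
proof -
  have xm: "lg (u * n mod q + u * h) = lg (u * (n + h))" for n
    by (metis lg_mod mod_add_left_eq distrib_left)
  have "corr (u * h) = (\<Sum>n<q. lg (u * n mod q) * lg (u * n mod q + u * h))"
    unfolding corr_def by (rule sum_mult_mod[OF u, symmetric])
  also have "\<dots> = (\<Sum>n<q. (lg u * lg u) * (lg n * lg (n + h)))"
    by (intro sum.cong refl) (simp only: xm lg_mod, simp only: lg_mult mult_ac)
  also have "\<dots> = corr h" by (simp add: lg_square[OF u] corr_def)
  finally show ?thesis .
qed

lemma corr_period: "corr (h + q) = corr h"
  unfolding corr_def by (intro sum.cong refl) (metis lg_period add.assoc)

lemma corr_0: "corr 0 = real q - 1"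
proof -
  have "corr 0 = (\<Sum>n<q. if n = 0 then 0 else 1)"
    unfolding corr_def by (intro sum.cong refl) (auto simp: lg_zero intro!: lg_square dest: dvd_imp_le)
  also have "\<dots> = real (card ({..<q} - {0}))" by (simp add: sum.If_cases Diff_eq Collect_neg_eq)
  also have "\<dots> = real q - 1" using q3 by (simp add: of_nat_diff)
  finally show ?thesis .
qed

text \<open>Dilation by units shows that all these correlations agree. The sum over all shifts is 0,
  hence (q - 1) (1 + corr 1) = 0.\<close>

lemma corr_not_dvd:
  assumes "\<not> q dvd h" shows "corr h = -1"
proof -
  have c1: "corr h = corr 1" if "\<not> q dvd h" for h using corr_mult[OF that, of 1] by simp
  have "(\<Sum>h<q. corr h) = (\<Sum>n<q. lg n * (\<Sum>h<q. lg (h + n)))"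
    unfolding corr_def sum_distrib_left by (subst sum.swap) (simp add: add.commute)
  also have "\<dots> = 0" using sum_periodic_shift[of lg q, OF lg_period] lg_sum by simp
  finally have "0 = (\<Sum>h<q. corr h)" by simp
  also have "{..<q} = insert 0 ({..<q} - {0})" using q3 by auto
  also have "(\<Sum>h\<in>insert 0 ({..<q} - {0}). corr h) = corr 0 + (\<Sum>h\<in>{..<q} - {0}. corr h)"
    by (subst sum.insert) auto
  also have "(\<Sum>h\<in>{..<q} - {0}. corr h) = (\<Sum>h\<in>{..<q} - {0}. corr 1)"
    by (intro sum.cong refl c1) (auto dest: dvd_imp_le)
  also have "\<dots> = (real q - 1) * corr 1" using q3 by (simp add: of_nat_diff)
  finally have "corr 0 + (real q - 1) * corr 1 = 0" ..
  moreover have "corr 0 + (real q - 1) * corr 1 = (real q - 1) * (1 + corr 1)"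
    by (simp add: corr_0 algebra_simps)
  ultimately have "(real q - 1) * (1 + corr 1) = 0" by (simp only:)
  then have "real q - 1 = 0 \<or> 1 + corr 1 = 0" by (simp only: mult_eq_0_iff)
  then show ?thesis using q3 c1[OF assms] by auto
qed

definition S :: "nat \<Rightarrow> real" where "S N = (\<Sum>n\<le>N. lg n)"

lemma A_eq_S: "A N = of_real (S N)" by (simp add: A_def S_def ch_eq_lg)
lemma S_period: "S (N + q) = S N" using A_period[of N] by (simp add: A_eq_S)
lemma abs_S_le: "\<bar>S N\<bar> \<le> real q" using norm_A_le[of N] by (simp add: A_eq_S)
lemma S_diff: "S (a + N) - S a = (\<Sum>j=1..N. lg (a + j))"
  by (induction N) (simp_all add: S_def)

lemma sum_corr_shift: "(\<Sum>a<q. lg (a + i) * lg (a + j)) = (if [i = j] (mod q) then real q - 1 else -1)"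
proof -
  have *: "(\<Sum>a<q. lg (a + i) * lg (a + j)) = (if [i = j] (mod q) then real q - 1 else -1)" if "i \<le> j" for i j
  proof -
    define h where "h = j - i"
    have "(\<Sum>a<q. lg (a + i) * lg (a + j)) = (\<Sum>a<q. (\<lambda>n. lg n * lg (n + h)) (a + i))"
      using that by (simp add: h_def add.assoc)
    also have "\<dots> = corr h" unfolding corr_def
      by (rule sum_periodic_shift) (metis lg_period add.assoc add.commute)
    finally have 1: "(\<Sum>a<q. lg (a + i) * lg (a + j)) = corr h" .
    have 2: "[i = j] (mod q) \<longleftrightarrow> q dvd h"
      using that unfolding h_def by (metis cong_altdef_nat cong_sym_eq)
    show ?thesis
    proof (cases "q dvd h")
      case True
      then obtain c where h: "h = q * c" by blast
      have "corr (q * c) = corr 0" for c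
      proof (induction c)
        case (Suc c)
        have "q * Suc c = q * c + q" by simp
        then show ?case by (simp only: corr_period Suc)
      qed simp
      then have "corr h = corr 0" unfolding h .
      then show ?thesis using 1 2 True corr_0 by simp
    qed (use 1 2 corr_not_dvd in auto)
  qed
  show ?thesis using *[of i j] *[of j i] by (cases "i \<le> j") (auto simp: mult.commute cong_sym_eq)
qed

text \<open>The diagonal of the expanded square gives N (q - 1); all other correlations equal -1 and
  are discarded.\<close>

lemma window_sum:
  assumes "N < q"
  shows "(\<Sum>a<q. (S (a + N) - S a)\<^sup>2) \<le> (real q)\<^sup>2"
proof -
  have "(\<Sum>a<q. (S (a + N) - S a)\<^sup>2) = (\<Sum>a<q. \<Sum>i=1..N. \<Sum>j=1..N. lg (a + i) * lg (a + j))"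
    by (simp only: S_diff power2_eq_square sum_product)
  also have "\<dots> = (\<Sum>i=1..N. \<Sum>a<q. \<Sum>j=1..N. lg (a + i) * lg (a + j))" by (rule sum.swap)
  also have "\<dots> = (\<Sum>i=1..N. \<Sum>j=1..N. \<Sum>a<q. lg (a + i) * lg (a + j))"
    by (intro sum.cong refl sum.swap)
  also have "\<dots> = (\<Sum>i=1..N. \<Sum>j=1..N. if i = j then real q - 1 else -1)"
    unfolding sum_corr_shift using assms by (intro sum.cong refl) (auto simp: cong_def)
  also have "\<dots> \<le> (\<Sum>i=1..N. \<Sum>j=1..N. if i = j then real q else 0)"
    by (intro sum_mono) auto
  also have "\<dots> = real N * real q" by simp
  also have "\<dots> \<le> real q * real q" using assms by (intro mult_right_mono) auto
  finally show ?thesis by (simp add: power2_eq_square)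
qed

text \<open>Averaging the second moment of S b - S a over all pairs produces a good centre, and
  Cauchy-Schwarz passes to the first moment. This takes the place of a Polya-Vinogradov bound and
  avoids its logarithm.\<close>

lemma ex_center:
  obtains a where "(\<Sum>b<q. \<bar>S b - S a\<bar>) \<le> real q * sqrt (real q)"
proof -
  have inner: "(\<Sum>b<q. (S b - S a)\<^sup>2) = (\<Sum>N<q. (S (a + N) - S a)\<^sup>2)" for a
    using sum_periodic_shift[of "\<lambda>b. (S b - S a)\<^sup>2" q a] by (simp add: S_period add.commute)
  have "(\<Sum>a<q. \<Sum>b<q. (S b - S a)\<^sup>2) = (\<Sum>N<q. \<Sum>a<q. (S (a + N) - S a)\<^sup>2)"
    unfolding inner by (rule sum.swap)
  also have "\<dots> \<le> (\<Sum>N<q. (real q)\<^sup>2)" by (intro sum_mono window_sum) auto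
  finally have le: "(\<Sum>a<q. \<Sum>b<q. (S b - S a)\<^sup>2) \<le> (\<Sum>a<q. (real q)\<^sup>2)" .
  have "\<exists>a<q. (\<Sum>b<q. (S b - S a)\<^sup>2) \<le> (real q)\<^sup>2"
  proof (rule ccontr)
    assume "\<not> ?thesis"
    then have "(\<Sum>a<q. (real q)\<^sup>2) < (\<Sum>a<q. \<Sum>b<q. (S b - S a)\<^sup>2)"
      using q3 by (intro sum_strict_mono) (auto simp: not_le lessThan_empty_iff)
    with le show False by simp
  qed
  then obtain a where a: "(\<Sum>b<q. (S b - S a)\<^sup>2) \<le> (real q)\<^sup>2" by blast
  have "(\<Sum>b<q. \<bar>S b - S a\<bar>)\<^sup>2 \<le> (\<Sum>b<q. \<bar>S b - S a\<bar>\<^sup>2) * (\<Sum>b<q. 1\<^sup>2)"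
    using Cauchy_Schwarz_ineq_sum[of "\<lambda>b. \<bar>S b - S a\<bar>" "\<lambda>_. 1" "{..<q}"] by simp
  also have "\<dots> \<le> (real q)\<^sup>2 * real q" using a by (intro mult_mono) auto
  also have "\<dots> = (real q * sqrt (real q))\<^sup>2" by (simp add: power_mult_distrib)
  finally have "(\<Sum>b<q. \<bar>S b - S a\<bar>) \<le> real q * sqrt (real q)" by (rule power2_le_imp_le) simp
  then show ?thesis by (rule that)
qed

text \<open>The coefficients of zeta(s) L(s).\<close>

definition divsum :: "nat \<Rightarrow> real" where "divsum n = (\<Sum>d | d dvd n. lg d)"

lemma divsum_mult: "coprime a b \<Longrightarrow> a > 0 \<Longrightarrow> b > 0 \<Longrightarrow> divsum (a * b) = divsum a * divsum b"
  unfolding divsum_def by (rule divisor_sum_coprime_mult) (auto simp: lg_mult)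

lemma divsum_prime_power: "prime p \<Longrightarrow> divsum (p ^ a) = (\<Sum>j\<le>a. lg p ^ j)"
  unfolding divsum_def by (rule divisor_sum_prime_power) (auto simp: lg_mult lg_1[unfolded One_nat_def])

lemma sum_minus_one_powers: "(\<Sum>j\<le>a. (-1) ^ j :: real) = (if even a then 1 else 0)"
  by (induction a) auto

text \<open>At p^a the sum is a + 1 or 1 when lg p is 1 or 0, and for lg p = -1 it is 1 or 0
  according to the parity of a. The case of even a is what makes squares contribute at least
  1.\<close>

lemma divsum_nonneg: "n > 0 \<Longrightarrow> divsum n \<ge> 0"
proof (induction n rule: prod_prime_power_induct)
  case (mult p a m)
  have cop: "coprime (p ^ a) m" using mult by (simp add: prime_imp_coprime)
  have "divsum (p ^ a) \<ge> 0"
    unfolding divsum_prime_power[OF mult(1)] using lg_cases[of p] by (auto simp: sum_minus_one_powers intro: sum_nonneg)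
  then show ?case using mult cop prime_gt_0_nat[of p] by (simp add: divsum_mult)
qed (simp add: divsum_def lg_1[unfolded One_nat_def])

lemma divsum_square_ge: "n > 0 \<Longrightarrow> divsum (n ^ 2) \<ge> 1"
proof (induction n rule: prod_prime_power_induct)
  case (mult p a m)
  have cop: "coprime ((p ^ a) ^ 2) (m ^ 2)" using mult by (simp add: prime_imp_coprime)
  have "divsum (p ^ (a * 2)) \<ge> 1"
    unfolding divsum_prime_power[OF mult(1)] using lg_cases[of p]
    by (auto simp: sum_minus_one_powers power_0_left sum.delta)
  moreover have "divsum ((p ^ a * m) ^ 2) = divsum (p ^ (a * 2)) * divsum (m ^ 2)"
    using mult cop prime_gt_0_nat[of p] by (simp add: power_mult_distrib divsum_mult power_mult[symmetric])
  ultimately show ?case using mult.IH mult_mono[of 1 "divsum (p ^ (a * 2))" 1 "divsum (m ^ 2)"] by simp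
qed (simp add: divsum_def lg_1[unfolded One_nat_def])

end

section \<open>A lower bound for the quadratic L-function at 1\<close>

lemma sinh_mvt:
  assumes "(u::real) > 0"
  shows "u \<le> sinh u" "sinh u \<le> u * cosh u"
proof -
  have "\<exists>z>0. z < u \<and> sinh u - sinh 0 = (u - 0) * cosh z"
    using assms by (intro MVT2) (auto intro!: derivative_eq_intros)
  then obtain z where z: "z > 0" "z < u" "sinh u = u * cosh z" by auto
  have "cosh z \<le> cosh u" using z by (subst cosh_real_nonneg_le_iff) auto
  moreover have "1 \<le> cosh z" by (rule cosh_real_ge_1)
  ultimately show "u \<le> sinh u" "sinh u \<le> u * cosh u" unfolding z(3) using assms by auto
qed

lemma cosh_lower: "(u::real) > 0 \<Longrightarrow> cosh u - 1 \<ge> u\<^sup>2 / 2"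
proof -
  assume u: "u > 0"
  have "cosh u = 2 * sinh (u/2) ^ 2 + 1" using cosh_double[of "u/2"] cosh_square_eq[of "u/2"] by simp
  moreover have "(u/2)\<^sup>2 \<le> sinh (u/2) ^ 2" using sinh_mvt(1)[of "u/2"] u by (intro power_mono) auto
  ultimately show ?thesis by (simp add: power_divide)
qed

lemma cosh_upper:
  assumes u: "(u::real) > 0" "u \<le> 1"
  shows "cosh u \<le> 1 + u\<^sup>2"
proof -
  have "exp u \<le> 1 + u + u\<^sup>2" using u by (intro exp_bound) auto
  moreover have "exp (- u) \<le> 1 - u + u\<^sup>2"
  proof -
    have "1 \<le> (1 - u + u\<^sup>2) * (1 + u)" using u by (simp add: power2_eq_square algebra_simps)
    also have "\<dots> \<le> (1 - u + u\<^sup>2) * exp u"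
      using u exp_ge_add_one_self[of u] by (intro mult_left_mono) auto
    finally show ?thesis by (simp add: exp_minus field_simps)
  qed
  ultimately show ?thesis by (simp add: cosh_field_def)
qed

text \<open>The function 1 / (2 sinh u) without its pole at 0: the pole produces X L(1) / 2, and
  what remains varies slowly enough for partial summation against S.\<close>

definition csch_err :: "real \<Rightarrow> real" where "csch_err u = 1 / (2 * sinh u) - 1 / (2 * u)"

lemma csch_err_deriv:
  assumes "u > 0"
  shows "(csch_err has_real_derivative (1 / u\<^sup>2 - cosh u / (sinh u)\<^sup>2) / 2) (at u)"
proof -
  have "sinh u > 0" using sinh_mvt(1)[OF assms] assms by simp
  have "((\<lambda>u. (inverse (sinh u) - inverse u) / 2) has_real_derivative
     ((- (inverse (sinh u) * cosh u * inverse (sinh u))) - (- (inverse u * 1 * inverse u))) / 2) (at u)"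
    using assms \<open>sinh u > 0\<close>
    by (intro DERIV_cdivide DERIV_diff DERIV_inverse' DERIV_ident) (auto intro!: derivative_eq_intros)
  moreover have "(\<lambda>u. (inverse (sinh u) - inverse u) / 2) = csch_err"
    by (rule ext) (simp add: csch_err_def diff_divide_distrib inverse_eq_divide)
  moreover have "((- (inverse (sinh u) * cosh u * inverse (sinh u))) - (- (inverse u * 1 * inverse u))) / 2 =
      (1 / u\<^sup>2 - cosh u / (sinh u)\<^sup>2) / 2"
    by (simp add: power2_eq_square inverse_eq_divide)
  ultimately show ?thesis by (simp only:)
qed

text \<open>For u <= 1 the numerator sinh^2 u - u^2 cosh u is at most 3 u^4 in absolute value,
  against a denominator of at least u^4. For u > 1 the second term is at most twice the first, by
  sinh^2 u >= u^2 cosh u / 2.\<close>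

lemma csch_err_deriv_bound:
  assumes u: "(u::real) > 0"
  shows "\<bar>(1 / u\<^sup>2 - cosh u / (sinh u)\<^sup>2) / 2\<bar> \<le> 6 / (1 + u)\<^sup>2"
proof (cases "u \<le> 1")
  case True
  have s: "u \<le> sinh u" "sinh u \<le> u * cosh u" using sinh_mvt[OF u] by auto
  have c: "cosh u \<le> 1 + u\<^sup>2" using cosh_upper[OF u True] .
  have s0: "u\<^sup>2 \<le> (sinh u)\<^sup>2" using s u by (intro power_mono) auto
  have "sinh u \<le> u * (1 + u\<^sup>2)" using s(2) c u by (meson mult_left_mono order.trans less_imp_le)
  then have "(sinh u)\<^sup>2 \<le> (u * (1 + u\<^sup>2))\<^sup>2" using s u by (intro power_mono) auto
  also have "\<dots> = u\<^sup>2 + 2 * u ^ 4 + u ^ 4 * u\<^sup>2" by (simp add: power2_eq_square power4_eq_xxxx algebra_simps)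
  also have "u ^ 4 * u\<^sup>2 \<le> u ^ 4 * 1" using u True by (intro mult_left_mono power_le_one) auto
  finally have s1: "(sinh u)\<^sup>2 \<le> u\<^sup>2 + 3 * u ^ 4" by simp
  have c1: "u\<^sup>2 * 1 \<le> u\<^sup>2 * cosh u" using cosh_real_ge_1[of u] by (intro mult_left_mono) auto
  have "u\<^sup>2 * cosh u \<le> u\<^sup>2 * (1 + u\<^sup>2)" using c by (intro mult_left_mono) auto
  then have c2: "u\<^sup>2 * cosh u \<le> u\<^sup>2 + u ^ 4" by (simp add: algebra_simps power4_eq_xxxx power2_eq_square)
  have "u ^ 4 \<ge> 0" by simp
  then have num: "\<bar>(sinh u)\<^sup>2 - u\<^sup>2 * cosh u\<bar> \<le> 3 * u ^ 4"
    using s0 s1 c1 c2 by (simp add: abs_le_iff)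
  have sp: "sinh u > 0" using s u by simp
  have "1 / u\<^sup>2 - cosh u / (sinh u)\<^sup>2 = ((sinh u)\<^sup>2 - u\<^sup>2 * cosh u) / (u\<^sup>2 * (sinh u)\<^sup>2)"
    using u sp by (simp add: field_simps)
  then have "\<bar>1 / u\<^sup>2 - cosh u / (sinh u)\<^sup>2\<bar> = \<bar>(sinh u)\<^sup>2 - u\<^sup>2 * cosh u\<bar> / (u\<^sup>2 * (sinh u)\<^sup>2)"
    by (simp add: abs_mult)
  also have "\<dots> \<le> (3 * u ^ 4) / (u\<^sup>2 * u\<^sup>2)"
    using num s0 u by (intro frac_le mult_left_mono) auto
  also have "\<dots> = 3" using u by (simp add: power2_eq_square power4_eq_xxxx)
  finally have "\<bar>(1 / u\<^sup>2 - cosh u / (sinh u)\<^sup>2) / 2\<bar> \<le> 6 / 4" by simp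
  also have "6 / 4 \<le> 6 / (1 + u)\<^sup>2"
  proof -
    have "(1 + u)\<^sup>2 \<le> 2\<^sup>2" using u True by (intro power_mono) auto
    then show ?thesis using u by (intro divide_left_mono) auto
  qed
  finally show ?thesis .
next
  case False
  have sp: "sinh u > 0" using sinh_mvt(1)[OF u] u by simp
  have "(sinh u)\<^sup>2 = (cosh u - 1) * (cosh u + 1)"
    using cosh_square_eq[of u] by (simp add: power2_eq_square algebra_simps)
  also have "\<dots> \<ge> (u\<^sup>2 / 2) * cosh u"
    using cosh_lower[OF u] cosh_real_ge_1[of u] by (intro mult_mono) auto
  finally have "u\<^sup>2 * cosh u \<le> 2 * (sinh u)\<^sup>2" by simp
  then have "cosh u / (sinh u)\<^sup>2 \<le> 2 / u\<^sup>2" using u sp by (simp add: field_simps)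
  moreover have "0 \<le> cosh u / (sinh u)\<^sup>2" using cosh_real_ge_1[of u] by simp
  moreover have gen: "\<bar>(w - v) / 2\<bar> \<le> w" if "0 \<le> v" "v \<le> 2 * w" for v w :: real
    using that by (auto simp: abs_le_iff)
  ultimately have "\<bar>(1 / u\<^sup>2 - cosh u / (sinh u)\<^sup>2) / 2\<bar> \<le> 1 / u\<^sup>2"
    by (intro gen) simp_all
  also have "\<dots> = 4 / (2 * u)\<^sup>2" using u by (simp add: power_mult_distrib)
  also have "\<dots> \<le> 6 / (1 + u)\<^sup>2" using u False by (intro frac_le power_mono) auto
  finally show ?thesis .
qed

lemma csch_err_bound_small: "0 < (u::real) \<Longrightarrow> u \<le> 1 \<Longrightarrow> \<bar>csch_err u\<bar> \<le> u / 2"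
proof -
  assume u: "0 < u" "u \<le> 1"
  have s: "u \<le> sinh u" "sinh u \<le> u * cosh u" using sinh_mvt[OF u(1)] by auto
  have "u * cosh u \<le> u * (1 + u\<^sup>2)" using cosh_upper[OF u] u by (intro mult_left_mono) auto
  then have "sinh u - u \<le> u ^ 3" using s by (simp add: algebra_simps power2_eq_square power3_eq_cube)
  moreover have "csch_err u = - ((sinh u - u) / (2 * u * sinh u))"
    using u s by (simp add: csch_err_def field_simps)
  moreover have "(sinh u - u) / (2 * u * sinh u) \<le> u ^ 3 / (2 * u * u)"
    using s u \<open>sinh u - u \<le> u ^ 3\<close> by (intro frac_le mult_left_mono) auto
  moreover have "(sinh u - u) / (2 * u * sinh u) \<ge> 0" using s u by simp
  moreover have "u ^ 3 / (2 * u * u) = u / 2" using u by (simp add: power3_eq_cube)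
  ultimately show ?thesis by (simp only: abs_minus_cancel abs_of_nonneg)
qed

lemma csch_bounds:
  assumes "(u::real) > 0"
  shows "0 \<le> 1 / (2 * sinh u)" "1 / (2 * sinh u) \<le> 1 / (2 * u)"
  using sinh_mvt(1)[OF assms] assms by (auto intro!: divide_left_mono)

lemma csch_err_bound_large: "0 < (u::real) \<Longrightarrow> \<bar>csch_err u\<bar> \<le> 1 / (2 * u)"
  using csch_bounds[of u] by (simp add: csch_err_def)

lemma csch_err_step:
  assumes X: "X > 0" and N: "N > 0"
  shows "\<bar>csch_err (real N / X) - csch_err (real (Suc N) / X)\<bar> \<le> 6 * X / (X + real N)\<^sup>2"
proof -
  let ?a = "real N / X" and ?b = "real (Suc N) / X"
  have ab: "?a < ?b" "?a > 0" using X N by (auto simp: field_simps)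
  have "\<exists>z. z > ?a \<and> z < ?b \<and> csch_err ?b - csch_err ?a = (?b - ?a) * ((1 / z\<^sup>2 - cosh z / (sinh z)\<^sup>2) / 2)"
    using ab by (intro MVT2) (auto intro!: csch_err_deriv)
  then obtain z where z: "z > ?a" "csch_err ?b - csch_err ?a = (?b - ?a) * ((1 / z\<^sup>2 - cosh z / (sinh z)\<^sup>2) / 2)"
    by blast
  have "\<bar>csch_err ?a - csch_err ?b\<bar> = \<bar>?b - ?a\<bar> * \<bar>(1 / z\<^sup>2 - cosh z / (sinh z)\<^sup>2) / 2\<bar>"
    by (subst abs_minus_commute) (simp only: z(2) abs_mult)
  also have "\<bar>?b - ?a\<bar> = 1 / X" using X by (simp add: field_simps)
  also have "1 / X * \<bar>(1 / z\<^sup>2 - cosh z / (sinh z)\<^sup>2) / 2\<bar> \<le> 1 / X * (6 / (1 + ?a)\<^sup>2)"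
  proof (intro mult_left_mono)
    have "\<bar>(1 / z\<^sup>2 - cosh z / (sinh z)\<^sup>2) / 2\<bar> \<le> 6 / (1 + z)\<^sup>2"
      using z ab by (intro csch_err_deriv_bound) auto
    also have "\<dots> \<le> 6 / (1 + ?a)\<^sup>2" using z ab by (intro divide_left_mono power_mono) auto
    finally show "\<bar>(1 / z\<^sup>2 - cosh z / (sinh z)\<^sup>2) / 2\<bar> \<le> 6 / (1 + ?a)\<^sup>2" .
  qed (use X in auto)
  also have "\<dots> = 6 * X / (X + real N)\<^sup>2"
  proof -
    have "1 + ?a = (X + real N) / X" using X by (simp add: field_simps)
    then show ?thesis using X by (simp add: power_divide) (simp add: power2_eq_square)
  qed
  finally show ?thesis .
qed

lemma exp_geometric_sums:
  assumes "u > (0::real)"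
  shows "(\<lambda>m. exp (- (real (Suc m) * u)) - exp (- (2 * (real (Suc m) * u)))) sums (1 / (2 * sinh u))"
proof -
  define z where "z = exp (- u)"
  have z: "0 < z" "z < 1" using assms by (auto simp: z_def)
  have 1: "exp (- (real (Suc m) * u)) = z * z ^ m" for m
    by (simp add: z_def exp_of_nat_mult[symmetric] exp_add[symmetric] algebra_simps)
  have 2: "exp (- (2 * (real (Suc m) * u))) = z\<^sup>2 * (z\<^sup>2) ^ m" for m
    by (simp add: z_def exp_of_nat_mult[symmetric] exp_add[symmetric] power2_eq_square algebra_simps)
  have "z\<^sup>2 < 1" using z by (simp add: power_less_one_iff)
  then have "(\<lambda>m. z * z ^ m - z\<^sup>2 * (z\<^sup>2) ^ m) sums (z * (1 / (1 - z)) - z\<^sup>2 * (1 / (1 - z\<^sup>2)))"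
    using z by (intro sums_diff sums_mult geometric_sums) auto
  also have "z * (1 / (1 - z)) - z\<^sup>2 * (1 / (1 - z\<^sup>2)) = z / (1 - z\<^sup>2)"
  proof -
    have "1 - z\<^sup>2 = (1 - z) * (1 + z)" by (simp add: power2_eq_square algebra_simps)
    then show ?thesis using z by (simp add: divide_simps) (simp add: power2_eq_square algebra_simps)
  qed
  also have "z / (1 - z\<^sup>2) = 1 / (2 * sinh u)"
  proof -
    have "2 * sinh u = 1 / z - z" by (simp add: sinh_field_def z_def exp_minus field_simps)
    then have "2 * sinh u = (1 - z\<^sup>2) / z" using z by (simp add: field_simps power2_eq_square)
    then show ?thesis by simp
  qed
  finally show ?thesis unfolding 1 2 .
qed

lemma exp_diff_lower:
  assumes t: "1 / 4 \<le> t" "t \<le> (1::real)"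
  shows "1 / 15 \<le> exp (- t) - exp (- (2 * t))"
proof -
  have "exp (- t) - exp (- (2 * t)) = exp (- t) * (1 - exp (- t))" by (simp add: algebra_simps exp_add[symmetric])
  moreover have "exp (- t) \<ge> 1 / 3"
  proof -
    have "exp t \<le> 3" using t exp_le by (meson exp_le_cancel_iff order.trans)
    then show ?thesis by (simp add: exp_minus field_simps)
  qed
  moreover have "1 - exp (- t) \<ge> 1 / 5"
  proof -
    have "5 / 4 \<le> exp t" using exp_ge_add_one_self[of t] t by linarith
    then show ?thesis by (simp add: exp_minus field_simps)
  qed
  ultimately show ?thesis using mult_mono[of "1/3" "exp (- t)" "1/5" "1 - exp (- t)"] by simp
qed


context real_prime_character
begin

text \<open>S is periodic, so each block of length q contributes at most q sqrt q times the weight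
  at its left end. By a telescoping comparison and X >= q the numbers 1 / (X + j q)^2 add up to at
  most 2 / (q X), whence 12.\<close>

lemma weighted_sum_le:
  assumes X: "X \<ge> real q" and c: "(\<Sum>b<q. \<bar>S b - c\<bar>) \<le> real q * sqrt (real q)"
  shows "(\<Sum>N<T * q. \<bar>S N - c\<bar> * (6 * X / (X + real N)\<^sup>2)) \<le> 12 * sqrt (real q)"
proof -
  have q0: "real q > 0" using q3 by simp
  have X0: "X > 0" using X q0 by linarith
  have S_mult: "S (i + j * q) = S i" for i j
  proof (induction j)
    case (Suc j)
    have "i + Suc j * q = (i + j * q) + q" by simp
    then show ?case by (simp only: S_period Suc)
  qed simp
  have block: "(\<Sum>N\<in>{j * q..<j * q + q}. \<bar>S N - c\<bar> * (6 * X / (X + real N)\<^sup>2)) \<le>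
      real q * sqrt (real q) * (6 * X / (X + real j * real q)\<^sup>2)" for j
  proof -
    have "(\<Sum>N\<in>{j * q..<j * q + q}. \<bar>S N - c\<bar> * (6 * X / (X + real N)\<^sup>2)) =
        (\<Sum>i<q. \<bar>S i - c\<bar> * (6 * X / (X + real (i + j * q))\<^sup>2))"
      using sum.shift_bounds_nat_ivl[of "\<lambda>N. \<bar>S N - c\<bar> * (6 * X / (X + real N)\<^sup>2)" 0 "j * q" q]
      by (simp add: S_mult lessThan_atLeast0 add.commute)
    also have "\<dots> \<le> (\<Sum>i<q. \<bar>S i - c\<bar> * (6 * X / (X + real j * real q)\<^sup>2))"
      using X0 q0 by (intro sum_mono mult_left_mono divide_left_mono power_mono mult_pos_pos zero_less_power) (auto intro: add_pos_nonneg)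
    also have "\<dots> = (\<Sum>i<q. \<bar>S i - c\<bar>) * (6 * X / (X + real j * real q)\<^sup>2)"
      by (rule sum_distrib_right[symmetric])
    also have "\<dots> \<le> real q * sqrt (real q) * (6 * X / (X + real j * real q)\<^sup>2)"
      using c X0 by (intro mult_right_mono) auto
    finally show ?thesis .
  qed
  have inv_sq: "(\<Sum>j<Suc T. 1 / (X + real j * real q)\<^sup>2) \<le> 1 / X\<^sup>2 + 1 / (real q * X) - 1 / (real q * (X + real T * real q))" for T
  proof (induction T)
    case (Suc T)
    define Y where "Y = X + real T * real q"
    have Y: "Y > 0" using X0 q0 by (simp add: Y_def add_pos_nonneg)
    have Y': "X + real (Suc T) * real q = Y + real q" by (simp add: Y_def algebra_simps)
    have "1 / (Y + real q)\<^sup>2 \<le> 1 / (Y * (Y + real q))"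
      using Y q0 by (intro divide_left_mono) (auto simp: power2_eq_square)
    also have "\<dots> = 1 / (real q * Y) - 1 / (real q * (Y + real q))"
      using Y q0 by (simp add: divide_simps)
    finally show ?case using Suc.IH unfolding sum.lessThan_Suc[of _ "Suc T"] Y' by (simp add: Y_def)
  qed simp
  have "(\<Sum>N<T * q. \<bar>S N - c\<bar> * (6 * X / (X + real N)\<^sup>2)) =
      (\<Sum>j<T. \<Sum>N\<in>{j * q..<j * q + q}. \<bar>S N - c\<bar> * (6 * X / (X + real N)\<^sup>2))"
    by (rule sum.nat_group[symmetric])
  also have "\<dots> \<le> (\<Sum>j<T. real q * sqrt (real q) * (6 * X / (X + real j * real q)\<^sup>2))"
    by (intro sum_mono block)
  also have "\<dots> = real q * sqrt (real q) * 6 * X * (\<Sum>j<T. 1 / (X + real j * real q)\<^sup>2)"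
    by (simp add: sum_distrib_left mult_ac)
  also have "\<dots> \<le> real q * sqrt (real q) * 6 * X * (1 / X\<^sup>2 + 1 / (real q * X))"
  proof (intro mult_left_mono)
    have "(\<Sum>j<T. 1 / (X + real j * real q)\<^sup>2) \<le> (\<Sum>j<Suc T. 1 / (X + real j * real q)\<^sup>2)" by simp
    also have "\<dots> \<le> 1 / X\<^sup>2 + 1 / (real q * X)"
      using inv_sq[of T] X0 q0 by (smt (verit) divide_nonneg_nonneg mult_nonneg_nonneg of_nat_0_le_iff)
    finally show "(\<Sum>j<T. 1 / (X + real j * real q)\<^sup>2) \<le> 1 / X\<^sup>2 + 1 / (real q * X)" .
  qed (use X0 in auto)
  also have "\<dots> = 6 * sqrt (real q) * (real q / X + 1)"
    using X0 q0 by (simp add: field_simps power2_eq_square)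
  also have "\<dots> \<le> 6 * sqrt (real q) * (1 + 1)"
    using X X0 by (intro mult_left_mono add_right_mono) (auto simp: divide_le_eq)
  finally show ?thesis by simp
qed

text \<open>The sum of exp(-db/X) - exp(-2db/X) over b > 0 is kern X d, so this is the weight that d receives
  when the divisor sums of lg are weighted by exp(-n/X) - exp(-2n/X).\<close>
definition kern :: "real \<Rightarrow> nat \<Rightarrow> real" where "kern X N = 1 / (2 * sinh (real N / X))"

lemma kern_le: "X > 0 \<Longrightarrow> N > 0 \<Longrightarrow> \<bar>kern X N\<bar> \<le> X / (2 * real N)"
proof -
  assume X: "X > 0" and N: "N > 0"
  have p: "real N / X > 0" using X N by simp
  show ?thesis using csch_bounds[OF p] by (simp add: kern_def)
qed

lemma inv_seq_tendsto_0: "(\<lambda>N. c / real (Suc N)) \<longlonglongrightarrow> 0"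
  using tendsto_mult_right_zero[OF LIMSEQ_inverse_real_of_nat, of c] by (simp add: divide_inverse)

lemma kern_sum_tendsto:
  assumes X: "X > 0" and V: "(\<lambda>d. lg d * kern X d) sums V"
  shows "(\<lambda>M. \<Sum>N<M. S N * (kern X N - kern X (Suc N))) \<longlonglongrightarrow> V"
proof -
  have abel: "(\<Sum>d<Suc M. lg d * kern X d) = (\<Sum>N<Suc M. S N * (kern X N - kern X (Suc N))) + S M * kern X (Suc M)" for M
    by (induction M) (simp_all add: S_def algebra_simps)
  have "(\<lambda>M. S M * kern X (Suc M)) \<longlonglongrightarrow> 0"
  proof (rule Lim_null_comparison)
    show "\<forall>\<^sub>F M in sequentially. norm (S M * kern X (Suc M)) \<le> (real q * X / 2) / real (Suc M)"
    proof (intro always_eventually allI)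
      fix M
      have "\<bar>S M\<bar> * \<bar>kern X (Suc M)\<bar> \<le> real q * (X / (2 * real (Suc M)))"
        using X by (intro mult_mono abs_S_le kern_le) auto
      then show "norm (S M * kern X (Suc M)) \<le> (real q * X / 2) / real (Suc M)" by (simp add: abs_mult)
    qed
  qed (rule inv_seq_tendsto_0)
  moreover have "(\<lambda>M. \<Sum>d<Suc M. lg d * kern X d) \<longlonglongrightarrow> V"
    using V unfolding sums_def by (rule LIMSEQ_Suc)
  ultimately have "(\<lambda>M. (\<Sum>d<Suc M. lg d * kern X d) - S M * kern X (Suc M)) \<longlonglongrightarrow> V - 0"
    by (intro tendsto_diff)
  then have "(\<lambda>M. \<Sum>N<Suc M. S N * (kern X N - kern X (Suc N))) \<longlonglongrightarrow> V"
    unfolding abel by simp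
  then show ?thesis by (rule LIMSEQ_imp_Suc)
qed

lemma S_0 [simp]: "S 0 = 0" by (simp add: S_def lg_zero)

lemma L_1_sums: "(\<lambda>N. S N * (1 / real N - 1 / real (Suc N))) sums Re (L 1)"
proof -
  have t: "A n * (of_nat n powr (- 1) - of_nat (Suc n) powr (- 1)) = of_real (S n * (1 / real n - 1 / real (Suc n)))" for n
    by (cases "n = 0") (simp_all add: A_eq_S powr_minus_divide field_simps del: of_nat_Suc)
  have "(\<lambda>n. A n * (of_nat n powr (- 1) - of_nat (Suc n) powr (- 1))) sums L 1"
    unfolding L_def using summable_L[of 1] by (intro summable_sums) auto
  from sums_Re[OF this] show ?thesis unfolding t by simp
qed

text \<open>By partial summation both quantities are sums of S against differences, and subtraction
  leaves those of \<open>csch_err\<close>. Replacing S by S - c costs only boundary terms, since the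
  constant telescopes. The one at infinity vanishes; c is at most q and \<open>csch_err\<close> at
  1/X at most 1 / (2 X), which turns 12 into 13.\<close>

lemma kern_approx:
  assumes X: "X \<ge> real q" and V: "(\<lambda>d. lg d * kern X d) sums V"
  shows "\<bar>V - X / 2 * Re (L 1)\<bar> \<le> 13 * sqrt (real q)"
proof -
  have q0: "real q \<ge> 3" using q3 by simp
  have X0: "X > 0" using X q0 by linarith
  obtain a where a: "(\<Sum>b<q. \<bar>S b - S a\<bar>) \<le> real q * sqrt (real q)" by (rule ex_center)
  define c where "c = S a"
  define e where "e = (\<lambda>N. csch_err (real N / X))"
  have e_eq: "S N * (kern X N - kern X (Suc N)) - X / 2 * (S N * (1 / real N - 1 / real (Suc N))) = S N * (e N - e (Suc N))" for N
    by (simp add: e_def kern_def csch_err_def algebra_simps)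
  have lim: "(\<lambda>M. \<Sum>N<M. S N * (e N - e (Suc N))) \<longlonglongrightarrow> V - X / 2 * Re (L 1)"
  proof -
    have "(\<lambda>M. \<Sum>N<M. S N * (1 / real N - 1 / real (Suc N))) \<longlonglongrightarrow> Re (L 1)"
      using L_1_sums by (simp add: sums_def)
    then have "(\<lambda>M. (\<Sum>N<M. S N * (kern X N - kern X (Suc N))) - X / 2 * (\<Sum>N<M. S N * (1 / real N - 1 / real (Suc N)))) \<longlonglongrightarrow> V - X / 2 * Re (L 1)"
      by (intro tendsto_diff tendsto_mult tendsto_const kern_sum_tendsto[OF X0 V])
    then show ?thesis by (simp only: sum_distrib_left sum_subtractf[symmetric] e_eq)
  qed
  have e1: "\<bar>e (Suc 0)\<bar> \<le> 1 / (2 * X)"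
    using csch_err_bound_small[of "1 / X"] X q0 X0 by (simp add: e_def)
  have eM: "\<bar>e (Suc M)\<bar> \<le> (X / 2) / real (Suc M)" for M
    using csch_err_bound_large[of "real (Suc M) / X"] X0 by (simp add: e_def field_simps)
  have c_le: "\<bar>c\<bar> \<le> real q" unfolding c_def by (rule abs_S_le)
  have part: "\<bar>\<Sum>N<Suc M. S N * (e N - e (Suc N))\<bar> \<le> 12 * sqrt (real q) + real q * (1 / (2 * X)) + real q * (X / 2) / real (Suc M)" for M
  proof -
    have tel: "(\<Sum>N=1..M. e N - e (Suc N)) = e (Suc 0) - e (Suc M)" by (induction M) auto
    have "(\<Sum>N<Suc M. S N * (e N - e (Suc N))) = (\<Sum>N=1..M. S N * (e N - e (Suc N)))"
      by (intro sum.mono_neutral_right) (auto simp: not_le)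
    also have "\<dots> = (\<Sum>N=1..M. (S N - c) * (e N - e (Suc N)) + c * (e N - e (Suc N)))"
      by (intro sum.cong) (auto simp: algebra_simps)
    also have "\<dots> = (\<Sum>N=1..M. (S N - c) * (e N - e (Suc N))) + c * (e (Suc 0) - e (Suc M))"
      by (simp only: sum.distrib sum_distrib_left[symmetric] tel)
    finally have eq: "(\<Sum>N<Suc M. S N * (e N - e (Suc N))) = (\<Sum>N=1..M. (S N - c) * (e N - e (Suc N))) + c * (e (Suc 0) - e (Suc M))" .
    have "\<bar>\<Sum>N=1..M. (S N - c) * (e N - e (Suc N))\<bar> \<le> (\<Sum>N=1..M. \<bar>S N - c\<bar> * (6 * X / (X + real N)\<^sup>2))"
    proof (rule order.trans[OF sum_abs], intro sum_mono)
      fix N assume "N \<in> {1..M}"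
      then show "\<bar>(S N - c) * (e N - e (Suc N))\<bar> \<le> \<bar>S N - c\<bar> * (6 * X / (X + real N)\<^sup>2)"
        unfolding abs_mult e_def using X0 by (intro mult_left_mono csch_err_step) auto
    qed
    also have "\<dots> \<le> (\<Sum>N<Suc M * q. \<bar>S N - c\<bar> * (6 * X / (X + real N)\<^sup>2))"
    proof (rule sum_mono2)
      have "Suc M * 1 \<le> Suc M * q" using q3 by (intro mult_left_mono) auto
      then show "{1..M} \<subseteq> {..<Suc M * q}" by auto
    qed (use X0 in auto)
    also have "\<dots> \<le> 12 * sqrt (real q)" using a by (intro weighted_sum_le X) (simp add: c_def)
    finally have 1: "\<bar>\<Sum>N=1..M. (S N - c) * (e N - e (Suc N))\<bar> \<le> 12 * sqrt (real q)" .
    have "\<bar>c * (e (Suc 0) - e (Suc M))\<bar> \<le> real q * (1 / (2 * X) + (X / 2) / real (Suc M))"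
      unfolding abs_mult using c_le e1 eM[of M] by (intro mult_mono) linarith+
    then show ?thesis unfolding eq using 1 by (simp add: algebra_simps)
  qed
  have "(\<lambda>M. 12 * sqrt (real q) + real q * (1 / (2 * X)) + real q * (X / 2) / real (Suc M)) \<longlonglongrightarrow> 12 * sqrt (real q) + real q * (1 / (2 * X)) + 0"
    by (intro tendsto_add tendsto_const inv_seq_tendsto_0)
  moreover have "(\<lambda>M. \<bar>\<Sum>N<Suc M. S N * (e N - e (Suc N))\<bar>) \<longlonglongrightarrow> \<bar>V - X / 2 * Re (L 1)\<bar>"
    using LIMSEQ_Suc[OF lim] by (rule tendsto_rabs)
  ultimately have "\<bar>V - X / 2 * Re (L 1)\<bar> \<le> 12 * sqrt (real q) + real q * (1 / (2 * X)) + 0"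
    using part by (intro LIMSEQ_le[of "\<lambda>M. \<bar>\<Sum>N<Suc M. S N * (e N - e (Suc N))\<bar>"]) auto
  also have "real q * (1 / (2 * X)) \<le> 1" using X X0 by (simp add: field_simps)
  also have "1 \<le> sqrt (real q)" using q0 by simp
  finally show ?thesis by simp
qed


text \<open>The same absolutely convergent double sum is evaluated by rows, which gives
  \<open>kern\<close>, and by products n = ab, which gives \<open>divsum\<close>. Convergence
  follows from \<open>kern X a\<close> <= z^a / (1 - z) with z = exp(-1/X).\<close>

lemma V_exists:
  assumes X: "X > 0"
  obtains V where "(\<lambda>d. lg d * kern X d) sums V"
    "(\<lambda>n. divsum n * (exp (- (real n / X)) - exp (- (2 * (real n / X))))) sums V"
proof -
  define ph where "ph = (\<lambda>t::real. exp (- (t / X)) - exp (- (2 * (t / X))))"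
  define F where "F = (\<lambda>a b. complex_of_real (lg a * ph (real (a * b))))"
  define z where "z = exp (- (1 / X))"
  have z: "0 < z" "z < 1" using X by (auto simp: z_def)
  have ph_nonneg: "ph t \<ge> 0" if "t \<ge> 0" for t using that X by (simp add: ph_def divide_right_mono)
  have geo: "(\<lambda>m. ph (real (a * Suc m))) sums kern X a" if "a \<ge> 1" for a
  proof -
    have "real (a * Suc m) / X = real (Suc m) * (real a / X)" for m by (simp add: algebra_simps)
    then have "ph (real (a * Suc m)) = exp (- (real (Suc m) * (real a / X))) - exp (- (2 * (real (Suc m) * (real a / X))))" for m
      unfolding ph_def by (simp only:)
    moreover have "real a / X > 0" using X that by simp
    ultimately show ?thesis unfolding kern_def by (simp only: exp_geometric_sums)
  qed
  have inner: "((\<lambda>b. ph (real (a * b))) has_sum kern X a) {1..}" if "a \<ge> 1" for a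
  proof -
    have "(\<lambda>m. ph (real (a * Suc m))) sums kern X a" using that by (rule geo)
    then have "((\<lambda>m. ph (real (a * Suc m))) has_sum kern X a) UNIV"
      by (intro sums_nonneg_imp_has_sum) (auto intro: ph_nonneg)
    moreover have "bij_betw Suc UNIV {1..}"
      by (rule bij_betwI[where g = "\<lambda>n. n - 1"]) auto
    ultimately show ?thesis using has_sum_reindex_bij_betw[of Suc UNIV "{1..}" "\<lambda>b. ph (real (a * b))"] by simp
  qed
  have kern_nonneg: "kern X a \<ge> 0" if "a \<ge> 1" for a using inner[OF that] ph_nonneg by (intro has_sum_nonneg[OF inner[OF that]]) auto
  have kern_geo: "kern X a \<le> z ^ a / (1 - z)" if a: "a \<ge> 1" for a
  proof -
    have "(\<lambda>m. ph (real (a * Suc m))) sums kern X a" using a by (rule geo)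
    moreover have "(\<lambda>m. z ^ a * z ^ m) sums (z ^ a * (1 / (1 - z)))" using z by (intro sums_mult geometric_sums) auto
    moreover have "ph (real (a * Suc m)) \<le> z ^ a * z ^ m" for m
    proof -
      have "ph (real (a * Suc m)) \<le> exp (- (real (a * Suc m) / X))" by (simp add: ph_def)
      also have "\<dots> = z ^ (a * Suc m)" unfolding z_def exp_of_nat_mult[symmetric] by simp
      also have "\<dots> \<le> z ^ (a + m)" using z a by (intro power_decreasing) (auto simp: Suc_le_eq intro: add_mono)
      finally show ?thesis by (simp add: power_add)
    qed
    ultimately show ?thesis using sums_le[of "\<lambda>m. ph (real (a * Suc m))"] by fastforce
  qed
  have outer: "(\<lambda>a. norm (lg a) * kern X a) summable_on {1..}"
  proof -
    have "summable (\<lambda>a. z ^ a * (1 / (1 - z)))" using z by (intro summable_mult2 summable_geometric) auto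
    then have "(\<lambda>a. z ^ a * (1 / (1 - z))) summable_on {1..}"
      using z by (intro summable_on_subset[of _ UNIV "{1..}"] norm_summable_imp_summable_on) (auto simp: abs_mult)
    then show ?thesis
    proof (rule summable_on_comparison_test)
      fix a :: nat assume "a \<in> {1..}"
      then have a: "a \<ge> 1" by simp
      show "norm (lg a) * kern X a \<ge> 0" using kern_nonneg[OF a] by simp
      have "norm (lg a) * kern X a \<le> 1 * kern X a"
        using abs_lg_le[of a] kern_nonneg[OF a] by (intro mult_right_mono) auto
      then show "norm (lg a) * kern X a \<le> z ^ a * (1 / (1 - z))" using kern_geo[OF a] by simp
    qed
  qed
  have normF: "norm (F a b) = norm (lg a) * ph (real (a * b))" for a b
    using ph_nonneg[of "real (a * b)"] by (simp add: F_def norm_mult)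
  have abs: "(\<lambda>(a,b). norm (F a b)) summable_on ({1..} \<times> {1..})"
  proof -
    have hs: "((\<lambda>b. norm (F a b)) has_sum norm (lg a) * kern X a) {1..}" if "a \<in> {1..}" for a
      unfolding normF using that by (intro has_sum_cmult_right inner) auto
    have "(\<lambda>x. norm (F (fst x) (snd x))) summable_on ({1..} \<times> {1..})"
      unfolding Infinite_Sum.abs_summable_on_Sigma_iff
    proof (intro conjI ballI)
      fix a :: nat assume a: "a \<in> {1..}"
      show "(\<lambda>y. norm (F (fst (a, y)) (snd (a, y)))) summable_on {1..}"
        using has_sum_imp_summable[OF hs[OF a]] by simp
    next
      have "(\<lambda>a. norm (norm (lg a) * kern X a)) summable_on {1..}"
        using outer by (rule summable_on_cong[THEN iffD1, rotated]) (use kern_nonneg in \<open>auto simp: abs_mult\<close>)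
      then show "(\<lambda>a. norm (\<Sum>\<^sub>\<infinity>y\<in>{1..}. norm (F (fst (a, y)) (snd (a, y))))) summable_on {1..}"
      proof (rule summable_on_cong[THEN iffD1, rotated])
        fix a :: nat assume "a \<in> {1..}"
        from infsumI[OF hs[OF this]]
        show "norm (norm (lg a) * kern X a) = norm (\<Sum>\<^sub>\<infinity>y\<in>{1..}. norm (F (fst (a, y)) (snd (a, y))))"
          by (simp only: fst_conv snd_conv)
      qed
    qed
    then show ?thesis by (simp add: case_prod_unfold)
  qed
  define W where "W = (\<Sum>\<^sub>\<infinity>(a,b)\<in>{1..} \<times> {1..}. F a b)"
  have sumF: "(\<lambda>(a,b). F a b) summable_on ({1..} \<times> {1..})"
    using abs_summable_summable[of "\<lambda>(a,b). F a b"] abs by (simp add: case_prod_unfold)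
  have "((\<lambda>(a,b). F a b) has_sum W) ({1..} \<times> {1..})" unfolding W_def using sumF by (rule has_sum_infsum)
  then have "((\<lambda>a. complex_of_real (lg a * kern X a)) has_sum W) {1..}"
  proof (rule has_sum_Sigma')
    fix a :: nat assume a: "a \<in> {1..}"
    have "((\<lambda>b. complex_of_real (lg a * ph (real (a * b)))) has_sum complex_of_real (lg a * kern X a)) {1..}"
      using a by (intro has_sum_of_real has_sum_cmult_right inner) auto
    then show "((\<lambda>b. case (a, b) of (a, b) \<Rightarrow> F a b) has_sum complex_of_real (lg a * kern X a)) {1..}"
      by (simp add: F_def)
  qed
  then have s1: "(\<lambda>a. complex_of_real (lg a * kern X a)) sums W"
    by (rule has_sum_imp_sums_from_1) (simp add: lg_zero)
  have "((\<lambda>n. \<Sum>d | d dvd n. F d (n div d)) has_sum W) {1..}"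
    unfolding W_def by (rule has_sum_divisor_pairs[OF abs])
  then have "((\<lambda>n. complex_of_real (divsum n * ph (real n))) has_sum W) {1..}"
  proof (rule has_sum_cong[THEN iffD1, rotated])
    fix n :: nat
    have "(\<Sum>d | d dvd n. F d (n div d)) = (\<Sum>d | d dvd n. complex_of_real (lg d * ph (real n)))"
    proof (intro sum.cong refl)
      fix d assume "d \<in> {d. d dvd n}"
      then have "d * (n div d) = n" by simp
      then show "F d (n div d) = complex_of_real (lg d * ph (real n))" unfolding F_def by (simp only:)
    qed
    then show "(\<Sum>d | d dvd n. F d (n div d)) = complex_of_real (divsum n * ph (real n))"
      by (simp add: divsum_def sum_distrib_right)
  qed
  then have s2: "(\<lambda>n. complex_of_real (divsum n * ph (real n))) sums W"
    by (rule has_sum_imp_sums_from_1) (simp add: ph_def)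
  show ?thesis
    by (rule that[of "Re W"]) (use sums_Re[OF s1] sums_Re[OF s2] in \<open>simp_all add: ph_def\<close>)
qed

text \<open>For J <= n <= 2 J the ratio n^2 / X lies between 1/4 and 1, so these squares contribute
  at least J / 15, and 210 = 15 * 14 makes this 14 sqrt q. The approximation error is 13 sqrt q, so
  X L(1) / 2 >= sqrt q, while X / 2 <= 352800 q.\<close>

lemma Re_L_1_ge: "Re (L 1) \<ge> 1 / (352800 * sqrt (real q))"
proof -
  have q0: "real q \<ge> 3" using q3 by simp
  define J where "J = 210 * nat \<lceil>sqrt (real q)\<rceil>"
  have J1: "210 * sqrt (real q) \<le> real J" unfolding J_def by simp
  have J2: "real J \<le> 420 * sqrt (real q)"
  proof -
    have "1 \<le> sqrt (real q)" using q0 by simp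
    moreover have "real (nat \<lceil>sqrt (real q)\<rceil>) = of_int \<lceil>sqrt (real q)\<rceil>" by simp
    moreover have "of_int \<lceil>sqrt (real q)\<rceil> \<le> sqrt (real q) + 1" by (rule of_int_ceiling_le_add_one)
    ultimately have "real (nat \<lceil>sqrt (real q)\<rceil>) \<le> 2 * sqrt (real q)" by linarith
    then show ?thesis by (simp add: J_def)
  qed
  have J0: "real J > 0" using J1 q0 by (smt (verit) real_sqrt_gt_zero)
  define X where "X = 4 * real J ^ 2"
  have sq: "(sqrt (real q))\<^sup>2 = real q" by simp
  have "real q \<le> (210 * sqrt (real q))\<^sup>2" using q0 by (simp add: power_mult_distrib)
  also have "\<dots> \<le> real J ^ 2" using J1 by (intro power_mono) auto
  also have "\<dots> \<le> X" by (simp add: X_def)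
  finally have Xq: "real q \<le> X" .
  have X0: "X > 0" using J0 by (simp add: X_def)
  obtain V where V: "(\<lambda>d. lg d * kern X d) sums V"
    "(\<lambda>n. divsum n * (exp (- (real n / X)) - exp (- (2 * (real n / X))))) sums V"
    using V_exists[OF X0] by blast
  define w where "w = (\<lambda>n. divsum n * (exp (- (real n / X)) - exp (- (2 * (real n / X)))))"
  have w_nonneg: "w n \<ge> 0" for n
    using divsum_nonneg[of n] X0 by (cases "n = 0") (auto simp: w_def divide_right_mono)
  have "real J / 15 \<le> (\<Sum>n\<in>{J..2 * J}. 1 / 15 :: real)" by simp
  also have "\<dots> \<le> (\<Sum>n\<in>{J..2 * J}. w (n ^ 2))"
  proof (rule sum_mono)
    fix n assume n: "n \<in> {J..2 * J}"
    then have n0: "n > 0" using J0 by auto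
    have "real J \<le> real n" "real n \<le> 2 * real J" using n by auto
    then have "real n ^ 2 \<ge> real J ^ 2" "real n ^ 2 \<le> (2 * real J) ^ 2" by (intro power_mono; simp)+
    then have "1 / 4 \<le> real (n ^ 2) / X" "real (n ^ 2) / X \<le> 1"
      using J0 by (auto simp: X_def field_simps power_mult_distrib)
    then have "1 / 15 \<le> exp (- (real (n ^ 2) / X)) - exp (- (2 * (real (n ^ 2) / X)))" by (rule exp_diff_lower)
    then show "1 / 15 \<le> w (n ^ 2)"
      using divsum_square_ge[OF n0] mult_mono[of 1 "divsum (n ^ 2)" "1/15"] by (simp add: w_def)
  qed
  also have "\<dots> = sum w ((\<lambda>n. n ^ 2) ` {J..2 * J})"
    by (subst sum.reindex) (auto intro!: inj_onI)
  also have "\<dots> \<le> V"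
    using V(2) w_nonneg unfolding w_def[symmetric]
    by (metis finite_atLeastAtMost finite_imageI sum_le_suminf sums_iff)
  finally have "real J / 15 \<le> V" .
  then have "X / 2 * Re (L 1) \<ge> real J / 15 - 13 * sqrt (real q)"
    using kern_approx[OF Xq V(1)] by linarith
  then have "X / 2 * Re (L 1) \<ge> sqrt (real q)" using J1 by linarith
  then have "Re (L 1) \<ge> sqrt (real q) / (X / 2)" using X0 by (simp add: field_simps)
  moreover have "sqrt (real q) / (X / 2) \<ge> 1 / (352800 * sqrt (real q))"
  proof -
    have "X / 2 \<le> 2 * (420 * sqrt (real q))\<^sup>2" unfolding X_def using J2 J0 power_mono[OF J2, of 2] by simp
    also have "\<dots> = 352800 * real q" by (simp add: power_mult_distrib)
    finally have "sqrt (real q) / (X / 2) \<ge> sqrt (real q) / (352800 * real q)"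
      using X0 q0 by (intro divide_left_mono) auto
    also have "sqrt (real q) / (352800 * real q) = 1 / (352800 * sqrt (real q))"
      using q0 by (simp add: field_simps)
    finally show ?thesis .
  qed
  ultimately show ?thesis by linarith
qed

lemma L_1_nonzero: "L 1 \<noteq> 0"
proof
  assume "L 1 = 0"
  then have "1 / (352800 * sqrt (real q)) \<le> 0" using Re_L_1_ge by simp
  then show False using q3 by (simp add: divide_le_0_iff)
qed

text \<open>The constant is 52 * 352800: the derivative bound over the lower bound for L(1).\<close>

lemma norm_log_deriv_L_1: "norm (deriv L 1 / L 1) \<le> 18345600 * (sqrt (real q) * ln (real q) ^ 2)"
proof -
  have q0: "sqrt (real q) > 0" using q3 by simp
  have "1 / (352800 * sqrt (real q)) \<le> norm (L 1)" using Re_L_1_ge complex_Re_le_cmod[of "L 1"] by linarith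
  moreover have "norm (deriv L 1) \<le> 52 * ln (real q) ^ 2" using ln_q_ge_1 by (intro norm_deriv_L_le) auto
  ultimately have "norm (deriv L 1 / L 1) \<le> (52 * ln (real q) ^ 2) / (1 / (352800 * sqrt (real q)))"
    unfolding norm_divide using q0 by (intro frac_le) auto
  then show ?thesis by (simp add: mult_ac)
qed

end

section \<open>Third differences of logarithmic derivatives\<close>

text \<open>The radius \<open>rho\<close> written without its locale; it depends on q alone, so one
  eta serves all characters.\<close>

definition char_rho :: "nat \<Rightarrow> real" where "char_rho q = 1 / 104 ^ 5 / 2 / ln (real q) ^ 9"

abbreviation char_log_deriv :: "(nat \<Rightarrow> complex) \<Rightarrow> real \<Rightarrow> complex" where
  "char_log_deriv ch x \<equiv> ds (\<lambda>n. of_real (mangoldt n) * ch n) (of_real x)"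

lemma (in prime_character) char_log_deriv_eq:
  assumes "x > 1" "L (of_real x) \<noteq> 0"
  shows "char_log_deriv ch x = - (deriv L (of_real x) / L (of_real x))"
  using deriv_L_eq[of "of_real x"] assms by (simp add: field_simps)

lemma (in prime_character) char_log_deriv_tendsto:
  assumes "L 1 \<noteq> 0"
  shows "(char_log_deriv ch \<longlongrightarrow> - (deriv L 1 / L 1)) (at_right 1)"
proof -
  have op: "open {s::complex. Re s > 0}" by (rule open_halfspace_Re_gt)
  have c1: "isCont L 1"
    using holomorphic_on_imp_continuous_on[OF L_holomorphic] op by (simp add: continuous_on_eq_continuous_at)
  have c2: "isCont (deriv L) 1"
    using holomorphic_on_imp_continuous_on[OF holomorphic_deriv[OF L_holomorphic op]] op
    by (simp add: continuous_on_eq_continuous_at)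
  have of_real: "((\<lambda>x::real. complex_of_real x) \<longlongrightarrow> 1) (at_right 1)"
    using tendsto_of_real[OF tendsto_ident_at[of 1 "{1<..}"]] by simp
  have l1: "((\<lambda>x. L (of_real x)) \<longlongrightarrow> L 1) (at_right 1)" by (rule isCont_tendsto_compose[OF c1 of_real])
  have l2: "((\<lambda>x. deriv L (of_real x)) \<longlongrightarrow> deriv L 1) (at_right 1)" by (rule isCont_tendsto_compose[OF c2 of_real])
  have "((\<lambda>x. - (deriv L (of_real x) / L (of_real x))) \<longlongrightarrow> - (deriv L 1 / L 1)) (at_right 1)"
    by (intro tendsto_intros l1 l2 assms)
  moreover have "\<forall>\<^sub>F x in at_right 1. L (of_real x) \<noteq> 0"
    using l1 assms by (rule tendsto_imp_eventually_ne)
  then have "\<forall>\<^sub>F x in at_right 1. - (deriv L (of_real x) / L (of_real x)) = char_log_deriv ch x"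
    using eventually_at_right_1_2
    by eventually_elim (use char_log_deriv_eq in auto)
  ultimately show ?thesis by (rule Lim_transform_eventually)
qed

text \<open>Phrased through the Dirichlet series and its limit at 1, so that the results for all
  members of the family can be added outside the locale of a single character.\<close>

lemma complex_character_limit:
  assumes "complex_prime_character ch q"
  shows "\<exists>l. (char_log_deriv ch \<longlongrightarrow> l) (at_right 1) \<and>
    (\<forall>\<eta>>0. 6 * \<eta> \<le> char_rho q \<longrightarrow>
       norm (char_log_deriv ch (1 + 3 * \<eta>) - 3 * char_log_deriv ch (1 + 2 * \<eta>) + 3 * char_log_deriv ch (1 + \<eta>) - l)
         \<le> 10368 * \<eta> ^ 3 / char_rho q ^ 4)"
proof -
  interpret complex_prime_character ch q by fact
  have rho: "rho = char_rho q" by (simp add: rho_def char_rho_def a0_def)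
  let ?f = "\<lambda>s. deriv L s / L s"
  have "L 1 \<noteq> 0" using rho_pos by (intro L_nonzero_near_1) simp
  moreover have "norm (char_log_deriv ch (1 + 3 * \<eta>) - 3 * char_log_deriv ch (1 + 2 * \<eta>) + 3 * char_log_deriv ch (1 + \<eta>) - (- ?f 1))
         \<le> 10368 * \<eta> ^ 3 / char_rho q ^ 4" if \<eta>: "\<eta> > 0" "6 * \<eta> \<le> char_rho q" for \<eta>
  proof -
    have eq: "char_log_deriv ch (1 + c * \<eta>) = - ?f (of_real (1 + c * \<eta>))" if "c > 0" "c \<le> 3" for c
    proof (rule char_log_deriv_eq)
      have "c * \<eta> \<le> 3 * \<eta>" using that \<eta> by (intro mult_right_mono) auto
      then have le: "c * \<eta> \<le> rho" using \<eta> rho by linarith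
      have pos: "c * \<eta> > 0" using that \<eta> by simp
      have "norm (complex_of_real (1 + c * \<eta>) - 1) = \<bar>c * \<eta>\<bar>"
        by (metis add_diff_cancel_left' norm_of_real of_real_1 of_real_diff)
      then show "L (of_real (1 + c * \<eta>)) \<noteq> 0"
        using le pos by (intro L_nonzero_near_1) linarith
      show "1 + c * \<eta> > 1" using pos by simp
    qed
    have "char_log_deriv ch (1 + 3 * \<eta>) - 3 * char_log_deriv ch (1 + 2 * \<eta>) + 3 * char_log_deriv ch (1 + \<eta>) - (- ?f 1) =
       - (?f (of_real (1 + 3 * \<eta>)) - 3 * ?f (of_real (1 + 2 * \<eta>)) + 3 * ?f (of_real (1 + \<eta>)) - ?f 1)"
      using eq[of 3] eq[of 2] eq[of 1] by (simp only: mult_1) (simp add: algebra_simps)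
    then show ?thesis
      using log_deriv_third_difference[of \<eta>] \<eta> by (simp only: rho norm_minus_cancel)
  qed
  ultimately show ?thesis using char_log_deriv_tendsto by blast
qed

lemma real_character_limit:
  assumes "real_prime_character ch q"
  shows "\<exists>l. (char_log_deriv ch \<longlongrightarrow> l) (at_right 1) \<and> norm l \<le> 18345600 * (sqrt (real q) * ln (real q) ^ 2)"
proof -
  interpret real_prime_character ch q by fact
  show ?thesis
    using char_log_deriv_tendsto[OF L_1_nonzero] norm_log_deriv_L_1
    by (intro exI[of _ "- (deriv L 1 / L 1)"]) simp
qed

lemma norm_ds_le_rzeta_ln:
  assumes x: "x > 1" and f: "\<And>n. n > 0 \<Longrightarrow> norm (f n) \<le> ln (real n)"
  shows "norm (ds f (of_real x)) \<le> rzeta_ln x"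
proof -
  have sm: "(\<lambda>n. ln (real n) * real n powr (- x)) sums rzeta_ln x"
    using sums_Suc_imp[of "\<lambda>n. ln (real n) * real n powr (- x)"] summable_sums[OF summable_rzeta_ln[OF x]]
    by (simp add: rzeta_ln_def)
  have "norm (ds f (of_real x)) \<le> (\<Sum>n. ln (real n) * real n powr (- x))"
    unfolding ds_def
  proof (rule norm_suminf_le)
    show "norm (f n * of_nat n powr (- of_real x)) \<le> ln (real n) * real n powr (- x)" for n
      using f[of n] by (cases "n = 0") (auto simp: norm_mult norm_of_nat_powr_minus intro: mult_right_mono)
  qed (use sm in \<open>simp add: sums_iff\<close>)
  then show ?thesis using sm by (simp add: sums_iff)
qed

lemma ds_0: "ds (\<lambda>n. 0) s = 0" by (simp add: ds_def)

lemma ds_sum: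
  assumes "finite I" "\<And>i. i \<in> I \<Longrightarrow> subpoly (f i)" "Re s > 1"
  shows "ds (\<lambda>n. \<Sum>i\<in>I. f i n) s = (\<Sum>i\<in>I. ds (f i) s) \<and> subpoly (\<lambda>n. \<Sum>i\<in>I. f i n)"
  using assms(1,2)
proof (induction I rule: finite_induct)
  case empty
  then show ?case using subpoly_bounded[of "\<lambda>_. 0" 0] by (simp add: ds_0)
next
  case (insert i I)
  then show ?case using ds_add[of "f i" "\<lambda>n. \<Sum>i\<in>I. f i n" s] subpoly_add[of "f i" "\<lambda>n. \<Sum>i\<in>I. f i n"] assms(3)
    by simp
qed

context character_family
begin

text \<open>The value 1/m at multiples of q makes the term 1 in the character expansion below replace the
  principal character.\<close>
definition ht :: "nat \<Rightarrow> real" where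
  "ht n = (if q dvd n then 1 / real m else if q dvd n ^ r + 1 then 1 else 0)"

lemma ht_nonneg: "ht n \<ge> 0" and ht_le_1: "ht n \<le> 1"
  using m_pos by (auto simp: ht_def field_simps)

lemma ht_eq: "complex_of_real (ht n) = (1 / of_nat m) * (1 + (\<Sum>i\<in>{1..<m}. (-1) ^ i * chi i n))"
proof (cases "q dvd n")
  case True
  then show ?thesis by (simp add: ht_def chi_def)
next
  case False
  have "{..<m} = insert 0 {1..<m}" using m_pos by auto
  then have "(\<Sum>i<m. (-1) ^ i * chi i n) = chi 0 n + (\<Sum>i\<in>{1..<m}. (-1) ^ i * chi i n)" by simp
  moreover have "chi 0 n = 1" using False by (simp add: chi_def)
  ultimately show ?thesis using orthogonality[OF False] False m_pos by (auto simp: ht_def)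
qed

lemma ds_ht:
  assumes "x > 1"
  shows "ds (\<lambda>n. of_real (mangoldt n * ht n)) (of_real x) =
    (1 / of_nat m) * (ds mangoldt (of_real x) + (\<Sum>i\<in>{1..<m}. (-1) ^ i * char_log_deriv (chi i) x))"
proof -
  have Re: "Re (of_real x) > 1" using assms by simp
  let ?g = "\<lambda>i n. (-1) ^ i * (of_real (mangoldt n) * chi i n)"
  have sg0: "subpoly (\<lambda>n. of_real (mangoldt n) * chi i n)" if "i \<in> {1..<m}" for i
  proof -
    interpret prime_character "chi i" q using that by (intro prime_character_chi) auto
    show ?thesis by (rule subpoly_mangoldt_ch)
  qed
  have sg: "subpoly (?g i)" if "i \<in> {1..<m}" for i
    using subpoly_mult[OF subpoly_bounded[of "\<lambda>_. (-1) ^ i" 1] sg0[OF that]] by (simp add: norm_power)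
  have eq: "of_real (mangoldt n * ht n) = (1 / of_nat m) * (mangoldt n + (\<Sum>i\<in>{1..<m}. ?g i n))" for n
    by (simp only: of_real_mult ht_eq) (simp add: sum_distrib_left algebra_simps)
  have sgs: "ds (\<lambda>n. \<Sum>i\<in>{1..<m}. ?g i n) (of_real x) = (\<Sum>i\<in>{1..<m}. ds (?g i) (of_real x))"
    "subpoly (\<lambda>n. \<Sum>i\<in>{1..<m}. ?g i n)"
    using ds_sum[of "{1..<m}" ?g, OF _ sg Re] by auto
  have sm: "subpoly mangoldt" using subpoly_mangoldt by simp
  have "ds (\<lambda>n. of_real (mangoldt n * ht n)) (of_real x) = (1 / of_nat m) * ds (\<lambda>n. mangoldt n + (\<Sum>i\<in>{1..<m}. ?g i n)) (of_real x)"
    unfolding eq by (rule ds_cmult[OF subpoly_add[OF sm sgs(2)] Re])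
  also have "ds (\<lambda>n. mangoldt n + (\<Sum>i\<in>{1..<m}. ?g i n)) (of_real x) = ds mangoldt (of_real x) + (\<Sum>i\<in>{1..<m}. ds (?g i) (of_real x))"
    using ds_add[OF sm sgs(2) Re] sgs(1) by simp
  also have "(\<Sum>i\<in>{1..<m}. ds (?g i) (of_real x)) = (\<Sum>i\<in>{1..<m}. (-1) ^ i * char_log_deriv (chi i) x)"
    by (intro sum.cong refl ds_cmult sg0 Re)
  finally show ?thesis .
qed

text \<open>The limit l stands in for the value at 1, which the series does not provide.\<close>

definition third_diff :: "(real \<Rightarrow> complex) \<Rightarrow> complex \<Rightarrow> real \<Rightarrow> complex" where
  "third_diff F l \<eta> = F (1 + 3 * \<eta>) - 3 * F (1 + 2 * \<eta>) + 3 * F (1 + \<eta>) - l"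

lemma norm_third_diff_le:
  assumes "\<And>c. c \<in> {1, 2, 3} \<Longrightarrow> norm (F (1 + c * \<eta>)) \<le> B"
  shows "norm (third_diff F l \<eta>) \<le> 7 * B + norm l"
proof -
  have "norm (a - 3 * b + 3 * c - d) \<le> norm a + 3 * norm b + 3 * norm c + norm d" for a b c d :: complex
    using norm_triangle_ineq4[of "a - 3 * b + 3 * c" d] norm_triangle_ineq[of "a - 3 * b" "3 * c"]
      norm_triangle_ineq4[of a "3 * b"] by (simp add: norm_mult)
  from this[of "F (1 + 3 * \<eta>)" "F (1 + 2 * \<eta>)" "F (1 + \<eta>)" l] show ?thesis
    unfolding third_diff_def using assms[of 1] assms[of 2] assms[of 3] by simp
qed

text \<open>With F the series minus its pole, the limit l0 equals F(1 + 3 eta) - 3 F(1 + 2 eta) + 3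
  F(1 + eta), bounded through B, minus the third difference of F, which is bounded character by
  character. The zeta part is estimated by size alone: each value is at most 2, so 7 * 2 + 1 =
  15.\<close>

lemma ht_limit:
  assumes \<epsilon>: "\<And>x. 1 < x \<Longrightarrow> x < 1 + \<epsilon> \<Longrightarrow> norm (of_real (1 / (x - 1)) - ds mangoldt (of_real x)) \<le> 2"
    and M: "\<And>s. s > 1 \<Longrightarrow> s \<le> 2 \<Longrightarrow> \<bar>rzeta_ln s - 1 / (s - 1)\<^sup>2\<bar> \<le> M"
    and \<eta>: "\<eta> > 0" "6 * \<eta> \<le> char_rho q" "3 * \<eta> < \<epsilon>" "3 * \<eta> \<le> 1"
    and B: "\<And>x. x \<ge> 1 + \<eta> \<Longrightarrow> norm (ds (\<lambda>n. of_real (mangoldt n * ht n)) (of_real x)) \<le> B"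
  shows "\<exists>l. ((\<lambda>x. ds (\<lambda>n. of_real (mangoldt n * ht n)) (of_real x) - of_real (1 / real m / (x - 1))) \<longlongrightarrow> l) (at_right 1) \<and>
     norm l \<le> 7 * (B + 1 / (real m * \<eta>)) + (1 / real m) * (15 + 10368 * real m * \<eta> ^ 3 / char_rho q ^ 4
        + (7 * (1 / \<eta>\<^sup>2 + M) + 18345600 * (sqrt (real q) * ln (real q) ^ 2)))"
proof -
  define P where "P = (\<lambda>i l. (char_log_deriv (chi i) \<longlongrightarrow> l) (at_right 1) \<and>
     norm (third_diff (char_log_deriv (chi i)) l \<eta>) \<le>
       (if 2 * i = m then 7 * (1 / \<eta>\<^sup>2 + M) + 18345600 * (sqrt (real q) * ln (real q) ^ 2) else 10368 * \<eta> ^ 3 / char_rho q ^ 4))"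
  have ex: "\<exists>l. (char_log_deriv (chi i) \<longlongrightarrow> l) (at_right 1) \<and>
     norm (third_diff (char_log_deriv (chi i)) l \<eta>) \<le>
       (if 2 * i = m then 7 * (1 / \<eta>\<^sup>2 + M) + 18345600 * (sqrt (real q) * ln (real q) ^ 2) else 10368 * \<eta> ^ 3 / char_rho q ^ 4)"
    if i: "i \<in> {1..<m}" for i
  proof (cases "2 * i = m")
    case False
    then have "complex_prime_character (chi i) q" using i by (intro complex_prime_character_chi) auto
    from complex_character_limit[OF this] show ?thesis
      using \<eta> False unfolding third_diff_def by auto
  next
    \<comment> \<open>For the quadratic character no disc around 1 without zeros of L is at hand, so
      its values at 1 + c eta are bounded trivially by -zeta' there. A single character can afford
      this loss.\<close>
    case True
    interpret real_prime_character "chi i" q using True by (rule real_prime_character_chi)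
    obtain l where l: "(char_log_deriv (chi i) \<longlongrightarrow> l) (at_right 1)"
      "norm l \<le> 18345600 * (sqrt (real q) * ln (real q) ^ 2)"
      using real_character_limit[OF real_prime_character_axioms] by blast
    have "norm (third_diff (char_log_deriv (chi i)) l \<eta>) \<le> 7 * (1 / \<eta>\<^sup>2 + M) + norm l"
    proof (rule norm_third_diff_le)
      fix c :: real assume c: "c \<in> {1, 2, 3}"
      have c2: "c * \<eta> \<ge> \<eta>" "c * \<eta> \<le> 1" using c \<eta> by auto
      have "norm (char_log_deriv (chi i) (1 + c * \<eta>)) \<le> rzeta_ln (1 + c * \<eta>)"
      proof (rule norm_ds_le_rzeta_ln)
        fix n :: nat assume "n > 0"
        have "norm (of_real (mangoldt n) * chi i n) \<le> mangoldt n * 1"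
          using mult_left_mono[OF norm_le[of n], of "mangoldt n"] by (simp add: norm_mult mangoldt_nonneg)
        then show "norm (of_real (mangoldt n) * chi i n) \<le> ln (real n)" using mangoldt_le[OF \<open>n > 0\<close>] by simp
      qed (use c2 \<eta> in auto)
      also have "\<dots> \<le> 1 / (c * \<eta>)\<^sup>2 + M" using M[of "1 + c * \<eta>"] c2 \<eta> by auto
      also have "1 / (c * \<eta>)\<^sup>2 \<le> 1 / \<eta>\<^sup>2" using c2 \<eta> by (intro divide_left_mono power_mono) auto
      finally show "norm (char_log_deriv (chi i) (1 + c * \<eta>)) \<le> 1 / \<eta>\<^sup>2 + M" by simp
    qed
    then show ?thesis using l True by (intro exI[of _ l]) auto
  qed
  obtain l where l: "\<And>i. i \<in> {1..<m} \<Longrightarrow> (char_log_deriv (chi i) \<longlongrightarrow> l i) (at_right 1)"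
    "\<And>i. i \<in> {1..<m} \<Longrightarrow> norm (third_diff (char_log_deriv (chi i)) (l i) \<eta>) \<le>
       (if 2 * i = m then 7 * (1 / \<eta>\<^sup>2 + M) + 18345600 * (sqrt (real q) * ln (real q) ^ 2) else 10368 * \<eta> ^ 3 / char_rho q ^ 4)"
  proof -
    have "\<forall>i\<in>{1..<m}. \<exists>l. P i l" unfolding P_def using ex by blast
    from bchoice[OF this] obtain l where "\<forall>i\<in>{1..<m}. P i (l i)" by blast
    then show ?thesis using that[of l] unfolding P_def by blast
  qed
  define Z where "Z = (\<lambda>x. ds mangoldt (of_real x) - of_real (1 / (x - 1)))"
  define F where "F = (\<lambda>x. ds (\<lambda>n. of_real (mangoldt n * ht n)) (of_real x) - of_real (1 / real m / (x - 1)))"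
  define l0 where "l0 = (1 / of_nat m) * (- euler_mascheroni + (\<Sum>i\<in>{1..<m}. (-1) ^ i * l i))"
  have F_eq: "F x = (1 / of_nat m) * (Z x + (\<Sum>i\<in>{1..<m}. (-1) ^ i * char_log_deriv (chi i) x))" if "x > 1" for x
    unfolding F_def ds_ht[OF that] Z_def by (simp add: algebra_simps)
  have Z: "(Z \<longlongrightarrow> - euler_mascheroni) (at_right 1)"
    using tendsto_minus[OF ds_mangoldt_pole_tendsto] by (simp add: Z_def)
  have "((\<lambda>x. (1 / of_nat m) * (Z x + (\<Sum>i\<in>{1..<m}. (-1) ^ i * char_log_deriv (chi i) x))) \<longlongrightarrow> l0) (at_right 1)"
    unfolding l0_def by (intro tendsto_intros Z l(1))
  moreover have "\<forall>\<^sub>F x in at_right 1. (1 / of_nat m) * (Z x + (\<Sum>i\<in>{1..<m}. (-1) ^ i * char_log_deriv (chi i) x)) = F x"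
    using eventually_at_right_1_2 by eventually_elim (simp add: F_eq)
  ultimately have lim: "(F \<longlongrightarrow> l0) (at_right 1)" by (rule Lim_transform_eventually)
  have td: "third_diff F l0 \<eta> = (1 / of_nat m) * (third_diff Z (- euler_mascheroni) \<eta> +
      (\<Sum>i\<in>{1..<m}. (-1) ^ i * third_diff (char_log_deriv (chi i)) (l i) \<eta>))"
    using \<eta> by (simp add: third_diff_def F_eq l0_def sum_distrib_left sum.distrib sum_subtractf algebra_simps)
  have tZ: "norm (third_diff Z (- euler_mascheroni) \<eta>) \<le> 15"
  proof -
    have "norm (third_diff Z (- euler_mascheroni) \<eta>) \<le> 7 * 2 + norm (- euler_mascheroni :: complex)"
    proof (rule norm_third_diff_le)
      fix c :: real assume c: "c \<in> {1, 2, 3}"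
      then have "1 < 1 + c * \<eta>" "1 + c * \<eta> < 1 + \<epsilon>" using \<eta> by auto
      from \<epsilon>[OF this] show "norm (Z (1 + c * \<eta>)) \<le> 2" by (simp add: Z_def norm_minus_commute)
    qed
    also have "norm (- euler_mascheroni :: complex) = (euler_mascheroni :: real)"
      using euler_mascheroni_pos by (metis norm_minus_cancel norm_of_real of_real_euler_mascheroni abs_of_pos)
    also have "(euler_mascheroni :: real) \<le> 1" using euler_mascheroni_less_13_over_22 by simp
    finally show ?thesis by simp
  qed
  have "M \<ge> 0" using M[of 2] by linarith
  then have p: "7 * (1 / \<eta>\<^sup>2 + M) + 18345600 * (sqrt (real q) * ln (real q) ^ 2) \<ge> 0" by simp
  have "norm (\<Sum>i\<in>{1..<m}. (-1) ^ i * third_diff (char_log_deriv (chi i)) (l i) \<eta>) \<le>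
     (\<Sum>i\<in>{1..<m}. if 2 * i = m then 7 * (1 / \<eta>\<^sup>2 + M) + 18345600 * (sqrt (real q) * ln (real q) ^ 2) else 10368 * \<eta> ^ 3 / char_rho q ^ 4)"
    by (rule sum_norm_le) (use l(2) in \<open>simp add: norm_mult norm_power\<close>)
  also have "\<dots> \<le> (\<Sum>i\<in>{1..<m}. 10368 * \<eta> ^ 3 / char_rho q ^ 4 + (if i = m div 2 then 7 * (1 / \<eta>\<^sup>2 + M) + 18345600 * (sqrt (real q) * ln (real q) ^ 2) else 0))"
    using \<eta> p by (intro sum_mono) (auto intro!: divide_nonneg_nonneg)
  also have "\<dots> \<le> 10368 * real m * \<eta> ^ 3 / char_rho q ^ 4 + (7 * (1 / \<eta>\<^sup>2 + M) + 18345600 * (sqrt (real q) * ln (real q) ^ 2))"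
  proof -
    have gen: "(\<Sum>i\<in>{1..<m}. K1 + (if i = j then K2 else 0)) \<le> real m * K1 + K2" if K: "K1 \<ge> 0" "K2 \<ge> 0" for K1 K2 :: real and j
    proof -
      have "(\<Sum>i\<in>{1..<m}. if i = j then K2 else 0) \<le> K2" using K by (simp add: sum.delta)
      moreover have "(\<Sum>i\<in>{1..<m}. K1) = real (m - 1) * K1" by simp
      moreover have "real (m - 1) * K1 \<le> real m * K1" using K by (intro mult_right_mono) auto
      ultimately show ?thesis by (simp only: sum.distrib)
    qed
    have "10368 * \<eta> ^ 3 / char_rho q ^ 4 \<ge> 0" using \<eta> by simp
    from gen[OF this p, of "m div 2"] show ?thesis by (simp add: mult_ac)
  qed
  finally have tS: "norm (\<Sum>i\<in>{1..<m}. (-1) ^ i * third_diff (char_log_deriv (chi i)) (l i) \<eta>) \<le>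
     10368 * real m * \<eta> ^ 3 / char_rho q ^ 4 + (7 * (1 / \<eta>\<^sup>2 + M) + 18345600 * (sqrt (real q) * ln (real q) ^ 2))" .
  have tF: "norm (third_diff F l0 \<eta>) \<le> (1 / real m) * (15 + 10368 * real m * \<eta> ^ 3 / char_rho q ^ 4
        + (7 * (1 / \<eta>\<^sup>2 + M) + 18345600 * (sqrt (real q) * ln (real q) ^ 2)))"
  proof -
    have "norm (third_diff Z (- euler_mascheroni) \<eta> + (\<Sum>i\<in>{1..<m}. (-1) ^ i * third_diff (char_log_deriv (chi i)) (l i) \<eta>))
       \<le> 15 + (10368 * real m * \<eta> ^ 3 / char_rho q ^ 4 + (7 * (1 / \<eta>\<^sup>2 + M) + 18345600 * (sqrt (real q) * ln (real q) ^ 2)))"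
      using norm_triangle_mono[OF tZ tS] .
    then show ?thesis unfolding td norm_mult using m_pos by (simp add: norm_divide mult_left_mono divide_right_mono add.assoc)
  qed
  have "norm (third_diff F 0 \<eta>) \<le> 7 * (B + 1 / (real m * \<eta>)) + norm (0 :: complex)"
  proof (rule norm_third_diff_le)
    fix c :: real assume c: "c \<in> {1, 2, 3}"
    then have c\<eta>: "c * \<eta> \<ge> \<eta>" using \<eta> by auto
    have "norm (F (1 + c * \<eta>)) \<le> norm (ds (\<lambda>n. of_real (mangoldt n * ht n)) (of_real (1 + c * \<eta>))) + norm (complex_of_real (1 / real m / (1 + c * \<eta> - 1)))"
      unfolding F_def by (rule norm_triangle_ineq4)
    also have "\<dots> \<le> B + 1 / (real m * \<eta>)"
    proof (rule add_mono)
      show "norm (ds (\<lambda>n. of_real (mangoldt n * ht n)) (of_real (1 + c * \<eta>))) \<le> B" using c\<eta> by (intro B) auto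
      have "norm (complex_of_real (1 / real m / (1 + c * \<eta> - 1))) = 1 / (real m * (c * \<eta>))"
        using c\<eta> \<eta> by (simp only: norm_of_real) simp
      also have "\<dots> \<le> 1 / (real m * \<eta>)" using c\<eta> \<eta> m_pos by (intro divide_left_mono mult_left_mono) auto
      finally show "norm (complex_of_real (1 / real m / (1 + c * \<eta> - 1))) \<le> 1 / (real m * \<eta>)" .
    qed
    finally show "norm (F (1 + c * \<eta>)) \<le> B + 1 / (real m * \<eta>)" .
  qed
  moreover have "l0 = third_diff F 0 \<eta> - third_diff F l0 \<eta>" by (simp add: third_diff_def)
  then have "norm l0 \<le> norm (third_diff F 0 \<eta>) + norm (third_diff F l0 \<eta>)" using norm_triangle_ineq4 by metis
  ultimately have "norm l0 \<le> 7 * (B + 1 / (real m * \<eta>)) + (1 / real m) * (15 + 10368 * real m * \<eta> ^ 3 / char_rho q ^ 4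
        + (7 * (1 / \<eta>\<^sup>2 + M) + 18345600 * (sqrt (real q) * ln (real q) ^ 2)))"
    using tF by simp
  with lim show ?thesis unfolding F_def by blast
qed

end

section \<open>The character average near 1\<close>

definition main_err :: "nat \<Rightarrow> nat \<Rightarrow> real" where
  "main_err q r = ln (real q) ^ 3 / (real q powr (1 / real r) * ln (ln (real q)))"

definition sqrt_err :: "nat \<Rightarrow> nat \<Rightarrow> real" where
  "sqrt_err q r = real r * ln (real q) ^ 2 / sqrt (real q)"

lemma exp_1_less_3: "exp (1::real) < 3"
proof -
  have "exp (1/4 :: real) \<le> 1 + 1/4 + (1/4)\<^sup>2" by (rule exp_bound) auto
  then have "exp (1/4 :: real) ^ 4 \<le> (21/16) ^ 4" by (intro power_mono) (auto simp: power2_eq_square)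
  moreover have "exp (1/4 :: real) ^ 4 = exp 1" by (simp add: exp_of_nat_mult[symmetric])
  moreover have "(21/16 :: real) ^ 4 < 3" by (simp add: eval_nat_numeral)
  ultimately show ?thesis by linarith
qed

lemma ln_gt_1: "real q \<ge> 3 \<Longrightarrow> ln (real q) > 1"
proof -
  assume q: "real q \<ge> 3"
  have "exp 1 < real q" using exp_1_less_3 q by linarith
  then have "ln (exp 1) < ln (real q)" using q by (subst ln_less_cancel_iff) auto
  then show ?thesis by simp
qed

lemma ln_ln_bounds:
  assumes "q \<ge> 3" shows "0 < ln (ln (real q))" "ln (ln (real q)) \<le> ln (real q)"
proof -
  have l: "ln (real q) > 1" using ln_gt_1[of q] assms by simp
  then show "0 < ln (ln (real q))" by simp
  show "ln (ln (real q)) \<le> ln (real q)" using ln_le_minus_one[of "ln (real q)"] l by linarith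
qed

lemma main_err_ge:
  assumes "q \<ge> 3" shows "ln (real q) ^ 2 / real q powr (1 / real r) \<le> main_err q r"
proof -
  have l: "ln (real q) > 1" using ln_gt_1[of q] assms by simp
  note ll = ln_ln_bounds[OF assms]
  have "ln (real q) ^ 2 / real q powr (1 / real r) = ln (real q) ^ 3 / (real q powr (1 / real r) * ln (real q))"
    using l by (simp add: power2_eq_square power3_eq_cube)
  also have "\<dots> \<le> main_err q r"
    unfolding main_err_def using l ll assms by (intro divide_left_mono mult_left_mono) auto
  finally show ?thesis .
qed

lemma main_err_nonneg: "q \<ge> 3 \<Longrightarrow> main_err q r \<ge> 0"
  using main_err_ge[of q r] by (meson divide_nonneg_nonneg order.trans powr_ge_zero zero_le_power2)

lemma sqrt_err_ge: "q \<ge> 3 \<Longrightarrow> real r / sqrt (real q) \<le> sqrt_err q r"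
proof -
  assume "q \<ge> 3"
  then have l: "ln (real q) > 1" using ln_gt_1[of q] by simp
  then have "real r * 1 \<le> real r * ln (real q) ^ 2" by (intro mult_left_mono one_le_power) auto
  then show ?thesis unfolding sqrt_err_def by (intro divide_right_mono) auto
qed

lemma powr_root_le:
  assumes q: "real q \<le> 2 * real n ^ r" and n: "n > 0" and r: "r > 0"
  shows "real q powr (1 / real r) \<le> 2 * real n"
proof -
  have "real q \<le> (2 * real n) ^ r"
  proof -
    have "(2::real) ^ 1 \<le> 2 ^ r" using r by (intro power_increasing) auto
    then have "2 * real n ^ r \<le> 2 ^ r * real n ^ r" by (intro mult_right_mono) auto
    then show ?thesis using q by (simp add: power_mult_distrib)
  qed
  then have "real q powr (1 / real r) \<le> ((2 * real n) ^ r) powr (1 / real r)" by (intro powr_mono2) auto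
  also have "\<dots> = ((2 * real n) powr real r) powr (1 / real r)" using n by (subst powr_realpow) auto
  also have "\<dots> = 2 * real n" using n r by (simp add: powr_powr)
  finally show ?thesis .
qed

text \<open>Once r >= ln q the main error is at least of order log^2 q, so crude estimates suffice;
  \<open>head_le\<close> and \<open>sum_wt_le\<close> split off this case.\<close>

lemma powr_inverse_le_3:
  assumes "q \<ge> 3" "real r \<ge> ln (real q)"
  shows "real q powr (1 / real r) \<le> 3"
proof -
  have l: "ln (real q) > 1" using ln_gt_1[of q] assms by simp
  have "real q powr (1 / real r) = exp (ln (real q) / real r)" using assms by (simp add: powr_def)
  also have "\<dots> \<le> exp 1" using assms l by (simp add: divide_le_eq)
  finally show ?thesis using exp_1_less_3 by linarith
qed

lemma card_roots_minus_one:
  assumes "prime (q::nat)" "q \<ge> 3" "r > 0"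
  shows "card {n. n < q \<and> q dvd n ^ r + 1} \<le> r"
proof -
  have "q dvd n ^ r + 1 \<longleftrightarrow> [n ^ r = q - 1] (mod q)" for n
  proof -
    have "[n ^ r = q - 1] (mod q) \<longleftrightarrow> [n ^ r + 1 = (q - 1) + 1] (mod q)" by (simp only: cong_add_rcancel_nat)
    also have "\<dots> \<longleftrightarrow> q dvd n ^ r + 1" using assms by (simp add: cong_def dvd_eq_mod_eq_0)
    finally show ?thesis by simp
  qed
  then have "{n. n < q \<and> q dvd n ^ r + 1} = {n\<in>{..<q}. [n ^ r = q - 1] (mod q)}" by auto
  then show ?thesis using roots_mod_prime_bound[of q r "q - 1"] assms by simp
qed

definition head :: "nat \<Rightarrow> nat \<Rightarrow> real" where
  "head q r = (\<Sum>n | n < q \<and> q dvd n ^ r + 1. ln (real n) / real n)"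

text \<open>A solution n < q satisfies q <= n^r + 1, hence n >= q^(1/r) / 2, and there are at most r
  solutions. This is enough for r <= ln q; otherwise a harmonic sum over all n suffices.\<close>

lemma head_le:
  assumes q: "prime q" "q \<ge> 3" and r: "r > 0"
  shows "head q r \<le> 6 * main_err q r"
proof (cases "real r \<le> ln (real q)")
  case True
  have l: "ln (real q) > 1" using ln_gt_1[of q] q by simp
  define Y where "Y = real q powr (1 / real r)"
  have Y: "Y > 0" using q by (simp add: Y_def)
  have "head q r \<le> (\<Sum>n | n < q \<and> q dvd n ^ r + 1. 2 * ln (real q) / Y)"
    unfolding head_def
  proof (rule sum_mono)
    fix n assume "n \<in> {n. n < q \<and> q dvd n ^ r + 1}"
    then have n: "n < q" "q dvd n ^ r + 1" by auto
    have "n \<noteq> 0"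
    proof
      assume "n = 0"
      then have "q dvd 1" using n(2) r by (simp add: zero_power)
      then show False using q by simp
    qed
    then have n0: "n > 0" by simp
    have "q \<le> n ^ r + 1" using n(2) by (intro dvd_imp_le) auto
    also have "\<dots> \<le> 2 * n ^ r" using n0 by simp
    finally have "real q \<le> real (2 * n ^ r)" by (simp only: of_nat_le_iff)
    then have "Y \<le> 2 * real n" unfolding Y_def using n0 r by (intro powr_root_le) auto
    then have "ln (real n) / real n \<le> ln (real q) / (Y / 2)"
      using n0 n(1) Y l by (intro frac_le) auto
    then show "ln (real n) / real n \<le> 2 * ln (real q) / Y" by (simp add: mult.commute)
  qed
  also have "\<dots> = real (card {n. n < q \<and> q dvd n ^ r + 1}) * (2 * ln (real q) / Y)" by simp
  also have "\<dots> \<le> ln (real q) * (2 * ln (real q) / Y)"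
    using card_roots_minus_one[OF q r] True Y l by (intro mult_right_mono) auto
  also have "\<dots> = 2 * (ln (real q) ^ 2 / Y)" by (simp add: power2_eq_square)
  also have "\<dots> \<le> 6 * main_err q r"
    using main_err_ge[OF q(2), of r] main_err_nonneg[OF q(2), of r] by (simp add: Y_def)
  finally show ?thesis .
next
  case False
  have l: "ln (real q) > 1" using ln_gt_1[of q] q by simp
  have Y: "real q powr (1 / real r) \<le> 3" using False q by (intro powr_inverse_le_3) auto
  \<comment> \<open>The zero sequence gives access to \<open>sum_inverse_le_ln\<close>, which lives
    in that locale.\<close>
  interpret mean_zero_periodic "\<lambda>_. 0" q using q by unfold_locales auto
  let ?R = "{1..q} \<inter> {n. n < q \<and> q dvd n ^ r + 1}"
  have "\<not> q dvd 0 ^ r + 1" using r q by (simp add: zero_power)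
  then have "{n. n < q \<and> q dvd n ^ r + 1} = ?R"
    by (auto simp: Suc_le_eq intro!: Nat.gr0I)
  then have "head q r = (\<Sum>n\<in>?R. ln (real n) / real n)" by (simp add: head_def)
  also have "\<dots> \<le> (\<Sum>n\<in>?R. ln (real q) * (1 / real n))"
    by (intro sum_mono) (auto intro!: divide_right_mono)
  also have "\<dots> \<le> (\<Sum>n=1..q. ln (real q) * (1 / real n))"
    using l by (intro sum_mono2) auto
  also have "\<dots> = ln (real q) * (\<Sum>n=1..q. 1 / real n)" by (simp add: sum_distrib_left)
  also have "\<dots> \<le> ln (real q) * (1 + ln (real q))" using l q by (intro mult_left_mono sum_inverse_le_ln) auto
  also have "\<dots> \<le> ln (real q) * (2 * ln (real q))" using l by (intro mult_left_mono) auto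
  also have "\<dots> = 6 * (ln (real q) ^ 2 / 3)" by (simp add: power2_eq_square)
  also have "\<dots> \<le> 6 * (ln (real q) ^ 2 / real q powr (1 / real r))"
    using Y q by (intro mult_left_mono divide_left_mono) auto
  also have "\<dots> \<le> 6 * main_err q r" using main_err_ge[OF q(2), of r] by simp
  finally show ?thesis .
qed

context character_family
begin

lemma ht_period: "ht (i + j * q) = ht i"
proof -
  have "[(i + j * q) ^ r + 1 = i ^ r + 1] (mod q)"
    by (intro cong_add cong_pow cong_refl) (simp add: cong_def)
  then have "q dvd (i + j * q) ^ r + 1 \<longleftrightarrow> q dvd i ^ r + 1" by (rule cong_dvd_iff)
  then show ?thesis by (simp add: ht_def)
qed

lemma sum_ht_le: "(\<Sum>i<q. ht i) \<le> 2 * real r"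
proof -
  have "(\<Sum>i<q. ht i) \<le> (\<Sum>i<q. (if i = 0 then 1 else 0) + (if q dvd i ^ r + 1 then 1 else 0))"
  proof (rule sum_mono)
    fix i assume "i \<in> {..<q}"
    then have "q dvd i \<Longrightarrow> i = 0" by (auto dest: dvd_imp_le)
    then show "ht i \<le> (if i = 0 then 1 else 0) + (if q dvd i ^ r + 1 then 1 else 0)"
      using ht_le_1[of i] by (auto simp: ht_def)
  qed
  also have "\<dots> = 1 + real (card {i. i < q \<and> q dvd i ^ r + 1})"
    using q3 by (simp add: sum.distrib sum.delta sum.If_cases Int_def)
  also have "\<dots> \<le> 2 * real r" using card_roots_minus_one[OF prime q3 r_pos] r_pos by simp
  finally show ?thesis .
qed

text \<open>The first period contributes \<open>head\<close>. In every later one the values of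
  \<open>ht\<close> add up to at most 2 r, and ln n <= (2 / eta) n^(eta / 2) leaves n^(-1 - eta /
  2), so summing over the periods costs another 3 / eta.\<close>

lemma ds_ht_le:
  assumes \<eta>: "\<eta> > 0" "\<eta> \<le> 1" and x: "x \<ge> 1 + \<eta>"
  shows "norm (ds (\<lambda>n. of_real (mangoldt n * ht n)) (of_real x)) \<le> head q r + 12 * real r / (real q * \<eta>\<^sup>2)"
proof -
  define w where "w = (\<lambda>n. ln (real n) * ht n * real n powr (- 1 - \<eta>))"
  have q0: "real q > 0" using q3 by simp
  have w_nonneg: "w n \<ge> 0" for n
    using ht_nonneg[of n] by (cases "n = 0") (auto simp: w_def)
  have block0: "(\<Sum>n<q. w n) \<le> head q r"
  proof -
    have "(\<Sum>n<q. w n) = (\<Sum>n\<in>{..<q} - {0}. w n)"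
      by (intro sum.mono_neutral_right) (auto simp: w_def)
    also have "\<dots> \<le> (\<Sum>n\<in>{..<q} - {0}. if q dvd n ^ r + 1 then ln (real n) / real n else 0)"
    proof (rule sum_mono)
      fix n assume n: "n \<in> {..<q} - {0}"
      then have "\<not> q dvd n" by (auto dest: dvd_imp_le)
      moreover have "real n powr (- 1 - \<eta>) \<le> real n powr (- 1)" using n \<eta> by (intro powr_mono) auto
      then have "ln (real n) * real n powr (- 1 - \<eta>) \<le> ln (real n) * (1 / real n)"
        using n by (intro mult_left_mono) (auto simp: powr_minus_divide)
      ultimately show "w n \<le> (if q dvd n ^ r + 1 then ln (real n) / real n else 0)"
        by (simp add: w_def ht_def)
    qed
    also have "\<dots> = (\<Sum>n\<in>{n\<in>{..<q} - {0}. q dvd n ^ r + 1}. ln (real n) / real n)"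
      by (rule sum.inter_filter[symmetric]) simp
    also have "\<dots> \<le> head q r" unfolding head_def
    proof (rule sum_mono2)
      show "ln (real n) / real n \<ge> 0" for n by (cases "n = 0") auto
    qed auto
    finally show ?thesis .
  qed
  have block: "(\<Sum>n\<in>{j * q..<j * q + q}. w n) \<le> (4 * real r / (\<eta> * real q)) * real j powr (- 1 - \<eta> / 2)" if j: "j > 0" for j
  proof -
    have wn: "w n \<le> (2 / \<eta>) * (real j powr (- 1 - \<eta> / 2) / real q) * ht n" if n: "n \<in> {j * q..<j * q + q}" for n
    proof -
      have n0: "real n \<ge> real j * real q" "real j * real q \<ge> 1"
        using n j q3 by (auto simp flip: of_nat_mult intro: Suc_leI)
      then have n1: "real n \<ge> 1" by linarith
      have "ln (real n) * real n powr (- 1 - \<eta>) \<le> (real n powr (\<eta> / 2) / (\<eta> / 2)) * real n powr (- 1 - \<eta>)"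
        using n1 \<eta> by (intro mult_right_mono ln_powr_bound) auto
      also have "\<dots> = (2 / \<eta>) * (real n powr (\<eta> / 2) * real n powr (- 1 - \<eta>))" by simp
      also have "real n powr (\<eta> / 2) * real n powr (- 1 - \<eta>) = real n powr (- 1 - \<eta> / 2)"
        by (subst powr_add[symmetric], rule arg_cong[where f = "\<lambda>x. real n powr x"]) (simp add: field_simps)
      also have "(2 / \<eta>) * real n powr (- 1 - \<eta> / 2) \<le> (2 / \<eta>) * (real j * real q) powr (- 1 - \<eta> / 2)"
        using n0 \<eta> by (intro mult_left_mono powr_mono2') auto
      also have "(real j * real q) powr (- 1 - \<eta> / 2) = real j powr (- 1 - \<eta> / 2) * real q powr (- 1 - \<eta> / 2)"
        by (rule powr_mult)
      also have "(2 / \<eta>) * (real j powr (- 1 - \<eta> / 2) * real q powr (- 1 - \<eta> / 2)) \<le> (2 / \<eta>) * (real j powr (- 1 - \<eta> / 2) * real q powr (- 1))"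
        using q3 \<eta> by (intro mult_left_mono powr_mono) auto
      also have "\<dots> = (2 / \<eta>) * (real j powr (- 1 - \<eta> / 2) / real q)" using q0 by (simp add: powr_minus_divide)
      finally have "ln (real n) * real n powr (- 1 - \<eta>) * ht n \<le> (2 / \<eta>) * (real j powr (- 1 - \<eta> / 2) / real q) * ht n"
        using ht_nonneg by (intro mult_right_mono)
      then show ?thesis by (simp add: w_def mult_ac)
    qed
    have "(\<Sum>n\<in>{j * q..<j * q + q}. ht n) = (\<Sum>i<q. ht i)"
      using sum.shift_bounds_nat_ivl[of ht 0 "j * q" q] by (simp add: ht_period lessThan_atLeast0 add.commute)
    then have sh: "(\<Sum>n\<in>{j * q..<j * q + q}. ht n) \<le> 2 * real r" using sum_ht_le by simp
    have "(\<Sum>n\<in>{j * q..<j * q + q}. w n) \<le> (\<Sum>n\<in>{j * q..<j * q + q}. (2 / \<eta>) * (real j powr (- 1 - \<eta> / 2) / real q) * ht n)"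
      by (intro sum_mono wn)
    also have "\<dots> = (2 / \<eta>) * (real j powr (- 1 - \<eta> / 2) / real q) * (\<Sum>n\<in>{j * q..<j * q + q}. ht n)"
      by (rule sum_distrib_left[symmetric])
    also have "\<dots> \<le> (2 / \<eta>) * (real j powr (- 1 - \<eta> / 2) / real q) * (2 * real r)"
      using \<eta> by (intro mult_left_mono sh) auto
    finally show ?thesis using \<eta> q0 by (simp add: field_simps)
  qed
  have zsum: "(\<Sum>j<T. real (Suc j) powr (- 1 - \<eta> / 2)) \<le> 3 / \<eta>" for T
  proof -
    have "(\<Sum>j<T. real (Suc j) powr (- (1 + \<eta> / 2))) \<le> rzeta (1 + \<eta> / 2)"
      unfolding rzeta_def using \<eta> by (intro sum_le_suminf summable_rzeta) auto
    also have "\<dots> \<le> 1 + 2 / \<eta>" using rzeta_bounds(1)[of "1 + \<eta> / 2"] \<eta> by simp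
    also have "\<dots> \<le> 3 / \<eta>" using \<eta> by (simp add: field_simps)
    finally show ?thesis by simp
  qed
  have part: "(\<Sum>n<N. w n) \<le> head q r + 12 * real r / (real q * \<eta>\<^sup>2)" for N
  proof -
    have "N * 1 \<le> Suc N * q" using q3 by (intro mult_mono) auto
    then have "(\<Sum>n<N. w n) \<le> (\<Sum>n<Suc N * q. w n)" by (intro sum_mono2 w_nonneg) auto
    also have "\<dots> = (\<Sum>j<Suc N. \<Sum>n\<in>{j * q..<j * q + q}. w n)" by (rule sum.nat_group[symmetric])
    also have "\<dots> = (\<Sum>n<q. w n) + (\<Sum>j<N. \<Sum>n\<in>{Suc j * q..<Suc j * q + q}. w n)"
      by (subst sum.lessThan_Suc_shift) (simp add: lessThan_atLeast0)
    also have "\<dots> \<le> head q r + (\<Sum>j<N. (4 * real r / (\<eta> * real q)) * real (Suc j) powr (- 1 - \<eta> / 2))"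
      by (intro add_mono block0 sum_mono block) auto
    also have "(\<Sum>j<N. (4 * real r / (\<eta> * real q)) * real (Suc j) powr (- 1 - \<eta> / 2)) =
        (4 * real r / (\<eta> * real q)) * (\<Sum>j<N. real (Suc j) powr (- 1 - \<eta> / 2))"
      by (rule sum_distrib_left[symmetric])
    also have "\<dots> \<le> (4 * real r / (\<eta> * real q)) * (3 / \<eta>)" using \<eta> by (intro mult_left_mono zsum) auto
    also have "\<dots> = 12 * real r / (real q * \<eta>\<^sup>2)" by (simp add: power2_eq_square mult_ac)
    finally show ?thesis by simp
  qed
  have sw: "summable w" by (rule summableI_nonneg_bounded[OF w_nonneg part])
  have "norm (ds (\<lambda>n. of_real (mangoldt n * ht n)) (of_real x)) \<le> suminf w"
    unfolding ds_def
  proof (rule norm_suminf_le[OF _ sw])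
    fix n
    show "norm (of_real (mangoldt n * ht n) * of_nat n powr (- of_real x) :: complex) \<le> w n"
    proof (cases "n = 0")
      case False
      then have n: "n > 0" by simp
      have "norm (complex_of_real (mangoldt n * ht n) * of_nat n powr (- of_real x)) = mangoldt n * ht n * real n powr (- x)"
        using ht_nonneg[of n] by (simp add: norm_mult norm_of_nat_powr_minus mangoldt_nonneg)
      also have "\<dots> \<le> ln (real n) * ht n * real n powr (- 1 - \<eta>)"
        using n x ht_nonneg[of n] by (intro mult_mono powr_mono mangoldt_le) (auto simp: mangoldt_nonneg)
      finally show ?thesis by (simp add: w_def)
    qed (simp add: w_def)
  qed
  also have "\<dots> \<le> head q r + 12 * real r / (real q * \<eta>\<^sup>2)" by (rule suminf_le_const[OF sw part])
  finally show ?thesis .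
qed

end


lemma ln_power_le_powr:
  assumes "x \<ge> 1" "k > 0" "e > 0"
  shows "ln x ^ k \<le> (real k / e) ^ k * x powr e"
proof -
  have "ln x \<le> x powr (e / real k) / (e / real k)" using assms by (intro ln_powr_bound) auto
  then have "ln x ^ k \<le> (x powr (e / real k) / (e / real k)) ^ k" using assms by (intro power_mono) auto
  also have "\<dots> = (real k / e) ^ k * (x powr (e / real k)) ^ k" by (simp add: power_divide power_mult_distrib)
  also have "(x powr (e / real k)) ^ k = x powr e"
    using assms by (simp add: powr_realpow[symmetric] powr_powr)
  finally show ?thesis .
qed

text \<open>Balances the terms of \<open>ht_limit\<close> at eta = \<kappa> q^(-1/4). The constant
  can precede all parameters because it depends only on zeta near 1.\<close>

lemma ht_limit_err:
  "\<exists>C\<ge>0. \<forall>q r m E g. character_family q r m E g \<longrightarrow>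
    (\<exists>l. ((\<lambda>x. ds (\<lambda>n. of_real (mangoldt n * character_family.ht q r m n)) (of_real x) - of_real (1 / real m / (x - 1))) \<longlongrightarrow> l) (at_right 1) \<and>
      norm l \<le> C * (main_err q r + sqrt_err q r))"
proof -
  obtain M where M0: "M > 0" and M: "\<And>s. s > 1 \<Longrightarrow> s \<le> 2 \<Longrightarrow> \<bar>rzeta_ln s - 1 / (s - 1)\<^sup>2\<bar> \<le> M"
    using rzeta_ln_bound by blast
  have "norm (euler_mascheroni :: complex) < 2"
  proof -
    have "norm (euler_mascheroni :: complex) = (euler_mascheroni :: real)"
      using euler_mascheroni_pos by (metis norm_of_real of_real_euler_mascheroni abs_of_pos)
    then show ?thesis using euler_mascheroni_less_13_over_22 by simp
  qed
  with tendsto_norm[OF ds_mangoldt_pole_tendsto]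
  have "\<forall>\<^sub>F x in at_right 1. norm (of_real (1 / (x - 1)) - ds mangoldt (of_real x)) < 2"
    by (rule order_tendstoD(2))
  then obtain b where b: "b > 1" "\<And>x. x > 1 \<Longrightarrow> x < b \<Longrightarrow> norm (of_real (1 / (x - 1)) - ds mangoldt (of_real x)) < 2"
    unfolding eventually_at_right_field by blast
  define \<epsilon> where "\<epsilon> = b - 1"
  have \<epsilon>0: "\<epsilon> > 0" using b by (simp add: \<epsilon>_def)
  define a where "a = (1 / 104 ^ 5 / 2 :: real)"
  have a0: "a > 0" by (simp add: a_def)
  \<comment> \<open>The first two bounds keep 3 eta below 1 and \<epsilon>. The last ensures 6 eta
    <= \<open>char_rho q\<close>, because (ln q)^9 <= 36^9 q^(1/4).\<close>
  define \<kappa> where "\<kappa> = min (min (1 / 4) (\<epsilon> / 4)) (a / (6 * 36 ^ 9))"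
  have \<kappa>: "\<kappa> > 0" "\<kappa> \<le> 1 / 4" "\<kappa> \<le> \<epsilon> / 4" "\<kappa> \<le> a / (6 * 36 ^ 9)"
    using \<epsilon>0 a0 by (auto simp: \<kappa>_def)
  \<comment> \<open>One summand for each of the estimates \<open>t2\<close> to \<open>t7\<close>
    below; the 42 in C is that of \<open>t1\<close>.\<close>
  define K0 where "K0 = 84 / \<kappa>\<^sup>2 + 14 / \<kappa> + 30 + 10368 * \<kappa> ^ 3 / a ^ 4 * 144 ^ 36 + 14 * (1 / \<kappa>\<^sup>2 + M) + 36691200"
  have K0: "K0 \<ge> 0" using \<kappa> M0 a0 by (auto simp: K0_def intro!: add_nonneg_nonneg)
  define C where "C = 42 + K0"
  show ?thesis
  proof (intro exI[of _ C] conjI allI impI)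
    show "C \<ge> 0" using K0 by (simp add: C_def)
    fix q r m E g assume "character_family q r m E g"
    then interpret character_family q r m E g .
    have q0: "real q \<ge> 3" using q3 by simp
    define l where "l = ln (real q)"
    have l: "l > 1" using ln_gt_1[OF q0] by (simp add: l_def)
    define \<eta> where "\<eta> = \<kappa> * real q powr (- 1 / 4)"
    have qle: "real q powr (- 1 / 4) \<le> 1" using q0 powr_mono[of "- 1 / 4" 0 "real q"] by simp
    have \<eta>0: "\<eta> > 0" using \<kappa> q0 by (simp add: \<eta>_def)
    have \<eta>\<kappa>: "\<eta> \<le> \<kappa>" unfolding \<eta>_def using qle \<kappa> by (simp add: mult_left_le)
    have rho: "char_rho q = a / l ^ 9" by (simp add: char_rho_def a_def l_def)
    have l9: "l ^ 9 \<le> 36 ^ 9 * real q powr (1 / 4)"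
      using ln_power_le_powr[of "real q" 9 "1/4"] q0 by (simp add: l_def)
    have l36: "l ^ 36 \<le> 144 ^ 36 * real q powr (1 / 4)"
      using ln_power_le_powr[of "real q" 36 "1/4"] q0 by (simp add: l_def)
    have "6 * \<eta> * l ^ 9 \<le> 6 * \<eta> * (36 ^ 9 * real q powr (1 / 4))" using l9 \<eta>0 by (intro mult_left_mono) auto
    also have "\<dots> = 6 * 36 ^ 9 * \<kappa> * (real q powr (- 1 / 4) * real q powr (1 / 4))" by (simp add: \<eta>_def)
    also have "real q powr (- 1 / 4) * real q powr (1 / 4) = 1" using q0 by (simp add: powr_add[symmetric])
    also have "6 * 36 ^ 9 * \<kappa> * 1 \<le> a" using \<kappa>(4) by (simp add: field_simps)
    finally have \<eta>rho: "6 * \<eta> \<le> char_rho q" unfolding rho using l by (simp add: field_simps)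
    have "\<exists>l. ((\<lambda>x. ds (\<lambda>n. of_real (mangoldt n * ht n)) (of_real x) - of_real (1 / real m / (x - 1))) \<longlongrightarrow> l) (at_right 1) \<and>
     norm l \<le> 7 * (head q r + 12 * real r / (real q * \<eta>\<^sup>2) + 1 / (real m * \<eta>)) + (1 / real m) * (15 + 10368 * real m * \<eta> ^ 3 / char_rho q ^ 4
        + (7 * (1 / \<eta>\<^sup>2 + M) + 18345600 * (sqrt (real q) * ln (real q) ^ 2)))"
    proof (rule ht_limit[OF _ M \<eta>0 \<eta>rho])
      show "norm (of_real (1 / (x - 1)) - ds mangoldt (of_real x)) \<le> 2" if "1 < x" "x < 1 + \<epsilon>" for x
        using b(2)[of x] that by (auto simp: \<epsilon>_def)
      show "3 * \<eta> < \<epsilon>" using \<eta>\<kappa> \<kappa> \<epsilon>0 by linarith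
      show "3 * \<eta> \<le> 1" using \<eta>\<kappa> \<kappa> by linarith
      show "norm (ds (\<lambda>n. of_real (mangoldt n * ht n)) (of_real x)) \<le> head q r + 12 * real r / (real q * \<eta>\<^sup>2)"
        if "x \<ge> 1 + \<eta>" for x
        using that \<eta>0 \<eta>\<kappa> \<kappa> by (intro ds_ht_le) auto
    qed
    then obtain lim where lim: "((\<lambda>x. ds (\<lambda>n. of_real (mangoldt n * ht n)) (of_real x) - of_real (1 / real m / (x - 1))) \<longlongrightarrow> lim) (at_right 1)"
      and bd: "norm lim \<le> 7 * (head q r + 12 * real r / (real q * \<eta>\<^sup>2) + 1 / (real m * \<eta>)) + (1 / real m) * (15 + 10368 * real m * \<eta> ^ 3 / char_rho q ^ 4
        + (7 * (1 / \<eta>\<^sup>2 + M) + 18345600 * (sqrt (real q) * ln (real q) ^ 2)))" by blast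
    define s where "s = sqrt (real q)"
    have s: "s \<ge> 1" "s * s = real q" using q0 by (auto simp: s_def)
    define D where "D = real r / s"
    have D: "D \<ge> 0" "D \<le> sqrt_err q r" using sqrt_err_ge[OF q3] s by (auto simp: D_def s_def)
    \<comment> \<open>Since r m = q - 1, the averaging factor 1/m gains r/q, which pays for every
      term of size sqrt q.\<close>
    have m_inv: "1 / real m \<le> 2 * real r / real q"
    proof -
      have "real r * real m = real q - 1" using rm q3 by (metis of_nat_mult of_nat_diff of_nat_1 one_le_numeral order.trans)
      then have "real q \<le> 2 * (real r * real m)" using q0 by simp
      then show ?thesis using m_pos q0 by (simp add: field_simps)
    qed
    have m_s: "1 / real m * s \<le> 2 * D"
    proof -
      have "1 / real m * s \<le> 2 * real r / real q * s" using m_inv s by (intro mult_right_mono) auto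
      also have "\<dots> = 2 * D" using s(1) by (simp add: D_def s(2)[symmetric])
      finally show ?thesis .
    qed
    have m1: "1 / real m \<le> 2 * D"
    proof -
      have "1 / real m * 1 \<le> 1 / real m * s" using s by (intro mult_left_mono) auto
      then show ?thesis using m_s by simp
    qed
    have p14: "real q powr (1 / 4) * real q powr (1 / 4) = s" using q0 by (simp add: powr_add[symmetric] s_def powr_half_sqrt)
    have p14s: "real q powr (1 / 4) \<le> s" unfolding s_def powr_half_sqrt[symmetric, OF of_nat_0_le_iff] using q0 by (intro powr_mono) auto
    have pm: "real q powr (- 1 / 4) = 1 / real q powr (1 / 4)" using powr_minus_divide[of "real q" "1/4"] by simp
    have \<eta>_eq: "\<eta> = \<kappa> / real q powr (1 / 4)" unfolding \<eta>_def pm by simp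
    have \<eta>inv: "1 / \<eta> \<le> s / \<kappa>" using p14s \<kappa> by (simp add: \<eta>_eq divide_right_mono)
    have \<eta>2: "1 / \<eta>\<^sup>2 = s / \<kappa>\<^sup>2" using \<kappa> by (simp add: \<eta>_eq power2_eq_square p14[symmetric])
    have t1: "7 * head q r \<le> 42 * main_err q r" using head_le[OF prime q3 r_pos] by simp
    have t2: "7 * (12 * real r / (real q * \<eta>\<^sup>2)) \<le> 84 / \<kappa>\<^sup>2 * sqrt_err q r"
    proof -
      have "7 * (12 * real r / (real q * \<eta>\<^sup>2)) = 84 * real r / real q * (1 / \<eta>\<^sup>2)" by simp
      also have "\<dots> = 84 / \<kappa>\<^sup>2 * D" unfolding \<eta>2 D_def using s by (simp add: s(2)[symmetric])
      also have "\<dots> \<le> 84 / \<kappa>\<^sup>2 * sqrt_err q r" using D by (intro mult_left_mono) auto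
      finally show ?thesis .
    qed
    have t3: "7 * (1 / (real m * \<eta>)) \<le> 14 / \<kappa> * sqrt_err q r"
    proof -
      have "7 * (1 / (real m * \<eta>)) = 7 * (1 / real m) * (1 / \<eta>)" by simp
      also have "\<dots> \<le> 7 * (1 / real m) * (s / \<kappa>)" using \<eta>inv by (intro mult_left_mono) auto
      also have "\<dots> = 7 / \<kappa> * (1 / real m * s)" by simp
      also have "\<dots> \<le> 7 / \<kappa> * (2 * D)" using m_s \<kappa> by (intro mult_left_mono) auto
      also have "\<dots> \<le> 7 / \<kappa> * (2 * sqrt_err q r)" using D \<kappa> by (intro mult_left_mono) auto
      finally show ?thesis by simp
    qed
    have t4: "1 / real m * 15 \<le> 30 * sqrt_err q r" using m1 D by simp
    \<comment> \<open>Since (ln q)^36 <= 144^36 q^(1/4), the product eta^3 (ln q)^36 is at most a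
      multiple of q^(-1/2) with no logarithm left.\<close>
    have t5: "1 / real m * (10368 * real m * \<eta> ^ 3 / char_rho q ^ 4) \<le> 10368 * \<kappa> ^ 3 / a ^ 4 * 144 ^ 36 * sqrt_err q r"
    proof -
      define p where "p = real q powr (1 / 4)"
      have p0: "p > 0" using q0 by (simp add: p_def)
      have "1 / real m * (10368 * real m * \<eta> ^ 3 / char_rho q ^ 4) = 10368 * \<kappa> ^ 3 / a ^ 4 * (l ^ 36 / p ^ 3)"
        using m_pos by (simp add: rho \<eta>_eq p_def power_divide power_mult_distrib power_mult[symmetric] mult_ac)
      also have "\<dots> \<le> 10368 * \<kappa> ^ 3 / a ^ 4 * (144 ^ 36 * p / p ^ 3)"
        using l36 p0 \<kappa> a0 by (intro mult_left_mono divide_right_mono) (auto simp: p_def)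
      also have "144 ^ 36 * p / p ^ 3 = 144 ^ 36 * (1 / s)"
        using p0 by (simp add: p14[symmetric] p_def[symmetric] power3_eq_cube)
      also have "10368 * \<kappa> ^ 3 / a ^ 4 * (144 ^ 36 * (1 / s)) \<le> 10368 * \<kappa> ^ 3 / a ^ 4 * (144 ^ 36 * sqrt_err q r)"
      proof (intro mult_left_mono)
        have "1 / s \<le> D" unfolding D_def using r_pos s by (intro divide_right_mono) auto
        then show "1 / s \<le> sqrt_err q r" using D by linarith
      qed (use \<kappa> a0 in auto)
      finally show ?thesis by (simp only: mult.assoc)
    qed
    have t6: "1 / real m * (7 * (1 / \<eta>\<^sup>2 + M)) \<le> 14 * (1 / \<kappa>\<^sup>2 + M) * sqrt_err q r"
    proof -
      have "M * 1 \<le> M * s" using s M0 by (intro mult_left_mono) auto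
      then have "1 / \<eta>\<^sup>2 + M \<le> (1 / \<kappa>\<^sup>2 + M) * s" unfolding \<eta>2 by (simp add: algebra_simps)
      then have "1 / real m * (7 * (1 / \<eta>\<^sup>2 + M)) \<le> 1 / real m * (7 * ((1 / \<kappa>\<^sup>2 + M) * s))"
        by (intro mult_left_mono) auto
      also have "\<dots> = 7 * (1 / \<kappa>\<^sup>2 + M) * (1 / real m * s)" by simp
      also have "\<dots> \<le> 7 * (1 / \<kappa>\<^sup>2 + M) * (2 * D)" using m_s M0 by (intro mult_left_mono) auto
      also have "\<dots> \<le> 7 * (1 / \<kappa>\<^sup>2 + M) * (2 * sqrt_err q r)" using D M0 by (intro mult_left_mono) auto
      also have "\<dots> = 14 * (1 / \<kappa>\<^sup>2 + M) * sqrt_err q r" by (simp add: algebra_simps)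
      finally show ?thesis .
    qed
    have t7: "1 / real m * (18345600 * (sqrt (real q) * ln (real q) ^ 2)) \<le> 36691200 * sqrt_err q r"
    proof -
      have "1 / real m * (18345600 * (sqrt (real q) * ln (real q) ^ 2)) = 18345600 * l ^ 2 * (1 / real m * s)"
        by (simp add: s_def l_def)
      also have "\<dots> \<le> 18345600 * l ^ 2 * (2 * D)" using m_s by (intro mult_left_mono) auto
      also have "\<dots> = 36691200 * sqrt_err q r" by (simp add: D_def sqrt_err_def s_def l_def)
      finally show ?thesis .
    qed
    have "norm lim \<le> 42 * main_err q r + K0 * sqrt_err q r"
      unfolding K0_def using bd t1 t2 t3 t4 t5 t6 t7 by (simp only: distrib_left distrib_right)
    also have "\<dots> \<le> C * main_err q r + C * sqrt_err q r"
      unfolding C_def using K0 D main_err_nonneg[OF q3, of r]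
      by (intro add_mono mult_right_mono) auto
    finally have "norm lim \<le> C * (main_err q r + sqrt_err q r)" by (simp add: distrib_left)
    with lim show "\<exists>l. ((\<lambda>x. ds (\<lambda>n. of_real (mangoldt n * ht n)) (of_real x) - of_real (1 / real m / (x - 1))) \<longlongrightarrow> l) (at_right 1) \<and>
      norm l \<le> C * (main_err q r + sqrt_err q r)" by blast
  qed
qed

section \<open>Prime powers weighted by local exponents\<close>

lemma geometric_tail_le:
  assumes "0 \<le> (x::real)" "x \<le> 1 / 2"
  shows "(\<Sum>j=a..<a + k. x ^ j) \<le> 2 * x ^ a"
proof (induction k arbitrary: a)
  case (Suc k)
  have "(\<Sum>j=a..<a + Suc k. x ^ j) = x ^ a + (\<Sum>j=Suc a..<Suc a + k. x ^ j)"
    by (subst sum.atLeast_Suc_lessThan) auto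
  also have "\<dots> \<le> x ^ a + 2 * x ^ Suc a" using Suc by (intro add_left_mono)
  also have "\<dots> \<le> x ^ a + x ^ a"
    using assms mult_right_mono[of "2 * x" 1 "x ^ a"] by (simp add: mult_ac)
  finally show ?case by simp
qed (use assms in simp)

lemma arith_geometric_tail_le:
  assumes "0 \<le> (x::real)" "x \<le> 1 / 2"
  shows "(\<Sum>j=a..<a + k. real j * x ^ j) \<le> (2 * real a + 2) * x ^ a"
proof (induction k arbitrary: a)
  case (Suc k)
  have "(\<Sum>j=a..<a + Suc k. real j * x ^ j) = real a * x ^ a + (\<Sum>j=Suc a..<Suc a + k. real j * x ^ j)"
    by (subst sum.atLeast_Suc_lessThan) auto
  also have "\<dots> \<le> real a * x ^ a + (2 * real (Suc a) + 2) * x ^ Suc a" using Suc by (intro add_left_mono)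
  also have "(2 * real (Suc a) + 2) * x ^ Suc a = (real a + 2) * ((2 * x) * x ^ a)" by (simp add: algebra_simps)
  also have "real a * x ^ a + (real a + 2) * ((2 * x) * x ^ a) \<le> real a * x ^ a + (real a + 2) * (1 * x ^ a)"
    using assms by (intro add_left_mono mult_left_mono mult_right_mono) auto
  finally show ?case by (simp add: algebra_simps)
qed (use assms in simp)

text \<open>The right side is the integral of (1 + ln t) / t^2 over [n - 1, n]. The summand 1 makes
  this integrand decreasing on all of t >= 1, which ln t / t^2 is not.\<close>

lemma ln_over_square_le:
  assumes "n \<ge> 2"
  shows "(1 + ln (real n)) / (real n)\<^sup>2 \<le> (2 + ln (real n - 1)) / (real n - 1) - (2 + ln (real n)) / real n"
proof -
  have pos: "real n - 1 > 0" using assms by simp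
  have "\<exists>z. z > real n - 1 \<and> z < real n \<and>
     (2 + ln (real n)) / real n - (2 + ln (real n - 1)) / (real n - 1) = (real n - (real n - 1)) * (- (1 + ln z) / z\<^sup>2)"
    using pos by (intro MVT2) (auto intro!: derivative_eq_intros simp: field_simps power2_eq_square)
  then obtain z where z0: "z > real n - 1" "z < real n"
    "(2 + ln (real n)) / real n - (2 + ln (real n - 1)) / (real n - 1) = - (1 + ln z) / z\<^sup>2" by auto
  have "- (1 + ln z) / z\<^sup>2 = - ((1 + ln z) / z\<^sup>2)" by (rule minus_divide_left[symmetric])
  with z0 have z: "z > real n - 1" "z < real n"
    "(2 + ln (real n - 1)) / (real n - 1) - (2 + ln (real n)) / real n = (1 + ln z) / z\<^sup>2" by linarith+
  have z1: "z \<ge> 1" using z(1) assms by simp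
  have "(1 + ln (real n)) / (real n)\<^sup>2 \<le> (1 + ln z) / z\<^sup>2"
  proof (rule DERIV_nonpos_imp_nonincreasing[of z "real n" "\<lambda>t. (1 + ln t) / t\<^sup>2"])
    fix t assume "z \<le> t" "t \<le> real n"
    then have t: "t \<ge> 1" using z1 by simp
    have "((\<lambda>t. (1 + ln t) / t\<^sup>2) has_real_derivative ((1 / t) * t\<^sup>2 - (1 + ln t) * (2 * t)) / (t\<^sup>2 * t\<^sup>2)) (at t)"
      using t by (auto intro!: derivative_eq_intros)
    moreover have "((1 / t) * t\<^sup>2 - (1 + ln t) * (2 * t)) / (t\<^sup>2 * t\<^sup>2) \<le> 0"
    proof -
      have "(1 / t) * t\<^sup>2 - (1 + ln t) * (2 * t) = - (t * (1 + 2 * ln t))" using t by (simp add: power2_eq_square algebra_simps)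
      moreover have "t * (1 + 2 * ln t) \<ge> 0" using t by simp
      ultimately show ?thesis using t by (simp add: divide_le_0_iff)
    qed
    ultimately show "\<exists>y. ((\<lambda>t. (1 + ln t) / t\<^sup>2) has_real_derivative y) (at t) \<and> y \<le> 0" by blast
  qed (use z in simp)
  then show ?thesis using z(3) by simp
qed

lemma sum_ln_over_square_le:
  assumes "finite A" "\<And>n. n \<in> A \<Longrightarrow> n > s" "s \<ge> 1"
  shows "(\<Sum>n\<in>A. ln (real n) / (real n)\<^sup>2) \<le> (2 + ln (real s)) / real s"
proof -
  have tel: "(\<Sum>n=Suc s..s + k. (1 + ln (real n)) / (real n)\<^sup>2) \<le> (2 + ln (real s)) / real s - (2 + ln (real (s + k))) / real (s + k)" for k
  proof (induction k)
    case (Suc k)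
    have "(1 + ln (real (s + Suc k))) / (real (s + Suc k))\<^sup>2 \<le>
      (2 + ln (real (s + k))) / real (s + k) - (2 + ln (real (s + Suc k))) / real (s + Suc k)"
      using ln_over_square_le[of "s + Suc k"] assms(3) by simp
    then show ?case using Suc by simp
  qed simp
  obtain k where k: "A \<subseteq> {Suc s..s + k}"
  proof -
    have "x \<le> Max (insert 0 A)" if "x \<in> A" for x using assms(1) that by (intro Max_ge) auto
    then have "A \<subseteq> {Suc s..s + Max (insert 0 A)}" using assms(2) by (fastforce simp: Suc_le_eq intro: trans_le_add2)
    then show ?thesis by (rule that)
  qed
  have "(\<Sum>n\<in>A. ln (real n) / (real n)\<^sup>2) \<le> (\<Sum>n=Suc s..s + k. ln (real n) / (real n)\<^sup>2)"
    using k by (intro sum_mono2) auto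
  also have "\<dots> \<le> (\<Sum>n=Suc s..s + k. (1 + ln (real n)) / (real n)\<^sup>2)" by (intro sum_mono divide_right_mono) auto
  also have "\<dots> \<le> (2 + ln (real s)) / real s - (2 + ln (real (s + k))) / real (s + k)" by (rule tel)
  also have "\<dots> \<le> (2 + ln (real s)) / real s" using assms(3) by (simp add: add_nonneg_nonneg)
  finally show ?thesis .
qed

text \<open>The function ln t / t decreases only beyond e; adding 1 to the logarithm gives a
  majorant that decreases from 1 on.\<close>

lemma ln_over_decreasing:
  assumes "1 \<le> (t::real)" "t \<le> m"
  shows "ln m / m \<le> (1 + ln t) / t"
proof -
  have "(1 + ln m) / m \<le> (1 + ln t) / t"
  proof (rule DERIV_nonpos_imp_nonincreasing[OF assms(2), of "\<lambda>t. (1 + ln t) / t"])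
    fix x assume "t \<le> x" "x \<le> m"
    then have x: "x \<ge> 1" using assms by simp
    have "((\<lambda>t. (1 + ln t) / t) has_real_derivative ((1 / x) * x - (1 + ln x) * 1) / (x * x)) (at x)"
      using x by (auto intro!: derivative_eq_intros)
    moreover have "((1 / x) * x - (1 + ln x) * 1) / (x * x) \<le> 0" using x by (simp add: divide_le_0_iff)
    ultimately show "\<exists>y. ((\<lambda>t. (1 + ln t) / t) has_real_derivative y) (at x) \<and> y \<le> 0" by blast
  qed
  moreover have "ln m / m \<le> (1 + ln m) / m" using assms by (intro divide_right_mono) auto
  ultimately show ?thesis by linarith
qed

text \<open>The full series is 2 / (1 - 1/2)^3 = 16; the induction carries the exact
  remainder.\<close>

lemma sum_quadratic_half_powers: "(\<Sum>i<k. real (i + 1) * real (i + 2) / 2 ^ i) \<le> 16"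
proof -
  have "(\<Sum>i<k. real (i + 1) * real (i + 2) / 2 ^ i) = 16 - (2 * real k ^ 2 + 10 * real k + 16) / 2 ^ k"
  proof (induction k)
    case (Suc k)
    show ?case unfolding sum.lessThan_Suc Suc.IH
      by (simp add: divide_simps) (simp add: power2_eq_square algebra_simps)
  qed simp
  then show ?thesis by simp
qed

locale divisor_setup =
  fixes q r :: nat
  assumes prime: "prime q" and q3: "q \<ge> 3" and r0: "r > 0" and r_dvd: "r dvd q - 1"
begin

definition G :: "nat \<Rightarrow> nat" where "G p = geo_ord q (p ^ r)"

text \<open>For primes p other than q the local coefficients vanish at 2 <= j <
  \<open>aexp p\<close>. The exponent 1 is left out because h accounts for it exactly.\<close>

definition aexp :: "nat \<Rightarrow> nat" where "aexp p = max 2 (G p - 1)"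

lemma G_neq_1: "G p \<noteq> 1" unfolding G_def by (rule geo_ord_neq_1[OF prime])
lemma G_eq_0_iff: "prime p \<Longrightarrow> G p = 0 \<longleftrightarrow> p = q"
proof -
  assume p: "prime p"
  have "G p = 0 \<longleftrightarrow> q dvd p ^ r" unfolding G_def by (rule geo_ord_eq_0_iff[OF prime])
  also have "\<dots> \<longleftrightarrow> q dvd p" using prime_dvd_power[OF prime, of p r] r0 by (auto simp: dvd_power_same intro: dvd_power dvd_trans)
  also have "\<dots> \<longleftrightarrow> p = q" using p prime primes_dvd_imp_eq by auto
  finally show ?thesis .
qed
lemma G_eq_2_iff: "G p = 2 \<longleftrightarrow> q dvd p ^ r + 1" unfolding G_def by (rule geo_ord_eq_2_iff[OF prime])
lemma G_cases: "prime p \<Longrightarrow> p \<noteq> q \<Longrightarrow> G p \<ge> 2" using G_eq_0_iff[of p] G_neq_1[of p] by linarith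
lemma pow_G: "[p ^ (r * G p) = 1] (mod q)"
  using pow_geo_ord_cong_1[OF prime, of "p ^ r"] by (simp add: G_def power_mult)

lemma aexp_ge_2: "aexp p \<ge> 2" by (simp add: aexp_def)

text \<open>With x = p^r, q divides 1 + x + ... + x^(G p - 1), which is positive and at most 2 x^(G
  p - 1).\<close>

lemma aexp_size:
  assumes p: "prime p" "p \<noteq> q"
  shows "real q powr (1 / real r) \<le> 2 * real p ^ aexp p"
proof -
  have G2: "G p \<ge> 2" using G_cases[OF p] .
  have geo_le: "x \<ge> 2 \<Longrightarrow> geo x (Suc n) \<le> 2 * x ^ n" for x n
  proof (induction n)
    case (Suc n)
    have "geo x (Suc (Suc n)) = geo x (Suc n) + x ^ Suc n" by (simp add: geo_def)
    also have "\<dots> \<le> 2 * x ^ n + x ^ Suc n" using Suc by simp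
    also have "\<dots> \<le> x * x ^ n + x ^ Suc n" using Suc.prems by (intro add_right_mono mult_right_mono) auto
    finally show ?case by simp
  qed (simp add: geo_def)
  have "q dvd geo (p ^ r) (G p)" unfolding G_def by (simp add: dvd_geo_iff_geo_ord[OF prime])
  moreover have "geo (p ^ r) (1 + (G p - 1)) > 0" unfolding geo_add by (simp add: geo_def)
  ultimately have "q \<le> geo (p ^ r) (Suc (G p - 1))" using G2 by (simp add: dvd_imp_le)
  also have "\<dots> \<le> 2 * (p ^ r) ^ (G p - 1)"
  proof (rule geo_le)
    have "p \<le> p ^ r" using prime_ge_1_nat[OF p(1)] r0 by (intro self_le_power) auto
    then show "2 \<le> p ^ r" using prime_ge_2_nat[OF p(1)] by linarith
  qed
  also have "(p ^ r) ^ (G p - 1) \<le> (p ^ r) ^ aexp p"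
    using prime_gt_0_nat[OF p(1)] by (intro power_increasing) (auto simp: aexp_def)
  also have "(p ^ r) ^ aexp p = (p ^ aexp p) ^ r" by (simp only: power_mult[symmetric] mult.commute)
  finally have "real q \<le> real (2 * (p ^ aexp p) ^ r)" by (simp only: of_nat_le_iff)
  then have "real q powr (1 / real r) \<le> 2 * real (p ^ aexp p)"
    using prime_gt_0_nat[OF p(1)] r0 by (intro powr_root_le) auto
  then show ?thesis by simp
qed

text \<open>The value a comes from G p = a + 1 or, if a = 2, possibly from G p = 2. In both cases p
  is a root of a binomial congruence modulo q, which has no more roots than its degree.\<close>

lemma card_aexp:
  assumes "finite A" "\<And>p. p \<in> A \<Longrightarrow> prime p \<and> p < q" "a \<ge> 2"
  shows "card {p\<in>A. aexp p = a} \<le> 3 * r * a"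
proof -
  have "{p\<in>A. aexp p = a} \<subseteq> {n\<in>{..<q}. [n ^ (r * (a + 1)) = 1] (mod q)} \<union> {n\<in>{..<q}. [n ^ (r * 2) = 1] (mod q)}"
  proof
    fix p assume "p \<in> {p\<in>A. aexp p = a}"
    then have p: "prime p" "p < q" "aexp p = a" using assms by auto
    then have "G p \<ge> 2" using G_cases[of p] by simp
    then have "G p = a + 1 \<or> G p = 2" using p(3) by (auto simp: aexp_def max_def split: if_splits)
    then show "p \<in> {n\<in>{..<q}. [n ^ (r * (a + 1)) = 1] (mod q)} \<union> {n\<in>{..<q}. [n ^ (r * 2) = 1] (mod q)}"
      using pow_G[of p] p by auto
  qed
  then have "card {p\<in>A. aexp p = a} \<le> card ({n\<in>{..<q}. [n ^ (r * (a + 1)) = 1] (mod q)} \<union> {n\<in>{..<q}. [n ^ (r * 2) = 1] (mod q)})"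
    by (intro card_mono) auto
  also have "\<dots> \<le> card {n\<in>{..<q}. [n ^ (r * (a + 1)) = 1] (mod q)} + card {n\<in>{..<q}. [n ^ (r * 2) = 1] (mod q)}"
    by (rule card_Un_le)
  also have "\<dots> \<le> r * (a + 1) + r * 2"
    using r0 by (intro add_mono roots_mod_prime_bound prime) auto
  also have "\<dots> \<le> 3 * r * a"
  proof -
    have "r * (a + 3) \<le> r * (3 * a)" using assms(3) by (intro mult_left_mono) auto
    then show ?thesis by (simp add: algebra_simps)
  qed
  finally show ?thesis .
qed

text \<open>The order of magnitude of what the powers p^j with j >= \<open>aexp p\<close> contribute
  together.\<close>

definition wt :: "nat \<Rightarrow> real" where "wt p = real (aexp p) * ln (real p) / real p ^ aexp p"

lemma wt_le_square: "prime p \<Longrightarrow> wt p \<le> 2 * (ln (real p) / (real p)\<^sup>2)"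
proof -
  assume p: "prime p"
  have p2: "real p \<ge> 2" using prime_ge_2_nat[OF p] by simp
  obtain b where b: "aexp p = b + 2" using aexp_ge_2[of p] by (metis add.commute le_Suc_ex)
  have "real b + 2 \<le> 2 * 2 ^ b" by (induction b) auto
  also have "\<dots> \<le> 2 * real p ^ b" using p2 by (intro mult_left_mono power_mono) auto
  finally have "real (aexp p) / real p ^ b \<le> 2" using p2 by (simp add: b divide_le_eq)
  then have "real (aexp p) / real p ^ b * (ln (real p) / (real p)\<^sup>2) \<le> 2 * (ln (real p) / (real p)\<^sup>2)"
    using p2 by (intro mult_right_mono) auto
  moreover have "wt p = real (aexp p) / real p ^ b * (ln (real p) / (real p)\<^sup>2)"
    by (simp add: wt_def b power_add power2_eq_square)
  ultimately show ?thesis by simp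
qed

lemma wt_eq: "prime p \<Longrightarrow> wt p = ln (real p ^ aexp p) / real p ^ aexp p"
  using prime_gt_0_nat[of p] by (simp add: wt_def ln_realpow)

lemma floor_sqrt:
  obtains s :: nat where "s \<ge> 1" "real s \<le> sqrt (real q)" "sqrt (real q) \<le> 2 * real s" "s < q"
proof -
  define s where "s = nat \<lfloor>sqrt (real q)\<rfloor>"
  have 1: "1 \<le> sqrt (real q)" using q3 by simp
  then have e: "real s = of_int \<lfloor>sqrt (real q)\<rfloor>" by (simp add: s_def)
  have s1: "s \<ge> 1" using 1 by (simp add: s_def le_nat_floor)
  have le: "real s \<le> sqrt (real q)" unfolding e by (rule of_int_floor_le)
  have "sqrt (real q) < real s + 1" unfolding e by (rule real_of_int_floor_add_one_gt)
  moreover have "real s \<ge> 1" using s1 by simp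
  ultimately have "sqrt (real q) \<le> 2 * real s" by linarith
  moreover have "sqrt (real q) < real q"
    using mult_strict_left_mono[of 1 "sqrt (real q)" "sqrt (real q)"] q3 by simp
  then have "s < q" using le by linarith
  ultimately show ?thesis using that s1 le by blast
qed

lemma sum_square_tail:
  assumes "finite A" "\<And>p. p \<in> A \<Longrightarrow> p > s" "s \<ge> 1" "real s \<le> sqrt (real q)" "sqrt (real q) \<le> 2 * real s"
  shows "(\<Sum>p\<in>A. ln (real p) / (real p)\<^sup>2) \<le> 6 * (ln (real q) / sqrt (real q))"
proof -
  have l: "ln (real q) > 1" using ln_gt_1[of q] q3 by simp
  have sq: "sqrt (real q) > 0" using q3 by simp
  have "sqrt (real q) \<le> real q" using mult_left_mono[of 1 "sqrt (real q)" "sqrt (real q)"] q3 by simp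
  then have lns: "ln (real s) \<le> ln (real q)" using assms by (intro ln_mono) auto
  have "(\<Sum>p\<in>A. ln (real p) / (real p)\<^sup>2) \<le> (2 + ln (real s)) / real s" using assms by (intro sum_ln_over_square_le) auto
  also have "\<dots> \<le> (3 * ln (real q)) / (sqrt (real q) / 2)" using l lns assms sq by (intro frac_le) auto
  finally show ?thesis by simp
qed


text \<open>Primes above sqrt q have weight O(ln p / p^2), and those up to ln q are few enough to be
  bounded singly. The others are sorted by a = \<open>aexp p\<close>. For them p^a reaches Y =
  q^(1/r) once a >= F, with F about ln Y / ln ln q. Up to F there are at most 3 r a primes for each
  a, of weight O(ln Y / Y), and beyond F the weight decays like 2^(F - a) up to a linear factor.
  With r ln Y = ln q the total is O(F^2 ln q / Y).\<close>

lemma sum_wt_le: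
  assumes P: "finite P" "\<And>p. p \<in> P \<Longrightarrow> prime p \<and> p \<noteq> q"
  shows "(\<Sum>p\<in>P. wt p) \<le> 364 * main_err q r + 12 * (ln (real q) / sqrt (real q))"
proof (cases "ln (real q) \<le> real r")
  case True
  have l: "ln (real q) > 1" using ln_gt_1[of q] q3 by simp
  have Y: "real q powr (1 / real r) \<le> 3" using True q3 by (intro powr_inverse_le_3) auto
  have "(\<Sum>p\<in>P. wt p) \<le> (\<Sum>p\<in>P. 2 * (ln (real p) / (real p)\<^sup>2))"
    using P(2) by (intro sum_mono wt_le_square) auto
  also have "\<dots> = 2 * (\<Sum>p\<in>P. ln (real p) / (real p)\<^sup>2)" by (simp add: sum_distrib_left)
  also have "\<dots> \<le> 2 * ((2 + ln (real 1)) / real 1)"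
    using P prime_gt_1_nat by (intro mult_left_mono sum_ln_over_square_le) auto
  also have "\<dots> = 12 * (1 / 3)" by simp
  also have "\<dots> \<le> 12 * (ln (real q) ^ 2 / real q powr (1 / real r))"
    using Y l q3 by (intro mult_left_mono frac_le) (auto simp: one_le_power)
  also have "\<dots> \<le> 12 * main_err q r" using main_err_ge[OF q3, of r] by simp
  also have "\<dots> \<le> 364 * main_err q r" using main_err_nonneg[OF q3, of r] by simp
  also have "\<dots> \<le> 364 * main_err q r + 12 * (ln (real q) / sqrt (real q))" using l by simp
  finally show ?thesis .
next
  case False
  define l where "l = ln (real q)"
  have l: "l > 1" using ln_gt_1[of q] q3 by (simp add: l_def)
  define LL where "LL = ln l"
  have LL: "0 < LL" "LL \<le> l" using ln_ln_bounds[OF q3] by (auto simp: LL_def l_def)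
  define Y where "Y = real q powr (1 / real r)"
  have lnY: "ln Y = l / real r" using q3 by (simp add: Y_def l_def ln_powr)
  have lnY1: "ln Y \<ge> 1" using False r0 by (simp add: lnY l_def)
  have lnYl: "ln Y \<le> l"
  proof -
    have "l / real r \<le> l / 1" using l r0 by (intro divide_left_mono) auto
    then show ?thesis by (simp add: lnY)
  qed
  have Y0: "Y > 0" using q3 by (simp add: Y_def)
  have Y2: "Y \<ge> 2"
  proof -
    have "exp 1 \<le> Y" using lnY1 Y0 by (simp add: ln_ge_iff)
    then show ?thesis using exp_ge_add_one_self[of 1] by linarith
  qed
  define R where "R = ln Y / Y"
  have R0: "R \<ge> 0" unfolding R_def using lnY1 Y0 by (intro divide_nonneg_nonneg) linarith+
  have rR: "real r * R = l / Y" using r0 by (simp add: R_def lnY)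
  have main_eq: "main_err q r = l ^ 3 / (Y * LL)" by (simp add: main_err_def l_def Y_def LL_def)
  obtain s where s: "s \<ge> 1" "real s \<le> sqrt (real q)" "sqrt (real q) \<le> 2 * real s" "s < q" using floor_sqrt .
  define P1 where "P1 = {p\<in>P. p > s}"
  define P2 where "P2 = {p\<in>P. p \<le> s \<and> real p \<le> l}"
  define P3 where "P3 = {p\<in>P. p \<le> s \<and> real p > l}"
  have fin: "finite P1" "finite P2" "finite P3" using P(1) by (auto simp: P1_def P2_def P3_def)
  have split: "(\<Sum>p\<in>P. wt p) = (\<Sum>p\<in>P1. wt p) + ((\<Sum>p\<in>P2. wt p) + (\<Sum>p\<in>P3. wt p))"
  proof -
    have "P = P1 \<union> (P2 \<union> P3)" by (auto simp: P1_def P2_def P3_def)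
    moreover have "P1 \<inter> (P2 \<union> P3) = {}" "P2 \<inter> P3 = {}" by (auto simp: P1_def P2_def P3_def)
    ultimately show ?thesis using fin by (simp add: sum.union_disjoint)
  qed
  have b1: "(\<Sum>p\<in>P1. wt p) \<le> 12 * (ln (real q) / sqrt (real q))"
  proof -
    have "(\<Sum>p\<in>P1. wt p) \<le> (\<Sum>p\<in>P1. 2 * (ln (real p) / (real p)\<^sup>2))"
      using P(2) by (intro sum_mono wt_le_square) (auto simp: P1_def)
    also have "\<dots> = 2 * (\<Sum>p\<in>P1. ln (real p) / (real p)\<^sup>2)" by (simp add: sum_distrib_left)
    also have "\<dots> \<le> 2 * (6 * (ln (real q) / sqrt (real q)))"
      using s fin by (intro mult_left_mono sum_square_tail) (auto simp: P1_def)
    finally show ?thesis by simp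
  qed
  have size: "Y \<le> 2 * real p ^ aexp p" if "p \<in> P" for p
    using aexp_size[of p] P(2)[OF that] by (simp add: Y_def)
  have gen: "wt p \<le> 4 * R" if p: "p \<in> P" for p
  proof -
    have "wt p = ln (real p ^ aexp p) / real p ^ aexp p" using P(2)[OF p] by (simp add: wt_eq)
    also have "\<dots> \<le> (1 + ln (Y / 2)) / (Y / 2)" using size[OF p] Y2 by (intro ln_over_decreasing) auto
    also have "\<dots> \<le> (2 * ln Y) / (Y / 2)"
    proof (rule divide_right_mono)
      have "ln (Y / 2) = ln Y - ln 2" using Y2 by (simp add: ln_div)
      then show "1 + ln (Y / 2) \<le> 2 * ln Y" using lnY1 ln_gt_zero[of "2::real"] by linarith
    qed (use Y2 in simp)
    finally show ?thesis by (simp add: R_def)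
  qed
  have b2: "(\<Sum>p\<in>P2. wt p) \<le> 4 * main_err q r"
  proof -
    have "card P2 \<le> card {1..nat \<lfloor>l\<rfloor>}"
    proof (rule card_mono)
      show "P2 \<subseteq> {1..nat \<lfloor>l\<rfloor>}"
        using P(2) prime_ge_1_nat by (auto simp: P2_def le_nat_floor)
    qed simp
    then have "real (card P2) \<le> real (nat \<lfloor>l\<rfloor>)" by simp
    also have "\<dots> \<le> l" using l by (intro of_nat_floor) auto
    finally have c: "real (card P2) \<le> l" .
    have "(\<Sum>p\<in>P2. wt p) \<le> (\<Sum>p\<in>P2. 4 * R)" by (intro sum_mono gen) (auto simp: P2_def)
    also have "\<dots> = real (card P2) * (4 * R)" by simp
    also have "\<dots> \<le> l * (4 * (l / Y))"
      using c R0 lnYl Y0 l by (intro mult_mono) (auto simp: R_def divide_right_mono)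
    also have "\<dots> = 4 * (ln (real q) ^ 2 / real q powr (1 / real r))" by (simp add: l_def Y_def power2_eq_square)
    also have "\<dots> \<le> 4 * main_err q r" using main_err_ge[OF q3, of r] by simp
    finally show ?thesis .
  qed
  \<comment> \<open>The maximum keeps ln B away from 0 for the smallest q, where ln q is close to
    1.\<close>
  define B where "B = max 2 l"
  have B2: "B \<ge> 2" by (simp add: B_def)
  have lnB_half: "ln B \<ge> 1 / 2"
  proof -
    have "exp (1 / 2 :: real) \<le> 1 + 1 / 2 + (1 / 2)\<^sup>2" by (rule exp_bound) auto
    also have "\<dots> \<le> B" using B2 by (simp add: power2_eq_square)
    finally show ?thesis using B2 by (subst ln_ge_iff) auto
  qed
  have lnB_LL: "ln B \<ge> LL" unfolding LL_def B_def using l by (intro ln_mono) auto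
  \<comment> \<open>The least exponent with Y <= B^F.\<close>
  define F where "F = nat \<lceil>ln Y / ln B\<rceil>"
  have F_real: "real F = of_int \<lceil>ln Y / ln B\<rceil>" using lnY1 lnB_half by (simp add: F_def)
  have F_ge: "ln Y / ln B \<le> real F" unfolding F_real by (rule le_of_int_ceiling)
  have F_le: "real F \<le> ln Y / ln B + 1" unfolding F_real by (rule of_int_ceiling_le_add_one)
  have F1: "F \<ge> 1"
  proof -
    have "ln Y / ln B > 0" using lnY1 lnB_half by simp
    then have "real F > 0" using F_ge by linarith
    then show ?thesis by simp
  qed
  have BF: "Y \<le> B ^ F"
  proof -
    have "ln Y \<le> real F * ln B" using F_ge lnB_half by (simp add: divide_le_eq)
    also have "\<dots> = ln (B ^ F)" using B2 by (simp add: ln_realpow)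
    finally show ?thesis using Y0 B2 by (subst (asm) ln_le_cancel_iff) auto
  qed
  \<comment> \<open>A bound for \<open>wt p\<close> that depends only on the exponent. Beyond F it
    comes from p^a >= Y 2^(a - F), the factor 2 + (a - F) being the growth of the logarithm.\<close>
  define w where "w = (\<lambda>a. if a \<le> F then 4 * R else (2 + real (a - F)) / 2 ^ (a - F) * R)"
  have w0: "w a \<ge> 0" for a using R0 by (simp add: w_def)
  have wtw: "wt p \<le> w (aexp p)" if p: "p \<in> P3" for p
  proof (cases "aexp p \<le> F")
    case True
    then show ?thesis using gen[of p] p by (simp add: w_def P3_def)
  next
    case False
    define i where "i = aexp p - F"
    have ai: "aexp p = F + i" using False by (simp add: i_def)
    have pp: "prime p" "real p > l" using p P(2) by (auto simp: P3_def)
    have pB: "B \<le> real p" using pp prime_ge_2_nat[OF pp(1)] by (simp add: B_def)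
    have Yi: "Y * 2 ^ i \<ge> 1" using mult_mono[of 1 Y 1 "2 ^ i"] Y2 by simp
    have "Y * 2 ^ i \<le> B ^ F * B ^ i" using BF B2 Y0 by (intro mult_mono power_mono) auto
    also have "\<dots> \<le> real p ^ aexp p" unfolding ai power_add[symmetric] using pB B2 by (intro power_mono) auto
    finally have le: "Y * 2 ^ i \<le> real p ^ aexp p" .
    have "wt p = ln (real p ^ aexp p) / real p ^ aexp p" using pp by (simp add: wt_eq)
    also have "\<dots> \<le> (1 + ln (Y * 2 ^ i)) / (Y * 2 ^ i)" by (rule ln_over_decreasing[OF Yi le])
    also have "\<dots> \<le> (ln Y * (2 + real i)) / (Y * 2 ^ i)"
    proof (rule divide_right_mono)
      have "ln (Y * 2 ^ i) = ln Y + real i * ln 2" using Y0 by (simp add: ln_mult ln_realpow)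
      moreover have "real i * ln 2 \<le> real i * 1" using ln_2_less_1 by (intro mult_left_mono) auto
      moreover have "real i * 1 \<le> real i * ln Y" using lnY1 by (intro mult_left_mono) auto
      ultimately show "1 + ln (Y * 2 ^ i) \<le> ln Y * (2 + real i)" using lnY1 by (simp add: algebra_simps)
    qed (use Y0 in auto)
    also have "\<dots> = w (aexp p)" using False by (simp add: w_def i_def R_def mult_ac)
    finally show ?thesis .
  qed
  obtain k where k: "aexp ` P3 \<subseteq> {1..F + k}"
  proof -
    have "a \<le> Max (insert 0 (aexp ` P3))" if "a \<in> aexp ` P3" for a using fin(3) that by (intro Max_ge) auto
    moreover have "a \<ge> 1" if "a \<in> aexp ` P3" for a using that by (auto intro!: le_trans[OF _ aexp_ge_2])
    ultimately have "aexp ` P3 \<subseteq> {1..F + Max (insert 0 (aexp ` P3))}" by (fastforce intro: trans_le_add2)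
    then show ?thesis by (rule that)
  qed
  have b3: "(\<Sum>p\<in>P3. wt p) \<le> 360 * main_err q r"
  proof -
    have "(\<Sum>p\<in>P3. wt p) \<le> (\<Sum>p\<in>P3. w (aexp p))" by (intro sum_mono wtw)
    also have "\<dots> = (\<Sum>a\<in>aexp ` P3. \<Sum>p\<in>{p\<in>P3. aexp p = a}. w (aexp p))"
      by (rule sum.image_gen[OF fin(3)])
    also have "\<dots> = (\<Sum>a\<in>aexp ` P3. real (card {p\<in>P3. aexp p = a}) * w a)"
      by (intro sum.cong refl) simp
    also have "\<dots> \<le> (\<Sum>a\<in>aexp ` P3. (3 * real r * real a) * w a)"
    proof (intro sum_mono mult_right_mono w0)
      fix a assume "a \<in> aexp ` P3"
      then have "a \<ge> 2" using aexp_ge_2 by auto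
      then have "card {p\<in>P3. aexp p = a} \<le> 3 * r * a"
        using fin P(2) s(4) by (intro card_aexp) (auto simp: P3_def)
      then have "real (card {p\<in>P3. aexp p = a}) \<le> real (3 * r * a)" by (simp only: of_nat_le_iff)
      then show "real (card {p\<in>P3. aexp p = a}) \<le> 3 * real r * real a" by simp
    qed
    also have "\<dots> \<le> (\<Sum>a=1..F + k. (3 * real r * real a) * w a)"
      using k w0 by (intro sum_mono2) auto
    also have "\<dots> = (\<Sum>a=1..F. (3 * real r * real a) * w a) + (\<Sum>a=F + 1..F + k. (3 * real r * real a) * w a)"
      by (rule sum.ub_add_nat) simp
    also have "(\<Sum>a=1..F. (3 * real r * real a) * w a) \<le> (\<Sum>a=1..F. (3 * real r * real F) * (4 * R))"
      using R0 by (intro sum_mono mult_mono) (auto simp: w_def)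
    also have "\<dots> = 12 * (real r * R) * real F ^ 2" by (simp add: power2_eq_square)
    also have "(\<Sum>a=F + 1..F + k. (3 * real r * real a) * w a) = (\<Sum>i=1..k. (3 * real r * real (F + i)) * w (F + i))"
      using sum.shift_bounds_cl_nat_ivl[of "\<lambda>a. (3 * real r * real a) * w a" 1 F k] by (simp add: add.commute)
    also have "\<dots> \<le> (\<Sum>i=1..k. (3 * (real r * R) * real F) * (real (i + 1) * real (i + 2) / 2 ^ i))"
    proof (rule sum_mono)
      fix i assume i: "i \<in> {1..k}"
      have "real (F + i) \<le> real F * real (i + 1)"
        using F1 mult_right_mono[of 1 "real F" "real i"] by (simp add: algebra_simps)
      then have "(3 * real r * real (F + i)) * w (F + i) \<le> (3 * real r * (real F * real (i + 1))) * w (F + i)"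
        using w0 by (intro mult_right_mono mult_left_mono) auto
      also have "\<dots> = (3 * (real r * R) * real F) * (real (i + 1) * real (i + 2) / 2 ^ i)"
        using i by (simp add: w_def mult_ac add_ac) (simp add: algebra_simps)
      finally show "(3 * real r * real (F + i)) * w (F + i) \<le> (3 * (real r * R) * real F) * (real (i + 1) * real (i + 2) / 2 ^ i)" .
    qed
    also have "\<dots> = (3 * (real r * R) * real F) * (\<Sum>i=1..k. real (i + 1) * real (i + 2) / 2 ^ i)"
      by (rule sum_distrib_left[symmetric])
    also have "\<dots> \<le> (3 * (real r * R) * real F) * 16"
    proof (rule mult_left_mono)
      have "(\<Sum>i=1..k. real (i + 1) * real (i + 2) / 2 ^ i) \<le> (\<Sum>i<Suc k. real (i + 1) * real (i + 2) / 2 ^ i)"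
        by (intro sum_mono2) auto
      also have "\<dots> \<le> 16" by (rule sum_quadratic_half_powers)
      finally show "(\<Sum>i=1..k. real (i + 1) * real (i + 2) / 2 ^ i) \<le> 16" .
    qed (use R0 in auto)
    also have "\<dots> = 48 * (real r * R) * real F" by simp
    also have "\<dots> \<le> 48 * (real r * R) * real F ^ 2"
      using R0 F1 self_le_power[of "real F" 2] by (intro mult_left_mono) auto
    finally have 1: "(\<Sum>p\<in>P3. wt p) \<le> 60 * (l / Y) * real F ^ 2" unfolding rR by simp
    have F2: "real F ^ 2 \<le> 6 * (l ^ 2 / LL)"
    proof -
      have "ln Y / ln B \<le> l / ln B" using lnYl lnB_half by (intro divide_right_mono) auto
      then have a: "real F ^ 2 \<le> (l / ln B + 1) ^ 2" using F_le by (intro power_mono) auto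
      have b: "(u + 1) ^ 2 \<le> 2 * u ^ 2 + 2" for u :: real
        using zero_le_power2[of "u - 1"] by (simp add: power2_sum power2_diff)
      \<comment> \<open>One factor ln B is bounded below by ln ln q and the other by 1/2, so a
        single ln ln q remains in the denominator, valid also when it is small.\<close>
      have c: "(l / ln B) ^ 2 \<le> 2 * (l ^ 2 / LL)"
      proof -
        have "LL / 2 \<le> ln B * ln B" using mult_mono[OF lnB_LL lnB_half] LL lnB_half by simp
        then have "l ^ 2 / (ln B * ln B) \<le> l ^ 2 / (LL / 2)" using LL lnB_half by (intro divide_left_mono) auto
        then show ?thesis by (simp add: power_divide power2_eq_square mult_ac)
      qed
      have d: "2 \<le> 2 * (l ^ 2 / LL)"
      proof -
        have "LL \<le> l ^ 2" using LL l self_le_power[of l 2] by simp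
        then have "1 \<le> l ^ 2 / LL" using LL by (simp add: le_divide_eq)
        then show ?thesis by simp
      qed
      show ?thesis using a b[of "l / ln B"] c d by linarith
    qed
    have "60 * (l / Y) * real F ^ 2 \<le> 60 * (l / Y) * (6 * (l ^ 2 / LL))"
      using F2 l Y0 by (intro mult_left_mono) auto
    also have "\<dots> = 360 * main_err q r" unfolding main_eq by (simp add: power2_eq_square power3_eq_cube)
    finally show ?thesis using 1 by linarith
  qed
  show ?thesis unfolding split using b1 b2 b3 by linarith
qed

end

section \<open>The residual series\<close>

text \<open>Prime powers below N have base and exponent at most N, so bounds over finite boxes of
  pairs (p, j) control every partial sum.\<close>

lemma primepow_summable:
  fixes f :: "nat \<Rightarrow> real"
  assumes nonneg: "\<And>n. f n \<ge> 0" and supp: "\<And>n. \<not> primepow n \<Longrightarrow> f n = 0"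
    and bound: "\<And>P J. finite P \<Longrightarrow> (\<And>p. p \<in> P \<Longrightarrow> prime p) \<Longrightarrow> (\<Sum>p\<in>P. \<Sum>j=1..J. f (p ^ j)) \<le> B"
  shows "summable f" "suminf f \<le> B"
proof -
  have part: "(\<Sum>n<N. f n) \<le> B" for N
  proof -
    let ?P = "{p. p < N \<and> prime p}" and ?J = "{1..N}"
    have inj: "inj_on (\<lambda>(p,j). p ^ j) (?P \<times> ?J)"
      by (auto simp: inj_on_def prime_power_inj'' Suc_le_eq)
    have "(\<Sum>n<N. f n) = (\<Sum>n\<in>{n. n < N \<and> primepow n}. f n)"
      using supp by (intro sum.mono_neutral_right) auto
    also have "\<dots> \<le> (\<Sum>n\<in>(\<lambda>(p,j). p ^ j) ` (?P \<times> ?J). f n)"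
    proof (intro sum_mono2 nonneg)
      show "{n. n < N \<and> primepow n} \<subseteq> (\<lambda>(p,j). p ^ j) ` (?P \<times> ?J)"
      proof
        fix n assume "n \<in> {n. n < N \<and> primepow n}"
        then obtain p j where n: "n < N" "prime p" "j > 0" "n = p ^ j" by (auto simp: primepow_def)
        have "p \<le> n" using n prime_ge_1_nat[of p] by (auto intro: self_le_power)
        moreover have "j < 2 ^ j" by simp
        then have "j < n" using n power_mono[OF prime_ge_2_nat[OF n(2)], of j] by linarith
        ultimately have "(p, j) \<in> ?P \<times> ?J" using n by auto
        then show "n \<in> (\<lambda>(p,j). p ^ j) ` (?P \<times> ?J)" using n(4) by (auto intro!: image_eqI[of _ _ "(p, j)"])
      qed
    qed auto
    also have "\<dots> = (\<Sum>(p,j)\<in>?P \<times> ?J. f (p ^ j))" using inj by (subst sum.reindex) (auto simp: case_prod_unfold)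
    also have "\<dots> = (\<Sum>p\<in>?P. \<Sum>j=1..N. f (p ^ j))" by (rule sum.cartesian_product[symmetric])
    also have "\<dots> \<le> B" by (rule bound) auto
    finally show ?thesis .
  qed
  show "summable f" by (rule summableI_nonneg_bounded[OF nonneg part])
  then show "suminf f \<le> B" by (rule suminf_le_const[OF _ part])
qed

lemma geometric_subset_le:
  assumes x: "0 \<le> (x::real)" "x \<le> 1 / 2" and A: "finite A" "\<And>j. j \<in> A \<Longrightarrow> x ^ j \<le> M" and M: "M \<ge> 0"
  shows "(\<Sum>j\<in>A. x ^ j) \<le> 2 * M"
proof (cases "A = {}")
  case False
  define a where "a = Min A"
  have a: "a \<in> A" "\<And>j. j \<in> A \<Longrightarrow> a \<le> j" using A(1) False by (auto simp: a_def)
  have "A \<subseteq> {a..<a + Suc (Max A)}" using a(2) Max_ge[OF A(1)] by (auto simp: less_Suc_eq_le trans_le_add2)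
  then have "(\<Sum>j\<in>A. x ^ j) \<le> (\<Sum>j=a..<a + Suc (Max A). x ^ j)" using x by (intro sum_mono2) auto
  also have "\<dots> \<le> 2 * x ^ a" by (rule geometric_tail_le[OF x])
  finally show ?thesis using A(2)[OF a(1)] by linarith
qed (use M in simp)

context divisor_setup
begin

definition m :: nat where "m = (q - 1) div r"
text \<open>The coefficient of the pole 1 / (x - 1) in the series of Lambda h. As the value of h at
  multiples of q it makes \<open>hfun\<close> equal to \<open>ht\<close> for even m and identically
  0 for odd m.\<close>

definition dens :: real where "dens = (if even m then 1 / real m else 0)"
definition hfun :: "nat \<Rightarrow> real" where
  "hfun n = (if q dvd n then dens else if q dvd n ^ r + 1 then 1 else 0)"
definition resid :: "nat \<Rightarrow> real" where "resid n = dcoef G n - mangoldt n * hfun n"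

lemma rm: "r * m = q - 1" using r_dvd by (simp add: m_def)
lemma m_pos: "m > 0" using rm q3 by (auto intro!: Nat.gr0I)
lemma dens_bounds: "0 \<le> dens" "dens \<le> 1 / 2"
proof -
  show "0 \<le> dens" by (simp add: dens_def)
  show "dens \<le> 1 / 2"
  proof (cases "even m")
    case True
    then have "m \<ge> 2" using m_pos by (auto elim!: evenE)
    then show ?thesis by (simp add: dens_def field_simps)
  qed (simp add: dens_def)
qed
lemma hfun_bounds: "0 \<le> hfun n" "hfun n \<le> 1" using dens_bounds by (auto simp: hfun_def)

lemma not_dvd_add_1: "q dvd n ^ r + 1 \<Longrightarrow> \<not> q dvd n"
proof
  assume 1: "q dvd n ^ r + 1" and "q dvd n"
  then have "q dvd n ^ r" using r0 by (meson dvd_power dvd_trans)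
  then have "q dvd 1" using 1 dvd_add_right_iff[of q "n ^ r" 1] by blast
  then show False using q3 by simp
qed

text \<open>At exponent 1 the local coefficient is 1 if G p = 2 and 0 otherwise, and G p = 2 means
  p^r = -1 modulo q.\<close>

lemma resid_prime: "prime p \<Longrightarrow> p \<noteq> q \<Longrightarrow> resid p = 0"
proof -
  assume p: "prime p" "p \<noteq> q"
  have nq: "\<not> q dvd p" using p prime primes_dvd_imp_eq by blast
  have d: "dcoef G p = ln (real p) * local_coeff (G p) 1" using dcoef_prime_power[OF p(1), of 1 G] by simp
  have "G p \<ge> 2" using G_cases[OF p] .
  then have "local_coeff (G p) 1 = (if G p = 2 then 1 else 0)" by (auto simp: local_coeff_def)
  then show ?thesis using p nq G_eq_2_iff[of p] by (simp add: resid_def d hfun_def)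
qed

lemma local_coeff_eq_0: "prime p \<Longrightarrow> p \<noteq> q \<Longrightarrow> 2 \<le> j \<Longrightarrow> j < aexp p \<Longrightarrow> local_coeff (G p) j = 0"
proof -
  assume p: "prime p" "p \<noteq> q" and j: "2 \<le> j" "j < aexp p"
  have "j < G p - 1" using j by (auto simp: aexp_def max_def split: if_splits)
  then have "\<not> (G p - 1) dvd j" "\<not> G p dvd j" using j by (auto dest!: dvd_imp_le)
  then show ?thesis by (simp add: local_coeff_def)
qed

lemma dcoef_part:
  assumes p: "prime p" "p \<noteq> q"
  shows "(\<Sum>j=2..J. \<bar>dcoef G (p ^ j)\<bar> / real (p ^ j)) \<le> 6 * wt p"
proof -
  define x where "x = 1 / real p"
  have p2: "real p \<ge> 2" using prime_ge_2_nat[OF p(1)] by simp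
  have x: "0 \<le> x" "x \<le> 1 / 2" using p2 by (auto simp: x_def)
  define a where "a = aexp p"
  have a2: "a \<ge> 2" using aexp_ge_2 by (simp add: a_def)
  have lp: "ln (real p) \<ge> 0" using p2 by simp
  have "(\<Sum>j=2..J. \<bar>dcoef G (p ^ j)\<bar> / real (p ^ j)) \<le> (\<Sum>j=2..J. if a \<le> j then ln (real p) * (2 * (real j * x ^ j)) else 0)"
  proof (rule sum_mono)
    fix j assume j: "j \<in> {2..J}"
    have "\<bar>dcoef G (p ^ j)\<bar> / real (p ^ j) = ln (real p) * (\<bar>local_coeff (G p) j\<bar> * x ^ j)"
      using j lp by (simp add: dcoef_prime_power[OF p(1)] abs_mult x_def power_divide)
    moreover have "local_coeff (G p) j = 0" if "j < a" using local_coeff_eq_0[OF p, of j] j that by (simp add: a_def)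
    moreover have "\<bar>local_coeff (G p) j\<bar> * x ^ j \<le> (2 * real j) * x ^ j" using j x norm_local_coeff_le[of j "G p"] by (intro mult_right_mono) auto
    ultimately show "\<bar>dcoef G (p ^ j)\<bar> / real (p ^ j) \<le> (if a \<le> j then ln (real p) * (2 * (real j * x ^ j)) else 0)"
      using lp by (auto simp: not_le mult.assoc intro!: mult_left_mono)
  qed
  also have "\<dots> = (\<Sum>j\<in>{j\<in>{2..J}. a \<le> j}. ln (real p) * (2 * (real j * x ^ j)))"
    by (rule sum.inter_filter[symmetric]) simp
  also have "\<dots> \<le> (\<Sum>j=a..<a + Suc J. ln (real p) * (2 * (real j * x ^ j)))"
    using lp x by (intro sum_mono2) auto
  also have "\<dots> = ln (real p) * 2 * (\<Sum>j=a..<a + Suc J. real j * x ^ j)" by (simp only: sum_distrib_left mult.assoc)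
  also have "\<dots> \<le> ln (real p) * 2 * ((2 * real a + 2) * x ^ a)" using lp by (intro mult_left_mono arith_geometric_tail_le x) auto
  \<comment> \<open>Here 2 a + 2 <= 3 a because \<open>aexp\<close> is at least 2.\<close>
  also have "\<dots> \<le> ln (real p) * 2 * ((3 * real a) * x ^ a)" using lp x a2 by (intro mult_left_mono mult_right_mono) auto
  also have "\<dots> = 6 * wt p" by (simp add: wt_def a_def x_def power_divide)
  finally show ?thesis .
qed

text \<open>Powers p^j < q on which h is 1 are distinct solutions of n^r = -1 and are covered by
  \<open>head\<close>. For p^j >= q the geometric tail is at most 2 / q for each p up to sqrt q and
  at most 2 / p^2 for larger p.\<close>

lemma hfun_part:
  assumes P: "finite P" "\<And>p. p \<in> P \<Longrightarrow> prime p \<and> p \<noteq> q"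
  shows "(\<Sum>p\<in>P. \<Sum>j=2..J. ln (real p) * hfun (p ^ j) / real (p ^ j)) \<le> head q r + 14 * (ln (real q) / sqrt (real q))"
proof -
  have l: "ln (real q) > 1" using ln_gt_1[of q] q3 by simp
  let ?t = "\<lambda>p j. ln (real p) / real (p ^ j)"
  have lp: "ln (real p) \<ge> 0" if "p \<in> P" for p using P(2)[OF that] prime_ge_1_nat[of p] by simp
  have hf: "hfun (p ^ j) = (if q dvd (p ^ j) ^ r + 1 then 1 else 0)" if "p \<in> P" for p j
  proof -
    have "\<not> q dvd p" using P(2)[OF that] prime primes_dvd_imp_eq by blast
    then have "\<not> q dvd p ^ j" using prime prime_dvd_power by blast
    then show ?thesis by (simp add: hfun_def)
  qed
  have "(\<Sum>p\<in>P. \<Sum>j=2..J. ln (real p) * hfun (p ^ j) / real (p ^ j)) \<le>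
     (\<Sum>p\<in>P. \<Sum>j=2..J. (if p ^ j < q \<and> q dvd (p ^ j) ^ r + 1 then ?t p j else 0) + (if q \<le> p ^ j then ?t p j else 0))"
    using lp by (intro sum_mono) (auto simp: hf)
  also have "\<dots> = (\<Sum>p\<in>P. \<Sum>j=2..J. if p ^ j < q \<and> q dvd (p ^ j) ^ r + 1 then ?t p j else 0) + (\<Sum>p\<in>P. \<Sum>j=2..J. if q \<le> p ^ j then ?t p j else 0)"
    by (simp only: sum.distrib)
  also have "(\<Sum>p\<in>P. \<Sum>j=2..J. if p ^ j < q \<and> q dvd (p ^ j) ^ r + 1 then ?t p j else 0) \<le> head q r"
  proof -
    let ?A = "{y\<in>P \<times> {2..J}. fst y ^ snd y < q \<and> q dvd (fst y ^ snd y) ^ r + 1}"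
    have inj: "inj_on (\<lambda>y. fst y ^ snd y) ?A"
      using P(2) by (auto simp: inj_on_def prime_power_inj'')
    have "(\<Sum>p\<in>P. \<Sum>j=2..J. if p ^ j < q \<and> q dvd (p ^ j) ^ r + 1 then ?t p j else 0) =
       (\<Sum>y\<in>P \<times> {2..J}. if fst y ^ snd y < q \<and> q dvd (fst y ^ snd y) ^ r + 1 then ?t (fst y) (snd y) else 0)"
      by (simp add: sum.cartesian_product case_prod_unfold)
    also have "\<dots> = (\<Sum>y\<in>?A. ?t (fst y) (snd y))" using P(1) by (intro sum.inter_filter[symmetric]) simp
    also have "\<dots> \<le> (\<Sum>y\<in>?A. ln (real (fst y ^ snd y)) / real (fst y ^ snd y))"
    proof (intro sum_mono divide_right_mono)
      fix y assume y: "y \<in> ?A"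
      then have "fst y ^ 1 \<le> fst y ^ snd y" using P(2)[of "fst y"] prime_ge_1_nat[of "fst y"] by (intro power_increasing) auto
      moreover have "fst y > 0" using y P(2)[of "fst y"] prime_gt_0_nat by auto
      ultimately show "ln (real (fst y)) \<le> ln (real (fst y ^ snd y))" by (intro ln_mono) auto
    qed auto
    also have "\<dots> = (\<Sum>n\<in>(\<lambda>y. fst y ^ snd y) ` ?A. ln (real n) / real n)"
      using sum.reindex[OF inj, of "\<lambda>n. ln (real n) / real n"] by (simp add: o_def)
    also have "\<dots> \<le> head q r" unfolding head_def
    proof (rule sum_mono2)
      show "ln (real n) / real n \<ge> 0" for n by (cases "n = 0") auto
    qed auto
    finally show ?thesis .
  qed
  also have "(\<Sum>p\<in>P. \<Sum>j=2..J. if q \<le> p ^ j then ?t p j else 0) \<le> 14 * (ln (real q) / sqrt (real q))"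
  proof -
    obtain s where s: "s \<ge> 1" "real s \<le> sqrt (real q)" "sqrt (real q) \<le> 2 * real s" "s < q" using floor_sqrt .
    \<comment> \<open>Every term with j >= 2 and p^j >= q obeys both bounds M; small p use the one
      in q, large p the one in p.\<close>
    have inner: "(\<Sum>j=2..J. if q \<le> p ^ j then ?t p j else 0) \<le> ln (real p) * (2 * M)"
      if p: "p \<in> P" and M: "M = 1 / real q \<or> M = 1 / (real p)\<^sup>2" for p M
    proof -
      have pp: "prime p" using P(2)[OF p] by simp
      have p2: "real p \<ge> 2" using prime_ge_2_nat[OF pp] by simp
      have "(\<Sum>j=2..J. if q \<le> p ^ j then ?t p j else 0) = (\<Sum>j\<in>{j\<in>{2..J}. q \<le> p ^ j}. ?t p j)"
        by (rule sum.inter_filter[symmetric]) simp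
      also have "\<dots> = ln (real p) * (\<Sum>j\<in>{j\<in>{2..J}. q \<le> p ^ j}. (1 / real p) ^ j)"
        by (simp add: sum_distrib_left power_divide)
      also have "\<dots> \<le> ln (real p) * (2 * M)"
      proof (intro mult_left_mono geometric_subset_le lp[OF p])
        fix j assume "j \<in> {j\<in>{2..J}. q \<le> p ^ j}"
        then have j: "j \<ge> 2" "q \<le> p ^ j" by auto
        have "real q \<le> real p ^ j" using j(2) by (metis of_nat_le_iff of_nat_power)
        then have "(1 / real p) ^ j \<le> 1 / real q" using q3 p2 by (simp add: power_divide frac_le)
        moreover have "(1 / real p) ^ j \<le> (1 / real p) ^ 2" using j p2 by (intro power_decreasing) auto
        ultimately show "(1 / real p) ^ j \<le> M" using M by (auto simp: power_divide)
      qed (use p2 M in auto)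
      finally show ?thesis .
    qed
    have "(\<Sum>p\<in>P. \<Sum>j=2..J. if q \<le> p ^ j then ?t p j else 0) =
       (\<Sum>p\<in>{p\<in>P. p \<le> s}. \<Sum>j=2..J. if q \<le> p ^ j then ?t p j else 0) + (\<Sum>p\<in>{p\<in>P. s < p}. \<Sum>j=2..J. if q \<le> p ^ j then ?t p j else 0)"
    proof -
      have "P = {p\<in>P. p \<le> s} \<union> {p\<in>P. s < p}" by auto
      moreover have "{p\<in>P. p \<le> s} \<inter> {p\<in>P. s < p} = {}" by auto
      ultimately show ?thesis using P(1) by (metis (no_types, lifting) finite_Un sum.union_disjoint)
    qed
    also have "(\<Sum>p\<in>{p\<in>P. p \<le> s}. \<Sum>j=2..J. if q \<le> p ^ j then ?t p j else 0) \<le> (\<Sum>p\<in>{p\<in>P. p \<le> s}. ln (real q) * (2 * (1 / real q)))"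
    proof (rule sum_mono)
      fix p assume p: "p \<in> {p\<in>P. p \<le> s}"
      then have "(\<Sum>j=2..J. if q \<le> p ^ j then ?t p j else 0) \<le> ln (real p) * (2 * (1 / real q))" by (intro inner) auto
      also have "\<dots> \<le> ln (real q) * (2 * (1 / real q))"
        using p s P(2)[of p] prime_gt_0_nat[of p] by (intro mult_right_mono ln_mono) auto
      finally show "(\<Sum>j=2..J. if q \<le> p ^ j then ?t p j else 0) \<le> ln (real q) * (2 * (1 / real q))" .
    qed
    also have "\<dots> = real (card {p\<in>P. p \<le> s}) * (ln (real q) * (2 * (1 / real q)))" by simp
    also have "\<dots> \<le> sqrt (real q) * (ln (real q) * (2 * (1 / real q)))"
    proof (rule mult_right_mono)
      have "card {p\<in>P. p \<le> s} \<le> card {1..s}" using P(2) prime_ge_1_nat by (intro card_mono) auto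
      then have "real (card {p\<in>P. p \<le> s}) \<le> real s" by simp
      then show "real (card {p\<in>P. p \<le> s}) \<le> sqrt (real q)" using s by linarith
    qed (use l in auto)
    also have "\<dots> = 2 * (ln (real q) / sqrt (real q))" using q3 by (simp add: field_simps)
    also have "(\<Sum>p\<in>{p\<in>P. s < p}. \<Sum>j=2..J. if q \<le> p ^ j then ?t p j else 0) \<le> (\<Sum>p\<in>{p\<in>P. s < p}. ln (real p) * (2 * (1 / (real p)\<^sup>2)))"
      by (intro sum_mono inner) auto
    also have "\<dots> = 2 * (\<Sum>p\<in>{p\<in>P. s < p}. ln (real p) / (real p)\<^sup>2)" by (simp add: sum_distrib_left mult_ac)
    also have "\<dots> \<le> 2 * (6 * (ln (real q) / sqrt (real q)))"
      using s P(1) by (intro mult_left_mono sum_square_tail) auto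
    finally show ?thesis by simp
  qed
  finally show ?thesis by simp
qed

lemma ln_over_sqrt_le: "ln (real q) / sqrt (real q) \<le> sqrt_err q r"
proof -
  have l: "ln (real q) > 1" using ln_gt_1[of q] q3 by simp
  have "1 * ln (real q) \<le> real r * ln (real q) ^ 2"
    using l r0 self_le_power[of "ln (real q)" 2] by (intro mult_mono) auto
  then show ?thesis unfolding sqrt_err_def by (intro divide_right_mono) auto
qed

text \<open>At p = q the local coefficients are 0 and only h remains; for other p the exponent 1
  cancels by \<open>resid_prime\<close>. The constants are 2190 = 6 * 364 + 6 and 88 = 2 + 6 * 12 +
  14.\<close>

lemma resid_sum_le:
  assumes P: "finite P" "\<And>p. p \<in> P \<Longrightarrow> prime p"
  shows "(\<Sum>p\<in>P. \<Sum>j=1..J. \<bar>resid (p ^ j)\<bar> / real (p ^ j)) \<le> 2190 * main_err q r + 88 * sqrt_err q r"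
proof -
  have l: "ln (real q) > 1" using ln_gt_1[of q] q3 by simp
  have q_part: "(\<Sum>j=1..J. \<bar>resid (q ^ j)\<bar> / real (q ^ j)) \<le> 2 * (ln (real q) / sqrt (real q))"
  proof -
    have "(\<Sum>j=1..J. \<bar>resid (q ^ j)\<bar> / real (q ^ j)) \<le> (\<Sum>j=1..J. ln (real q) * (1 / real q) ^ j)"
    proof (rule sum_mono)
      fix j assume j: "j \<in> {1..J}"
      have "G q = 0" using G_eq_0_iff[OF prime] by simp
      then have "dcoef G (q ^ j) = 0" using j dcoef_prime_power[OF prime, of j G] by (simp add: local_coeff_def)
      then have "\<bar>resid (q ^ j)\<bar> = ln (real q) * hfun (q ^ j)" using j prime l hfun_bounds by (simp add: resid_def abs_mult)
      also have "\<dots> \<le> ln (real q) * 1" using l hfun_bounds by (intro mult_left_mono) auto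
      finally show "\<bar>resid (q ^ j)\<bar> / real (q ^ j) \<le> ln (real q) * (1 / real q) ^ j"
        by (simp add: power_divide divide_right_mono)
    qed
    also have "\<dots> = ln (real q) * (\<Sum>j=1..J. (1 / real q) ^ j)" by (simp add: sum_distrib_left)
    also have "\<dots> \<le> ln (real q) * (2 * (1 / real q))"
      using l q3 by (intro mult_left_mono geometric_subset_le) (auto simp: power_le_one power_divide intro!: divide_left_mono self_le_power)
    also have "\<dots> = 2 * (ln (real q) / real q)" by simp
    also have "\<dots> \<le> 2 * (ln (real q) / sqrt (real q))"
      using l q3 mult_left_mono[of 1 "sqrt (real q)" "sqrt (real q)"] by (intro mult_left_mono divide_left_mono) auto
    finally show ?thesis .
  qed
  have "(\<Sum>p\<in>P. \<Sum>j=1..J. \<bar>resid (p ^ j)\<bar> / real (p ^ j)) \<le>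
     (\<Sum>p\<in>insert q (P - {q}). \<Sum>j=1..J. \<bar>resid (p ^ j)\<bar> / real (p ^ j))"
    using P(1) by (intro sum_mono2) (auto intro!: sum_nonneg)
  also have "\<dots> = (\<Sum>j=1..J. \<bar>resid (q ^ j)\<bar> / real (q ^ j)) + (\<Sum>p\<in>P - {q}. \<Sum>j=1..J. \<bar>resid (p ^ j)\<bar> / real (p ^ j))"
    using P(1) by (subst sum.insert) auto
  also have "(\<Sum>p\<in>P - {q}. \<Sum>j=1..J. \<bar>resid (p ^ j)\<bar> / real (p ^ j)) \<le>
     (\<Sum>p\<in>P - {q}. 6 * wt p + (\<Sum>j=2..J. ln (real p) * hfun (p ^ j) / real (p ^ j)))"
  proof (rule sum_mono)
    fix p assume "p \<in> P - {q}"
    then have p: "prime p" "p \<noteq> q" using P by auto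
    have lp: "ln (real p) \<ge> 0" using prime_ge_1_nat[OF p(1)] by simp
    have "i = 1" if "i \<in> {1..J} - {2..J}" for i using that by auto
    then have "(\<Sum>j=1..J. \<bar>resid (p ^ j)\<bar> / real (p ^ j)) = (\<Sum>j=2..J. \<bar>resid (p ^ j)\<bar> / real (p ^ j))"
      using resid_prime[OF p] by (intro sum.mono_neutral_right) force+
    also have "\<dots> \<le> (\<Sum>j=2..J. \<bar>dcoef G (p ^ j)\<bar> / real (p ^ j) + ln (real p) * hfun (p ^ j) / real (p ^ j))"
    proof (rule sum_mono)
      fix j assume j: "j \<in> {2..J}"
      have "\<bar>resid (p ^ j)\<bar> \<le> \<bar>dcoef G (p ^ j)\<bar> + ln (real p) * hfun (p ^ j)"
        using j p(1) lp hfun_bounds[of "p ^ j"] by (simp add: resid_def) (smt (verit) mult_nonneg_nonneg)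
      then show "\<bar>resid (p ^ j)\<bar> / real (p ^ j) \<le> \<bar>dcoef G (p ^ j)\<bar> / real (p ^ j) + ln (real p) * hfun (p ^ j) / real (p ^ j)"
        by (simp add: add_divide_distrib[symmetric] divide_right_mono)
    qed
    also have "\<dots> \<le> 6 * wt p + (\<Sum>j=2..J. ln (real p) * hfun (p ^ j) / real (p ^ j))"
      unfolding sum.distrib by (intro add_right_mono dcoef_part p)
    finally show "(\<Sum>j=1..J. \<bar>resid (p ^ j)\<bar> / real (p ^ j)) \<le> 6 * wt p + (\<Sum>j=2..J. ln (real p) * hfun (p ^ j) / real (p ^ j))" .
  qed
  also have "\<dots> = 6 * (\<Sum>p\<in>P - {q}. wt p) + (\<Sum>p\<in>P - {q}. \<Sum>j=2..J. ln (real p) * hfun (p ^ j) / real (p ^ j))"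
    by (simp add: sum.distrib sum_distrib_left)
  also have "\<dots> \<le> 6 * (364 * main_err q r + 12 * (ln (real q) / sqrt (real q))) + (head q r + 14 * (ln (real q) / sqrt (real q)))"
    using P by (intro add_mono mult_left_mono sum_wt_le hfun_part) auto
  finally have "(\<Sum>p\<in>P. \<Sum>j=1..J. \<bar>resid (p ^ j)\<bar> / real (p ^ j)) \<le> (\<Sum>j=1..J. \<bar>resid (q ^ j)\<bar> / real (q ^ j)) +
    (6 * (364 * main_err q r + 12 * (ln (real q) / sqrt (real q))) + (head q r + 14 * (ln (real q) / sqrt (real q))))"
    by simp
  moreover have "s \<le> 2190 * M + 88 * S"
    if "s \<le> s' + (6 * (364 * M + 12 * u) + (h + 14 * u))" "s' \<le> 2 * u" "h \<le> 6 * M" "u \<le> S" for s s' M S u h :: real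
    using that by simp
  ultimately show ?thesis using q_part head_le[OF prime q3 r0] ln_over_sqrt_le by blast
qed

section \<open>The Euler-Kronecker constant\<close>

lemma resid_eq_0: "\<not> primepow n \<Longrightarrow> resid n = 0"
  by (simp add: resid_def dcoef_def mangoldt_def)

lemma subpoly_mangoldt_hfun: "subpoly (\<lambda>n. of_real (mangoldt n * hfun n))"
proof (rule subpoly_mono[OF subpoly_mangoldt, where C = 1])
  fix n :: nat
  show "norm (complex_of_real (mangoldt n * hfun n)) \<le> 1 * norm (complex_of_real (mangoldt n))"
    using mult_left_mono[OF hfun_bounds(2)[of n] mangoldt_nonneg[of n]] hfun_bounds[of n] mangoldt_nonneg[of n]
    by (simp add: norm_mult)
qed

text \<open>Dominated convergence: for x > 1 each term is bounded by its absolute value at 1, and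
  those are summable by \<open>resid_sum_le\<close>.\<close>

lemma resid_limit:
  obtains e where "((\<lambda>x. ds (\<lambda>n. of_real (resid n)) (of_real x)) \<longlongrightarrow> e) (at_right 1)"
    "norm e \<le> 2190 * main_err q r + 88 * sqrt_err q r"
proof -
  let ?f = "\<lambda>n. \<bar>resid n\<bar> / real n"
  let ?e = "\<Sum>n. complex_of_real (resid n / real n)"
  have summ: "summable ?f" and le: "suminf ?f \<le> 2190 * main_err q r + 88 * sqrt_err q r"
    using primepow_summable[of ?f "2190 * main_err q r + 88 * sqrt_err q r"] resid_eq_0 resid_sum_le by auto
  have "((\<lambda>x. \<Sum>n. complex_of_real (resid n) * of_nat n powr (- of_real x)) \<longlongrightarrow> ?e) (at_right (1::real))"
  proof (rule tannerys_theorem[THEN conjunct2, THEN conjunct2])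
    fix n
    show "((\<lambda>x. complex_of_real (resid n) * of_nat n powr (- of_real x)) \<longlongrightarrow> complex_of_real (resid n / real n)) (at_right (1::real))"
    proof (cases "n = 0")
      case False
      have "((\<lambda>x. complex_of_real (resid n) * of_nat n powr (- of_real x)) \<longlongrightarrow> complex_of_real (resid n) * of_nat n powr (- of_real 1)) (at_right (1::real))"
        using False by (intro tendsto_intros) auto
      then show ?thesis using False by (simp add: powr_minus divide_inverse)
    qed simp
  next
    show "\<forall>\<^sub>F (k, x) in sequentially \<times>\<^sub>F at_right (1::real). norm (complex_of_real (resid k) * of_nat k powr (- of_real x)) \<le> ?f k"
    proof -
      have "\<forall>\<^sub>F (k, x) in (sequentially :: nat filter) \<times>\<^sub>F at_right (1::real). x > 1 \<and> x < 2"
        using eventually_at_right_1_2 by (subst eventually_prod2) auto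
      then show ?thesis
      proof eventually_elim
        case (elim y)
        obtain k x where y: "y = (k, x)" by (cases y)
        with elim have x: "x > 1" by simp
        show ?case
        proof (cases "k = 0")
          case False
          then have "real k powr (- x) \<le> real k powr (- 1)" using x by (intro powr_mono) auto
          then have "real k powr (- x) \<le> 1 / real k" using False by (simp add: powr_minus divide_inverse)
          from mult_left_mono[OF this, of "\<bar>resid k\<bar>"] show ?thesis
            by (simp add: y norm_mult norm_of_nat_powr_minus)
        qed (simp add: y)
      qed
    qed
  qed (use summ in auto)
  moreover have "norm ?e \<le> suminf ?f"
  proof -
    have "summable (\<lambda>n. norm (complex_of_real (resid n / real n)))" using summ by (simp add: norm_divide)
    from summable_norm[OF this] show ?thesis by (simp add: norm_divide)
  qed
  ultimately show ?thesis using le by (intro that[of ?e]) (auto simp: ds_def)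
qed

text \<open>Raising n^r = -1 to the odd power m would give n^(q - 1) = -1, against Fermat.\<close>

lemma not_dvd_power_add_1_if_odd:
  assumes "odd m" shows "\<not> q dvd n ^ r + 1"
proof
  assume d: "q dvd n ^ r + 1"
  then have nq: "\<not> q dvd n" by (rule not_dvd_add_1)
  have "int q dvd int n ^ r + 1" using d by (metis of_nat_1 of_nat_add of_nat_dvd_iff of_nat_power)
  then have "[int n ^ r = - 1] (mod int q)" by (simp add: cong_iff_dvd_diff)
  then have "[(int n ^ r) ^ m = (- 1) ^ m] (mod int q)" by (rule cong_pow)
  then have "[int n ^ (q - 1) = - 1] (mod int q)" using assms by (simp add: power_mult[symmetric] rm)
  moreover have "[int n ^ (q - 1) = 1] (mod int q)"
    using fermat_theorem[OF prime nq] by (metis cong_int_iff of_nat_1 of_nat_power)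
  ultimately have "[1 = - 1] (mod int q)" by (meson cong_sym cong_trans)
  then have "int q dvd 2" by (simp add: cong_iff_dvd_diff)
  then show False using q3 zdvd_imp_le[of "int q" 2] by simp
qed

lemma hfun_limit:
  assumes C: "C \<ge> 0" "\<forall>q r m E g. character_family q r m E g \<longrightarrow>
    (\<exists>l. ((\<lambda>x. ds (\<lambda>n. of_real (mangoldt n * character_family.ht q r m n)) (of_real x) - of_real (1 / real m / (x - 1))) \<longlongrightarrow> l) (at_right 1) \<and>
      norm l \<le> C * (main_err q r + sqrt_err q r))"
    and nonneg: "main_err q r + sqrt_err q r \<ge> 0"
  obtains l where "((\<lambda>x. ds (\<lambda>n. of_real (mangoldt n * hfun n)) (of_real x) - of_real (dens / (x - 1))) \<longlongrightarrow> l) (at_right 1)"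
    "norm l \<le> C * (main_err q r + sqrt_err q r)"
proof (cases "even m")
  case True
  show ?thesis
  proof (rule prime_character_generator_exists[OF prime q3])
    fix E :: "nat \<Rightarrow> complex" and g :: nat
    assume Eg: "\<And>a b. \<not> q dvd a \<Longrightarrow> \<not> q dvd b \<Longrightarrow> E (a * b) = E a * E b"
      "\<And>a. norm (E a) = 1" "\<And>a. E (a mod q) = E a"
      "\<And>a b. \<not> q dvd a \<Longrightarrow> \<not> q dvd b \<Longrightarrow> E a = E b \<longleftrightarrow> [a = b] (mod q)"
      "\<not> q dvd g" "\<And>j. E g ^ j = 1 \<longleftrightarrow> (q - 1) dvd j"
    have cf: "character_family q r m E g"
      by unfold_locales (use Eg prime q3 rm True in simp_all)
    have "character_family.ht q r m n = hfun n" for n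
      using True by (simp add: character_family.ht_def[OF cf] hfun_def dens_def)
    then show ?thesis using C(2)[rule_format, OF cf] that True by (auto simp: dens_def)
  qed
next
  case False
  have "mangoldt n * hfun n = 0" for n
    using not_dvd_power_add_1_if_odd[OF False, of n] False by (simp add: hfun_def dens_def)
  then have "ds (\<lambda>n. of_real (mangoldt n * hfun n)) s = 0" for s by (simp only: ds_def) simp
  then show ?thesis using that[of 0] False C(1) nonneg by (simp add: dens_def)
qed

lemma ds_dcoef_eq:
  assumes "Re s > 1"
  shows "ds (\<lambda>n. of_real (dcoef G n)) s = ds (\<lambda>n. of_real (mangoldt n * hfun n)) s + ds (\<lambda>n. of_real (resid n)) s"
proof -
  have "subpoly (\<lambda>n. of_real (dcoef G n) + (- 1) * of_real (mangoldt n * hfun n))"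
    by (intro subpoly_add subpoly_dcoef subpoly_mult subpoly_mangoldt_hfun subpoly_bounded[of _ 1]) simp
  then have "subpoly (\<lambda>n. of_real (resid n))" by (simp add: resid_def)
  from ds_add[OF subpoly_mangoldt_hfun this assms] show ?thesis by (simp add: resid_def)
qed

lemma nondivisibility_set_beta:
  assumes k: "k \<ge> 1" and r: "r = gcd k (q - 1)"
  shows "beta G n = (if n \<in> nondivisibility_set k q then 1 else 0)"
proof (cases "n > 0")
  case True
  have "geo_ord q (p ^ k) = G p" for p
  proof (cases "q dvd p")
    case True
    then have "q dvd p ^ k" "q dvd p ^ r"
      using k r0 dvd_trans[OF True dvd_power[of k p]] dvd_trans[OF True dvd_power[of r p]] by simp_all
    then show ?thesis by (simp add: G_def geo_ord_eq_0_iff[OF prime, THEN iffD2])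
  next
    case False
    then show ?thesis using geo_ord_power_gcd[OF prime False k] by (simp only: G_def r[symmetric])
  qed
  then show ?thesis using geo_dvd_divisor_sum_iff[OF prime True, of k] True
    by (auto simp: beta_def nondivisibility_set_def divisor_power_sum_def)
qed (auto simp: beta_def nondivisibility_set_def)

lemma set_dirichlet_series_eq:
  assumes k: "k \<ge> 1" and r: "r = gcd k (q - 1)" and s: "Re s > 1"
  shows "set_dirichlet_series (nondivisibility_set k q) s = ds (beta G) s"
proof -
  have "set_dirichlet_series (nondivisibility_set k q) s = (\<Sum>\<^sub>\<infinity>n\<in>{1..}. beta G n * of_nat n powr (- s))"
    unfolding set_dirichlet_series_def
    by (intro infsum_cong_neutral) (auto simp: nondivisibility_set_beta[OF k r] nondivisibility_set_def)
  then show ?thesis using ds_eq_infsum(2)[OF subpoly_beta s] by simp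
qed

text \<open>The coefficients are nonnegative and the term n = 1 contributes 1.\<close>

lemma ds_beta_neq_0:
  assumes "x > 1" shows "ds (beta G) (of_real x) \<noteq> 0"
proof -
  have s: "Re (of_real x) > 1" using assms by simp
  have eq: "Re (beta G n * of_nat n powr (- of_real x)) = (if beta G n = 1 then real n powr (- x) else 0)" for n
  proof -
    have "(of_nat n :: complex) powr (- of_real x) = of_real (real n powr (- x))"
      using powr_of_real[of "real n" "- x"] by simp
    then show ?thesis by (auto simp: beta_def)
  qed
  have sm: "summable (\<lambda>n. Re (beta G n * of_nat n powr (- of_real x)))"
    by (rule summable_Re[OF summable_ds[OF subpoly_beta s]])
  have "(\<Sum>n\<in>{1}. Re (beta G n * of_nat n powr (- of_real x))) \<le> (\<Sum>n. Re (beta G n * of_nat n powr (- of_real x)))"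
    by (rule sum_le_suminf[OF sm]) (unfold eq, auto)
  moreover have "beta G 1 = 1" by (simp add: beta_def)
  ultimately have "Re (ds (beta G) (of_real x)) \<ge> 1"
    unfolding ds_def Re_suminf[OF summable_ds[OF subpoly_beta s]] by (simp only: eq) simp
  then show ?thesis by auto
qed

text \<open>T'/T has coefficients c - Lambda with c = Lambda h + \<open>resid\<close>. The poles are
  distributed so that each of the first three summands has a finite limit; the last is a pole unless
  \<alpha> = 1 - \<open>dens\<close>.\<close>

lemma regularized_log_deriv_eq:
  assumes k: "k \<ge> 1" and r: "r = gcd k (q - 1)" and x: "x > 1"
  shows "regularized_log_deriv (nondivisibility_set k q) \<alpha> x =
    (of_real (1 / (x - 1)) - ds mangoldt (of_real x)) +
    (ds (\<lambda>n. of_real (mangoldt n * hfun n)) (of_real x) - of_real (dens / (x - 1))) +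
    ds (\<lambda>n. of_real (resid n)) (of_real x) + of_real ((\<alpha> - (1 - dens)) / (x - 1))"
proof -
  let ?T = "set_dirichlet_series (nondivisibility_set k q)"
  have s: "Re (of_real x) > 1" using x by simp
  have "(ds (beta G) has_field_derivative - (ds (\<lambda>n. of_real (mangoldt n - dcoef G n)) (of_real x) * ds (beta G) (of_real x))) (at (of_real x))"
    by (rule ds_log_deriv[OF subpoly_beta subpoly_diff_dcoef s]) (rule dconv_beta[OF G_neq_1])
  then have "(?T has_field_derivative - (ds (\<lambda>n. of_real (mangoldt n - dcoef G n)) (of_real x) * ds (beta G) (of_real x))) (at (of_real x))"
    by (rule has_field_derivative_transform_within_open[OF _ open_halfspace_Re_gt[of 1]])
      (use x in \<open>simp_all add: set_dirichlet_series_eq[OF k r]\<close>)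
  then have "deriv ?T (of_real x) / ?T (of_real x) = - ds (\<lambda>n. of_real (mangoldt n - dcoef G n)) (of_real x)"
    using ds_beta_neq_0[OF x] by (simp add: DERIV_imp_deriv set_dirichlet_series_eq[OF k r s])
  also have "\<dots> = ds (\<lambda>n. of_real (dcoef G n)) (of_real x) - ds mangoldt (of_real x)"
    using ds_add[OF subpoly_diff_dcoef subpoly_dcoef s, of G G] by simp
  finally show ?thesis
    unfolding regularized_log_deriv_def ds_dcoef_eq[OF s] using x
    by (simp add: diff_divide_distrib add_divide_distrib algebra_simps)
qed

text \<open>The description in \<open>euler_kronecker_exponent\<close> needs uniqueness: the
  expressions for two exponents differ by a constant over x - 1, and multiplying by x - 1 shows that
  finite limits force this constant to be 0. Positivity of 1 - \<open>dens\<close> comes from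
  \<open>dens\<close> <= 1/2.\<close>

lemma euler_kronecker_constant_eq:
  assumes k: "k \<ge> 1" and r: "r = gcd k (q - 1)"
    and l: "((\<lambda>x. ds (\<lambda>n. of_real (mangoldt n * hfun n)) (of_real x) - of_real (dens / (x - 1))) \<longlongrightarrow> l) (at_right 1)"
    and e: "((\<lambda>x. ds (\<lambda>n. of_real (resid n)) (of_real x)) \<longlongrightarrow> e) (at_right 1)"
  shows "euler_kronecker_constant (nondivisibility_set k q) = euler_mascheroni + l + e"
proof -
  let ?A = "nondivisibility_set k q"
  have ev: "\<forall>\<^sub>F x in at_right (1::real). x > 1" using eventually_at_right_1_2 by eventually_elim simp
  have lim: "(regularized_log_deriv ?A (1 - dens) \<longlongrightarrow> euler_mascheroni + l + e) (at_right 1)"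
  proof (rule Lim_transform_eventually)
    show "((\<lambda>x. (of_real (1 / (x - 1)) - ds mangoldt (of_real x)) +
      (ds (\<lambda>n. of_real (mangoldt n * hfun n)) (of_real x) - of_real (dens / (x - 1))) +
      ds (\<lambda>n. of_real (resid n)) (of_real x)) \<longlongrightarrow> euler_mascheroni + l + e) (at_right 1)"
      by (intro tendsto_add ds_mangoldt_pole_tendsto l e)
    show "\<forall>\<^sub>F x in at_right 1. (of_real (1 / (x - 1)) - ds mangoldt (of_real x)) +
      (ds (\<lambda>n. of_real (mangoldt n * hfun n)) (of_real x) - of_real (dens / (x - 1))) +
      ds (\<lambda>n. of_real (resid n)) (of_real x) = regularized_log_deriv ?A (1 - dens) x"
      using ev by eventually_elim (simp add: regularized_log_deriv_eq[OF k r])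
  qed
  have unique: "\<alpha> = 1 - dens" if L: "(regularized_log_deriv ?A \<alpha> \<longlongrightarrow> L) (at_right 1)" for \<alpha> L
  proof -
    have "((\<lambda>x. (regularized_log_deriv ?A \<alpha> x - regularized_log_deriv ?A (1 - dens) x) * of_real (x - 1)) \<longlongrightarrow>
       (L - (euler_mascheroni + l + e)) * of_real (1 - 1)) (at_right 1)"
      by (intro tendsto_intros L lim)
    moreover have "\<forall>\<^sub>F x in at_right 1. (regularized_log_deriv ?A \<alpha> x - regularized_log_deriv ?A (1 - dens) x) * of_real (x - 1) =
       of_real (\<alpha> - (1 - dens))"
      using ev
    proof eventually_elim
      case (elim x)
      have "regularized_log_deriv ?A \<alpha> x - regularized_log_deriv ?A (1 - dens) x = of_real ((\<alpha> - (1 - dens)) / (x - 1))"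
        unfolding regularized_log_deriv_def by (simp add: diff_divide_distrib)
      moreover have "complex_of_real (x - 1) \<noteq> 0" using elim by (simp del: of_real_diff)
      ultimately show ?case unfolding of_real_divide by (simp only: times_divide_eq_left nonzero_mult_div_cancel_right simp_thms)
    qed
    ultimately have "((\<lambda>x::real. complex_of_real (\<alpha> - (1 - dens))) \<longlongrightarrow> 0) (at_right 1)"
      by (auto intro: Lim_transform_eventually)
    then have "complex_of_real (\<alpha> - (1 - dens)) = 0" by (simp add: tendsto_const_iff)
    then show ?thesis unfolding of_real_eq_0_iff by simp
  qed
  have "euler_kronecker_exponent ?A = 1 - dens"
    unfolding euler_kronecker_exponent_def
  proof (rule the_equality)
    show "1 - dens > 0 \<and> (\<exists>L. (regularized_log_deriv ?A (1 - dens) \<longlongrightarrow> L) (at_right 1))"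
      using dens_bounds lim by auto
  qed (use unique in blast)
  then show ?thesis unfolding euler_kronecker_constant_def
    by (simp only:) (rule tendsto_Lim[OF trivial_limit_at_right_real lim])
qed

end

theorem theorem3:
  "\<exists>C::real. \<forall>(q::nat) (k::nat). prime q \<and> odd q \<and> k \<ge> 1 \<longrightarrow>
     (let r = gcd k (q - 1) in
        norm (euler_kronecker_constant (nondivisibility_set k q) - of_real euler_mascheroni)
          \<le> C * (ln (real q) ^ 3 / (real q powr (1 / real r) * ln (ln (real q)))
                  + real r * ln (real q) ^ 2 / sqrt (real q)))"
proof -
  obtain C where C0: "C \<ge> 0" and C: "\<forall>q r m E g. character_family q r m E g \<longrightarrow>
    (\<exists>l. ((\<lambda>x. ds (\<lambda>n. of_real (mangoldt n * character_family.ht q r m n)) (of_real x) - of_real (1 / real m / (x - 1))) \<longlongrightarrow> l) (at_right 1) \<and>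
      norm l \<le> C * (main_err q r + sqrt_err q r))"
    using ht_limit_err by (elim exE conjE) (rule that)
  have "norm (euler_kronecker_constant (nondivisibility_set k q) - of_real euler_mascheroni) \<le>
    (C + 2190) * (main_err q (gcd k (q - 1)) + sqrt_err q (gcd k (q - 1)))"
    if q: "prime q" "odd q" and k: "k \<ge> 1" for q k
  proof -
    define r where "r = gcd k (q - 1)"
    have q3: "q \<ge> 3" using q prime_ge_2_nat[of q] by (cases "q = 2") auto
    interpret divisor_setup q r by unfold_locales (use q q3 k in \<open>auto simp: r_def\<close>)
    have nn: "main_err q r \<ge> 0" "sqrt_err q r \<ge> 0" using q3 by (auto intro: main_err_nonneg simp: sqrt_err_def)
    obtain l where l: "((\<lambda>x. ds (\<lambda>n. of_real (mangoldt n * hfun n)) (of_real x) - of_real (dens / (x - 1))) \<longlongrightarrow> l) (at_right 1)"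
      "norm l \<le> C * (main_err q r + sqrt_err q r)"
      using hfun_limit[OF C0 C] nn by auto
    obtain e where e: "((\<lambda>x. ds (\<lambda>n. of_real (resid n)) (of_real x)) \<longlongrightarrow> e) (at_right 1)"
      "norm e \<le> 2190 * main_err q r + 88 * sqrt_err q r"
      using resid_limit .
    have "norm (euler_kronecker_constant (nondivisibility_set k q) - of_real euler_mascheroni) = norm (l + e)"
      unfolding euler_kronecker_constant_eq[OF k r_def l(1) e(1)] by (simp add: add.assoc)
    also have "\<dots> \<le> norm l + norm e" by (rule norm_triangle_ineq)
    also have "\<dots> \<le> (C + 2190) * (main_err q r + sqrt_err q r)" using l(2) e(2) nn by (simp add: algebra_simps)
    finally show ?thesis by (simp add: r_def)
  qed
  then show ?thesis unfolding Let_def main_err_def sqrt_err_def by (intro exI[of _ "C + 2190"]) simp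
qed

end
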